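(* Let $\Phi$ be a hidden point process and $\Xi$ the measurement point process obtained from it by thinning with constant detection probability $p_d\in(0,1]$, shifting with density $l_d(\cdot\mid x)$, and superposition with a Poisson clutter process with intensity function $l_c$, as described in the context. Put $q_d=1-p_d$ and $\tilde l_d(z\mid x)=p_d\,l_d(z\mid x)$. Then the $n$-th conditional Janossy density of $\Phi$ given that $\Xi=z_{1:m}=(z_1,\dots,z_m)$ satisfies $$ j^{(n)}_{\Phi\mid\Xi=z_{1:m}}(x_1,\dots,x_n)=\frac{j^{(n,m)}_{\Phi,\Xi=z_{1:m}}(x_1,\dots,x_n)}{j^{(m)}_\Xi(z_{1:m})},\qquad x_1,\dots,x_n\in\Lambda,\quad m,n\ge 0,$$ where (i) the $(n,m)$-th joint Janossy density of $(\Phi,\Xi)$ is given by $$ j^{(n,m)}_{\Phi,\Xi=z_{1:m}}(x_1,\dots,x_n)= j^{(n)}_\Phi(x_1,\dots,x_n)\sum_{\substack{S\subset\{1,\dots,m\}\\ |S|\le n}} \frac{n!\,q_d^{\,n-|S|}}{(n-|S|)!}\prod_{j\in\{1,\dots,m\}\setminus S} l_c(z_j)\ \sum_{\pi:S\to\{1,\dots,n\}}\ \prod_{i\in S}\tilde l_d(z_i\mid x_{\pi(i)}),$$ the inner sum being over injective mappings $\pi:S\to\{1,\dots,n\}$; and (ii) the Janossy densities of the measurement point process $\Xi$ are given by $$ j^{(m)}_\Xi(z_1,\dots,z_m)=\sum_{n\ge 0}\ \sum_{\substack{S\subset\{1,\dots,m\}\\ |S|\le n}}\ \prod_{j\in\{1,\dots,m\}\setminus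 S} l_c(z_j)\ \frac{q_d^{\,n-|S|}}{(n-|S|)!}\int_{\Lambda^n} j^{(n)}_\Phi(x_1,\dots,x_n)\prod_{i=1}^{|S|}\tilde l_d(z_{s_i}\mid x_i)\,\nu(dx_1)\cdots\nu(dx_n),\qquad m\ge 0,$$ where $s_1<\dots<s_{|S|}$ are the elements of $S$.
   Context: Setting. $\Lambda$ is a relatively compact subset of $\mathbb R^d$ and $\nu$ is a Radon reference measure on $\Lambda$. $\Phi$ is a simple and locally finite point process on $\Lambda$ with Janossy densities $j^{(n)}_\Phi:\Lambda^n\to[0,\infty)$, $n\ge 0$, with respect to $\nu$: symmetric measurable functions such that for all measurable $F\ge 0$ on finite configurations, $E[F(\Phi)]=F(\emptyset)j^{(0)}_\Phi+\sum_{n\ge1}\frac1{n!}\int_{\Lambda^n}F(\{x_1,\dots,x_n\})j^{(n)}_\Phi(x_1,\dots,x_n)\,\nu(dx_1)\cdots\nu(dx_n)$. Measurement process. Every point $x\in\Phi$ is kept with probability $p_d$ and then shifted according to the probability density function $l_d(\cdot\mid x)$ with respect to $\nu$, or deleted with probability $q_d=1-p_d$. $\Xi$ is obtained by superposing to the resulting points a Poisson point process $\Xi_c$ with intensity function $l_c$, representing clutter. Janossy densities. The probability generating functional (PGFl) of a point process with points $X_i$ is $h\mapsto E[\prod_i h(X_i)]$ for bounded measurable $h$ on $\Lambda$; write $\mathcal G_\Phi$ and $\mathcal G_{\Xi_c}$ for the PGFls of $\Phi$ and $\Xi_c$. The joint PGFl of $(\Phi,\Xi)$ is $\mathcal G_{\Phi,\Xi}(h,g)=\mathcal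 G_{\Xi_c}(g)\,\mathcal G_\Phi\big(h(\cdot)\,(q_d+\int_\Lambda g(z)\tilde l_d(z\mid\cdot)\,\nu(dz))\big)$. The joint Janossy density $j^{(n,m)}_{\Phi,\Xi=z_{1:m}}(x_1,\dots,x_n)$ is obtained by differentiating $\mathcal G_{\Phi,\Xi}(h,g)$ in $h$ in the directions of the Dirac masses at $x_1,\dots,x_n$ and in $g$ in the directions of the Dirac masses at $z_1,\dots,z_m$, and evaluating at $h=0$, $g=0$; $j^{(m)}_\Xi(z_1,\dots,z_m)$ is obtained in the same way from the marginal PGFl $\mathcal G_\Xi(g)=\mathcal G_{\Phi,\Xi}(1,g)$ at $g=0$. $|S|$ is the cardinality of $S$, and empty products equal $1$.
   Formalization: The factor n!/(n-|S|)! in (i) is removed and a factor exp(-∫ l_c dν) is added to (i) and (ii), since the printed formulas are false; densities are identified ν-almost everywhere, the ratio where j_Ξ^(m)(z_{1:m}) is nonzero. *)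

theory Defs
  imports "HOL-Probability.Probability"
begin

section \<open>Configurations and point processes\<close>

definition radon_on :: "'a::euclidean_space set \<Rightarrow> 'a measure \<Rightarrow> bool" where
  "radon_on \<Lambda> \<nu> \<longleftrightarrow>
     sets \<nu> = sets (restrict_space borel \<Lambda>) \<and>
     (\<forall>x\<in>\<Lambda>. \<exists>U. open U \<and> x \<in> U \<and> emeasure \<nu> (U \<inter> \<Lambda>) < \<infinity>) \<and>
     (\<forall>A\<in>sets \<nu>. emeasure \<nu> A = (SUP K\<in>{K. compact K \<and> K \<subseteq> A}. emeasure \<nu> K))"

text \<open>The number of points of a configuration that lie in a set.\<close>

definition points_in :: "'a set \<Rightarrow> 'a multiset \<Rightarrow> nat" where
  "points_in A \<phi> = size (filter_mset (\<lambda>x. x \<in> A) \<phi>)"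

text \<open>
  The space is bounded, so locally finite point processes have finitely many points.
  A configuration is therefore a finite multiset, identified with the counting measure
  of its points, and the configuration space carries the \<open>\<sigma>\<close>-algebra generated by the
  counting maps.
\<close>

definition configs :: "'a measure \<Rightarrow> 'a multiset measure" where
  "configs \<nu> = sigma {\<phi>. set_mset \<phi> \<subseteq> space \<nu>}
     {{\<phi>. set_mset \<phi> \<subseteq> space \<nu> \<and> points_in A \<phi> = k} | A k. A \<in> sets \<nu>}"

definition simple_point_process ::
    "'w measure \<Rightarrow> 'a measure \<Rightarrow> ('w \<Rightarrow> 'a multiset) \<Rightarrow> bool" where
  "simple_point_process P \<nu> \<Phi> \<longleftrightarrow>
     \<Phi> \<in> P \<rightarrow>\<^sub>M configs \<nu> \<and> (AE \<omega> in P. \<forall>x. count (\<Phi> \<omega>) x \<le> 1)"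

text \<open>
  An \<open>n\<close>-tuple is a function on \<open>{1..n}\<close>. For \<open>n = 0\<close> the product measure is a unit point
  mass, so the term \<open>n = 0\<close> of a sum of integrals over all powers is the value at the
  empty configuration.
\<close>

abbreviation tuples :: "'a measure \<Rightarrow> nat \<Rightarrow> (nat \<Rightarrow> 'a) measure" where
  "tuples \<nu> n \<equiv> Pi\<^sub>M {1..n} (\<lambda>_. \<nu>)"

definition config_of :: "nat \<Rightarrow> (nat \<Rightarrow> 'a) \<Rightarrow> 'a multiset" where
  "config_of n x = image_mset x (mset_set {1..n})"

definition symmetric_on_tuples :: "'a measure \<Rightarrow> nat \<Rightarrow> ((nat \<Rightarrow> 'a) \<Rightarrow> 'b) \<Rightarrow> bool" where
  "symmetric_on_tuples \<nu> n f \<longleftrightarrow>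
     (\<forall>\<sigma>. \<sigma> permutes {1..n} \<longrightarrow> (\<forall>x\<in>space (tuples \<nu> n). f (x \<circ> \<sigma>) = f x))"

definition janossy_densities ::
    "'w measure \<Rightarrow> 'a measure \<Rightarrow> ('w \<Rightarrow> 'a multiset) \<Rightarrow> (nat \<Rightarrow> (nat \<Rightarrow> 'a) \<Rightarrow> real) \<Rightarrow> bool" where
  "janossy_densities P \<nu> \<Phi> j \<longleftrightarrow>
     (\<forall>n. j n \<in> borel_measurable (tuples \<nu> n) \<and> symmetric_on_tuples \<nu> n (j n) \<and>
          (\<forall>x\<in>space (tuples \<nu> n). 0 \<le> j n x)) \<and>
     (\<forall>F\<in>borel_measurable (configs \<nu>).
        (\<integral>\<^sup>+\<omega>. F (\<Phi> \<omega>) \<partial>P) =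
        (\<Sum>n. ennreal (1 / fact n) *
              (\<integral>\<^sup>+x. F (config_of n x) * ennreal (j n x) \<partial>tuples \<nu> n)))"

section \<open>The measurement process\<close>

text \<open>
  Densities \<open>l\<close> are written with the observed point first: \<open>l z x\<close> stands for \<open>l(z | x)\<close>.
\<close>

definition shift_density :: "'a measure \<Rightarrow> ('a \<Rightarrow> 'a \<Rightarrow> real) \<Rightarrow> bool" where
  "shift_density \<nu> l \<longleftrightarrow>
     (\<lambda>(z, x). l z x) \<in> borel_measurable (\<nu> \<Otimes>\<^sub>M \<nu>) \<and>
     (\<forall>x\<in>space \<nu>. (\<forall>z\<in>space \<nu>. 0 \<le> l z x) \<and> (\<integral>\<^sup>+z. ennreal (l z x) \<partial>\<nu>) = 1)"

definition detection_law ::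
    "'a measure \<Rightarrow> real \<Rightarrow> ('a \<Rightarrow> 'a \<Rightarrow> real) \<Rightarrow> 'a \<Rightarrow> 'a multiset measure" where
  "detection_law \<nu> p l x =
     distr (measure_pmf (bernoulli_pmf p) \<Otimes>\<^sub>M density \<nu> (\<lambda>z. ennreal (l z x))) (configs \<nu>)
       (\<lambda>(kept, z). if kept then {#z#} else {#})"

text \<open>
  The points of a configuration without repeated points are thinned and shifted
  independently of each other.
\<close>

definition thinned_shifted_law ::
    "'a measure \<Rightarrow> real \<Rightarrow> ('a \<Rightarrow> 'a \<Rightarrow> real) \<Rightarrow> 'a multiset \<Rightarrow> 'a multiset measure" where
  "thinned_shifted_law \<nu> p l \<phi> =
     distr (Pi\<^sub>M (set_mset \<phi>) (detection_law \<nu> p l)) (configs \<nu>)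
       (\<lambda>\<psi>. \<Sum>x\<in>set_mset \<phi>. \<psi> x)"

text \<open>\<open>\<Psi>\<close> has conditional law \<open>thinned_shifted_law \<nu> p l \<phi>\<close> given \<open>\<Phi> = \<phi>\<close>.\<close>

definition thinned_shifted ::
    "'w measure \<Rightarrow> 'a measure \<Rightarrow> real \<Rightarrow> ('a \<Rightarrow> 'a \<Rightarrow> real) \<Rightarrow>
     ('w \<Rightarrow> 'a multiset) \<Rightarrow> ('w \<Rightarrow> 'a multiset) \<Rightarrow> bool" where
  "thinned_shifted P \<nu> p l \<Phi> \<Psi> \<longleftrightarrow>
     \<Psi> \<in> P \<rightarrow>\<^sub>M configs \<nu> \<and>
     (\<forall>A\<in>sets (configs \<nu>). \<forall>B\<in>sets (configs \<nu>).
        emeasure P {\<omega>\<in>space P. \<Phi> \<omega> \<in> A \<and> \<Psi> \<omega> \<in> B} =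
        (\<integral>\<^sup>+\<omega>. indicator A (\<Phi> \<omega>) * emeasure (thinned_shifted_law \<nu> p l (\<Phi> \<omega>)) B \<partial>P))"

text \<open>The intensity is integrable because configurations are finite.\<close>

definition poisson_process ::
    "'w measure \<Rightarrow> 'a measure \<Rightarrow> ('a \<Rightarrow> real) \<Rightarrow> ('w \<Rightarrow> 'a multiset) \<Rightarrow> bool" where
  "poisson_process P \<nu> l C \<longleftrightarrow>
     C \<in> P \<rightarrow>\<^sub>M configs \<nu> \<and>
     l \<in> borel_measurable \<nu> \<and> (\<forall>z\<in>space \<nu>. 0 \<le> l z) \<and> (\<integral>\<^sup>+z. ennreal (l z) \<partial>\<nu>) < \<infinity> \<and>
     (\<forall>A\<in>sets \<nu>. \<forall>k.
        measure P {\<omega>\<in>space P. points_in A (C \<omega>) = k} =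
        (\<integral>z\<in>A. l z \<partial>\<nu>) ^ k / fact k * exp (- (\<integral>z\<in>A. l z \<partial>\<nu>))) \<and>
     (\<forall>(I::nat set) A. finite I \<and> (\<forall>i\<in>I. A i \<in> sets \<nu>) \<and> disjoint_family_on A I \<longrightarrow>
        prob_space.indep_vars P (\<lambda>_. count_space UNIV) (\<lambda>i \<omega>. points_in (A i) (C \<omega>)) I)"

text \<open>The clutter is independent of \<open>(\<Phi>, \<Psi>)\<close>: the joint law is the product of the laws.\<close>

definition measurement_process ::
    "'w measure \<Rightarrow> 'a measure \<Rightarrow> real \<Rightarrow> ('a \<Rightarrow> 'a \<Rightarrow> real) \<Rightarrow> ('a \<Rightarrow> real) \<Rightarrow>
     ('w \<Rightarrow> 'a multiset) \<Rightarrow> ('w \<Rightarrow> 'a multiset) \<Rightarrow> bool" where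
  "measurement_process P \<nu> p ld lc \<Phi> \<Xi> \<longleftrightarrow>
     (\<exists>\<Psi> C. thinned_shifted P \<nu> p ld \<Phi> \<Psi> \<and> poisson_process P \<nu> lc C \<and>
        distr P ((configs \<nu> \<Otimes>\<^sub>M configs \<nu>) \<Otimes>\<^sub>M configs \<nu>) (\<lambda>\<omega>. ((\<Phi> \<omega>, \<Psi> \<omega>), C \<omega>)) =
          distr P (configs \<nu> \<Otimes>\<^sub>M configs \<nu>) (\<lambda>\<omega>. (\<Phi> \<omega>, \<Psi> \<omega>)) \<Otimes>\<^sub>M distr P (configs \<nu>) C \<and>
        (\<forall>\<omega>\<in>space P. \<Xi> \<omega> = \<Psi> \<omega> + C \<omega>))"

section \<open>Generating functionals and their derivatives\<close>

definition joint_pgfl ::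
    "'w measure \<Rightarrow> ('w \<Rightarrow> 'a multiset) \<Rightarrow> ('w \<Rightarrow> 'a multiset) \<Rightarrow>
     ('a \<Rightarrow> real) \<Rightarrow> ('a \<Rightarrow> real) \<Rightarrow> real" where
  "joint_pgfl P \<Phi> \<Xi> h g = (\<integral>\<omega>. (\<Prod>x\<in>#\<Phi> \<omega>. h x) * (\<Prod>z\<in>#\<Xi> \<omega>. g z) \<partial>P)"

text \<open>
  \<open>has_mixed_derivative G ds h g D\<close>: the mixed directional derivative of \<open>G\<close> at \<open>(h, g)\<close>,
  one differentiation for each direction in \<open>ds\<close>, exists and equals \<open>D\<close>. Each direction is
  a pair of increments, of \<open>h\<close> and of \<open>g\<close>.
\<close>

primrec has_mixed_derivative ::
    "(('a \<Rightarrow> real) \<Rightarrow> ('a \<Rightarrow> real) \<Rightarrow> real) \<Rightarrow> (('a \<Rightarrow> real) \<times> ('a \<Rightarrow> real)) list \<Rightarrow>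
     ('a \<Rightarrow> real) \<Rightarrow> ('a \<Rightarrow> real) \<Rightarrow> real \<Rightarrow> bool" where
  "has_mixed_derivative G [] h g D \<longleftrightarrow> G h g = D"
| "has_mixed_derivative G (d # ds) h g D \<longleftrightarrow>
     (\<exists>f. (\<forall>\<^sub>F t in nhds 0.
             has_mixed_derivative G ds (\<lambda>x. h x + t * fst d x) (\<lambda>z. g z + t * snd d z) (f t)) \<and>
          (f has_real_derivative D) (at 0))"

definition test_directions :: "'a measure \<Rightarrow> nat \<Rightarrow> (nat \<Rightarrow> 'a \<Rightarrow> real) \<Rightarrow> bool" where
  "test_directions \<nu> n \<eta> \<longleftrightarrow>
     (\<forall>i\<in>{1..n}. \<eta> i \<in> borel_measurable \<nu> \<and> (\<exists>B. \<forall>x\<in>space \<nu>. 0 \<le> \<eta> i x \<and> \<eta> i x \<le> B))"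

text \<open>
  A Dirac mass is not an admissible argument of a generating functional. The derivative in
  the directions of Dirac masses is understood as the density, with respect to the product
  of the reference measures, of the multilinear form that maps bounded measurable directions
  to the mixed derivative: formally \<open>\<eta> = \<integral> \<eta>(x) \<delta>\<^sub>x \<nu>(dx)\<close>. Nonnegative directions suffice by
  multilinearity. Densities take values in \<open>[0, \<infinity>]\<close> and are unique up to null sets.
\<close>

definition joint_janossy_density ::
    "'w measure \<Rightarrow> 'a measure \<Rightarrow> ('w \<Rightarrow> 'a multiset) \<Rightarrow> ('w \<Rightarrow> 'a multiset) \<Rightarrow> nat \<Rightarrow> nat \<Rightarrow>
     ((nat \<Rightarrow> 'a) \<Rightarrow> (nat \<Rightarrow> 'a) \<Rightarrow> ennreal) \<Rightarrow> bool" where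
  "joint_janossy_density P \<nu> \<Phi> \<Xi> n m J \<longleftrightarrow>
     (\<lambda>(x, z). J x z) \<in> borel_measurable (tuples \<nu> n \<Otimes>\<^sub>M tuples \<nu> m) \<and>
     (\<forall>\<eta> \<theta>. test_directions \<nu> n \<eta> \<and> test_directions \<nu> m \<theta> \<longrightarrow>
        (let I = (\<integral>\<^sup>+(x, z). ennreal ((\<Prod>i=1..n. \<eta> i (x i)) * (\<Prod>k=1..m. \<theta> k (z k))) * J x z
                    \<partial>(tuples \<nu> n \<Otimes>\<^sub>M tuples \<nu> m))
         in I < \<infinity> \<and>
            has_mixed_derivative (joint_pgfl P \<Phi> \<Xi>)
              (map (\<lambda>i. (\<eta> i, \<lambda>_. 0)) [1..<Suc n] @ map (\<lambda>k. (\<lambda>_. 0, \<theta> k)) [1..<Suc m])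
              (\<lambda>_. 0) (\<lambda>_. 0) (enn2real I)))"

text \<open>The same for the marginal generating functional \<open>g \<mapsto> joint_pgfl P \<Phi> \<Xi> 1 g\<close>.\<close>

definition observation_janossy_density ::
    "'w measure \<Rightarrow> 'a measure \<Rightarrow> ('w \<Rightarrow> 'a multiset) \<Rightarrow> ('w \<Rightarrow> 'a multiset) \<Rightarrow> nat \<Rightarrow>
     ((nat \<Rightarrow> 'a) \<Rightarrow> ennreal) \<Rightarrow> bool" where
  "observation_janossy_density P \<nu> \<Phi> \<Xi> m J \<longleftrightarrow>
     J \<in> borel_measurable (tuples \<nu> m) \<and>
     (\<forall>\<theta>. test_directions \<nu> m \<theta> \<longrightarrow>
        (let I = (\<integral>\<^sup>+z. ennreal (\<Prod>k=1..m. \<theta> k (z k)) * J z \<partial>tuples \<nu> m)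
         in I < \<infinity> \<and>
            has_mixed_derivative (joint_pgfl P \<Phi> \<Xi>) (map (\<lambda>k. (\<lambda>_. 0, \<theta> k)) [1..<Suc m])
              (\<lambda>_. 1) (\<lambda>_. 0) (enn2real I)))"

section \<open>Conditional Janossy densities\<close>

definition janossy_kernel ::
    "'a measure \<Rightarrow> ('a multiset \<Rightarrow> nat \<Rightarrow> (nat \<Rightarrow> 'a) \<Rightarrow> ennreal) \<Rightarrow> bool" where
  "janossy_kernel \<nu> K \<longleftrightarrow>
     (\<forall>n. (\<lambda>(\<xi>, x). K \<xi> n x) \<in> borel_measurable (configs \<nu> \<Otimes>\<^sub>M tuples \<nu> n) \<and>
          (\<forall>\<xi>\<in>space (configs \<nu>). symmetric_on_tuples \<nu> n (K \<xi> n)))"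

text \<open>
  \<open>K \<xi>\<close> are Janossy densities of the conditional law of \<open>\<Phi>\<close> given \<open>\<Xi> = \<xi>\<close>: the defining
  identity of Janossy densities with \<open>E[F(\<Phi>) | \<Xi>]\<close> in place of \<open>E[F(\<Phi>)]\<close>.
\<close>

definition conditional_janossy_densities ::
    "'w measure \<Rightarrow> 'a measure \<Rightarrow> ('w \<Rightarrow> 'a multiset) \<Rightarrow> ('w \<Rightarrow> 'a multiset) \<Rightarrow>
     ('a multiset \<Rightarrow> nat \<Rightarrow> (nat \<Rightarrow> 'a) \<Rightarrow> ennreal) \<Rightarrow> bool" where
  "conditional_janossy_densities P \<nu> \<Phi> \<Xi> K \<longleftrightarrow>
     janossy_kernel \<nu> K \<and>
     (\<forall>F\<in>borel_measurable (configs \<nu>).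
        AE \<omega> in P.
          nn_cond_exp P (vimage_algebra (space P) \<Xi> (configs \<nu>)) (\<lambda>\<omega>. F (\<Phi> \<omega>)) \<omega> =
          (\<Sum>n. ennreal (1 / fact n) *
                (\<integral>\<^sup>+x. F (config_of n x) * K (\<Xi> \<omega>) n x \<partial>tuples \<nu> n)))"

section \<open>The two explicit formulas\<close>

text \<open>
  Evaluating the Poisson generating functional \<open>exp (\<integral> (g - 1) lc d\<nu>)\<close> at \<open>g = 0\<close> gives the
  factor \<open>exp (- \<integral> lc d\<nu>)\<close> in both formulas, the void probability of the clutter. It
  cancels in the conditional densities and is often suppressed. Differentiating
  \<open>\<Prod>i. q + \<integral> g(z) lt(z | x i) \<nu>(dz)\<close> gives each injection \<open>\<pi>\<close> the weight \<open>q ^ (n - |S|)\<close>: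
  the number \<open>n! / (n - |S|)!\<close> of injections appears only after integration over \<open>x\<close>, where
  all of them contribute equally. It must not multiply the sum over \<open>\<pi>\<close>.
\<close>

definition joint_formula ::
    "'a measure \<Rightarrow> (nat \<Rightarrow> (nat \<Rightarrow> 'a) \<Rightarrow> real) \<Rightarrow> real \<Rightarrow> ('a \<Rightarrow> 'a \<Rightarrow> real) \<Rightarrow> ('a \<Rightarrow> real) \<Rightarrow>
     nat \<Rightarrow> nat \<Rightarrow> (nat \<Rightarrow> 'a) \<Rightarrow> (nat \<Rightarrow> 'a) \<Rightarrow> real" where
  "joint_formula \<nu> j q lt lc n m x z =
     exp (- (\<integral>y. lc y \<partial>\<nu>)) * j n x *
     (\<Sum>S | S \<subseteq> {1..m} \<and> card S \<le> n.
        q ^ (n - card S) * (\<Prod>k\<in>{1..m} - S. lc (z k)) *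
        (\<Sum>\<pi> | \<pi> \<in> S \<rightarrow>\<^sub>E {1..n} \<and> inj_on \<pi> S. \<Prod>i\<in>S. lt (z i) (x (\<pi> i))))"

definition observation_formula ::
    "'a measure \<Rightarrow> (nat \<Rightarrow> (nat \<Rightarrow> 'a) \<Rightarrow> real) \<Rightarrow> real \<Rightarrow> ('a \<Rightarrow> 'a \<Rightarrow> real) \<Rightarrow> ('a \<Rightarrow> real) \<Rightarrow>
     nat \<Rightarrow> (nat \<Rightarrow> 'a) \<Rightarrow> ennreal" where
  "observation_formula \<nu> j q lt lc m z =
     ennreal (exp (- (\<integral>y. lc y \<partial>\<nu>))) *
     (\<Sum>n. \<Sum>S | S \<subseteq> {1..m} \<and> card S \<le> n.
        ennreal ((\<Prod>k\<in>{1..m} - S. lc (z k)) * (q ^ (n - card S) / fact (n - card S))) *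
        (\<integral>\<^sup>+x. ennreal (j n x *
           (\<Prod>i=1..card S. lt (z (sorted_list_of_set S ! (i - 1))) (x i))) \<partial>tuples \<nu> n))"

end

(*
  The laws involved are identified through their generating functionals. The generating functional
  of Xi given Phi is a product over the points of Phi of the functions q + \<integral> g(z) lt(z | x) \<nu>(dz), times
  the Poisson factor exp (\<integral> (g - 1) lc). Expanding the product over the points into sums over partial
  injections from observations to hidden points shows that it equals the generating functional
  built from the explicit joint formula; as products of powers of counting variables determine a
  measure on configurations, the joint formula is a density of the joint law.
  The mixed derivative of the generating functional at 0 in directions \<eta>, \<theta> is the expectation of
  symmetrized products of \<eta> over Phi and of \<theta> over Xi. Integrating against a symmetric density
  undoes the symmetrization, so these moments determine the density almost everywhere. The same moments
  inserted into the defining property of the conditional expectation give the quotient formula.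
*)
theory Submission
  imports Defs
begin

text \<open>Thinning is defined only through probabilities of rectangles, with a conditional law
  that reads the set of points of a configuration and is not assumed to depend measurably on it.
  Measurability is therefore derived from generating functionals, off the null set of configurations
  with repeated points. The points of both processes are collected in one multiset over a disjoint
  sum type, so that the joint and the marginal derivatives are instances of one differentiation
  theorem. This beats the polynomial number of ways to place the directions and justifies
  differentiation under the expectation without moment bounds on the number of points. The quotient
  is treated in the multiplied form \<open>jf = L * obs\<close>, which stays meaningful where the
  denominator vanishes, because the joint formula vanishes almost everywhere there.\<close>

section \<open>Measurability on configurations\<close>

text \<open>Local finiteness covers the space by open sets of finite mass; the Lindelof property
  leaves countably many of them.\<close>

lemma radon_on_sigma_finite:
  fixes \<nu> :: "'a::euclidean_space measure"
  assumes "radon_on \<Lambda> \<nu>"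
  shows "sigma_finite_measure \<nu>"
proof
  have sets: "sets \<nu> = sets (restrict_space borel \<Lambda>)"
    and fin: "\<And>x. x \<in> \<Lambda> \<Longrightarrow> \<exists>U. open U \<and> x \<in> U \<and> emeasure \<nu> (U \<inter> \<Lambda>) < \<infinity>"
    using assms by (auto simp: radon_on_def)
  have sp: "space \<nu> = \<Lambda>"
    using sets_eq_imp_space_eq[OF sets] by (simp add: space_restrict_space)
  obtain \<F> where \<F>: "\<F> \<subseteq> {U. open U \<and> emeasure \<nu> (U \<inter> \<Lambda>) < \<infinity>}" "countable \<F>"
    "\<Union>\<F> = \<Union>{U. open U \<and> emeasure \<nu> (U \<inter> \<Lambda>) < \<infinity>}"
    by (rule Lindelof[of "{U. open U \<and> emeasure \<nu> (U \<inter> \<Lambda>) < \<infinity>}"]) auto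
  show "\<exists>A. countable A \<and> A \<subseteq> sets \<nu> \<and> \<Union>A = space \<nu> \<and> (\<forall>a\<in>A. emeasure \<nu> a \<noteq> \<infinity>)"
  proof (intro exI conjI)
    show "countable ((\<lambda>U. U \<inter> \<Lambda>) ` \<F>)"
      using \<F> by simp
    show "(\<lambda>U. U \<inter> \<Lambda>) ` \<F> \<subseteq> sets \<nu>"
    proof (rule image_subsetI)
      fix U assume "U \<in> \<F>"
      then have "open U" using \<F>(1) by auto
      then show "U \<inter> \<Lambda> \<in> sets \<nu>"
        unfolding sets sets_restrict_space by (auto simp: Int_commute intro!: image_eqI[of _ _ U])
    qed
    show "\<Union>((\<lambda>U. U \<inter> \<Lambda>) ` \<F>) = space \<nu>"
    proof -
      have "\<Lambda> \<subseteq> \<Union>\<F>"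
        unfolding \<F>(3) using fin by (intro subsetI) (metis (mono_tags, lifting) UnionI mem_Collect_eq)
      then show ?thesis unfolding sp by auto
    qed
    show "\<forall>a\<in>(\<lambda>U. U \<inter> \<Lambda>) ` \<F>. emeasure \<nu> a \<noteq> \<infinity>"
      using \<F>(1) by auto
  qed
qed

lemma points_in_empty [simp]: "points_in A {#} = 0"
  by (simp add: points_in_def)

lemma points_in_add_mset [simp]:
  "points_in A (add_mset x \<phi>) = of_bool (x \<in> A) + points_in A \<phi>"
  by (simp add: points_in_def)

lemma points_in_plus [simp]: "points_in A (\<phi> + \<psi>) = points_in A \<phi> + points_in A \<psi>"
  by (simp add: points_in_def)

lemma points_in_sum: "finite I \<Longrightarrow> points_in A (\<Sum>i\<in>I. \<phi> i) = (\<Sum>i\<in>I. points_in A (\<phi> i))"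
  by (induction I rule: finite_induct) auto

lemma configs_sets_subset:
  "{{\<phi>. set_mset \<phi> \<subseteq> space \<nu> \<and> points_in A \<phi> = k} | A k. A \<in> sets \<nu>} \<subseteq> Pow {\<phi>. set_mset \<phi> \<subseteq> space \<nu>}"
  by auto

lemma space_configs: "space (configs \<nu>) = {\<phi>. set_mset \<phi> \<subseteq> space \<nu>}"
  unfolding configs_def by (rule space_measure_of[OF configs_sets_subset])

lemma sets_configs: "sets (configs \<nu>) = sigma_sets {\<phi>. set_mset \<phi> \<subseteq> space \<nu>}
     {{\<phi>. set_mset \<phi> \<subseteq> space \<nu> \<and> points_in A \<phi> = k} | A k. A \<in> sets \<nu>}"
  unfolding configs_def by (rule sets_measure_of[OF configs_sets_subset])

lemma measurable_points_in [measurable]: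
  assumes "A \<in> sets \<nu>"
  shows "points_in A \<in> configs \<nu> \<rightarrow>\<^sub>M count_space UNIV"
proof (rule measurableI)
  fix S :: "nat set"
  have "points_in A -` S \<inter> space (configs \<nu>) = (\<Union>k\<in>S. {\<phi>. set_mset \<phi> \<subseteq> space \<nu> \<and> points_in A \<phi> = k})"
    by (auto simp: space_configs)
  also have "\<dots> \<in> sets (configs \<nu>)"
    using assms by (intro sets.countable_UN' sets.sets_into_space) (auto simp: sets_configs)
  finally show "points_in A -` S \<inter> space (configs \<nu>) \<in> sets (configs \<nu>)" .
qed simp

text \<open>The generating sets of \<open>configs\<close> are preimages under counting maps, so
  counts decide measurability once the configurations stay inside the space.\<close>

lemma measurable_configsI:
  assumes "\<And>\<omega>. \<omega> \<in> space M \<Longrightarrow> set_mset (f \<omega>) \<subseteq> space \<nu>"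
    and "\<And>A. A \<in> sets \<nu> \<Longrightarrow> (\<lambda>\<omega>. points_in A (f \<omega>)) \<in> M \<rightarrow>\<^sub>M count_space UNIV"
  shows "f \<in> M \<rightarrow>\<^sub>M configs \<nu>"
  unfolding configs_def
proof (rule measurable_measure_of[OF configs_sets_subset])
  show "f \<in> space M \<rightarrow> {\<phi>. set_mset \<phi> \<subseteq> space \<nu>}"
    using assms(1) by auto
  fix B assume "B \<in> {{\<phi>. set_mset \<phi> \<subseteq> space \<nu> \<and> points_in A \<phi> = k} | A k. A \<in> sets \<nu>}"
  then obtain A k where A: "A \<in> sets \<nu>" and B: "B = {\<phi>. set_mset \<phi> \<subseteq> space \<nu> \<and> points_in A \<phi> = k}"
    by auto
  have "f -` B \<inter> space M = (\<lambda>\<omega>. points_in A (f \<omega>)) -` {k} \<inter> space M"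
    using assms(1) by (auto simp: B)
  also have "\<dots> \<in> sets M"
    using assms(2)[OF A] by (rule measurable_sets) simp
  finally show "f -` B \<inter> space M \<in> sets M" .
qed

lemma measurable_configs_plus [measurable]:
  assumes f: "f \<in> M \<rightarrow>\<^sub>M configs \<nu>" and g: "g \<in> M \<rightarrow>\<^sub>M configs \<nu>"
  shows "(\<lambda>\<omega>. f \<omega> + g \<omega>) \<in> M \<rightarrow>\<^sub>M configs \<nu>"
proof (rule measurable_configsI)
  fix \<omega> assume "\<omega> \<in> space M"
  then show "set_mset (f \<omega> + g \<omega>) \<subseteq> space \<nu>"
    using measurable_space[OF f] measurable_space[OF g] by (auto simp: space_configs)
next
  fix A assume A [measurable]: "A \<in> sets \<nu>"
  have [measurable]: "f \<in> M \<rightarrow>\<^sub>M configs \<nu>" "g \<in> M \<rightarrow>\<^sub>M configs \<nu>" by fact+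
  show "(\<lambda>\<omega>. points_in A (f \<omega> + g \<omega>)) \<in> M \<rightarrow>\<^sub>M count_space UNIV"
    by simp
qed

text \<open>Group the points by the value of \<open>g\<close>. A product over points becomes a
  finite product of powers of counts of level sets, which serves both measurability and the Poisson
  computation.\<close>

lemma prod_mset_finite_range:
  fixes g :: "'a \<Rightarrow> 'b::comm_monoid_mult"
  assumes "finite (g ` S)" "set_mset \<phi> \<subseteq> S"
  shows "(\<Prod>x\<in>#\<phi>. g x) = (\<Prod>c\<in>g ` S. c ^ points_in (g -` {c} \<inter> S) \<phi>)"
  using assms(2)
proof (induction \<phi>)
  case (add x \<phi>)
  have "(\<Prod>c\<in>g ` S. c ^ points_in (g -` {c} \<inter> S) (add_mset x \<phi>)) =
      (\<Prod>c\<in>g ` S. (if c = g x then c else 1) * c ^ points_in (g -` {c} \<inter> S) \<phi>)"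
    using add.prems by (intro prod.cong) auto
  also have "\<dots> = g x * (\<Prod>c\<in>g ` S. c ^ points_in (g -` {c} \<inter> S) \<phi>)"
    using add.prems assms(1) by (simp add: prod.distrib prod.delta)
  finally show ?case
    using add by simp
qed simp

lemma tendsto_prod_mset:
  fixes f :: "'i \<Rightarrow> 'a \<Rightarrow> 'b::real_normed_field"
  assumes "\<And>x. x \<in># \<phi> \<Longrightarrow> ((\<lambda>i. f i x) \<longlongrightarrow> g x) F"
  shows "((\<lambda>i. \<Prod>x\<in>#\<phi>. f i x) \<longlongrightarrow> (\<Prod>x\<in>#\<phi>. g x)) F"
  using assms by (induction \<phi>) (auto intro!: tendsto_mult)

text \<open>For simple \<open>g\<close> the product is a finite product of powers of counting
  variables. The general case is a pointwise limit, since a product over finitely many points is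
  continuous in its factors.\<close>

lemma borel_measurable_prod_mset [measurable]:
  fixes g :: "'a \<Rightarrow> real"
  assumes "g \<in> borel_measurable \<nu>"
  shows "(\<lambda>\<phi>. \<Prod>x\<in>#\<phi>. g x) \<in> borel_measurable (configs \<nu>)"
proof -
  obtain s where s: "\<And>i. simple_function \<nu> (s i)" "\<And>x. x \<in> space \<nu> \<Longrightarrow> (\<lambda>i. s i x) \<longlonglongrightarrow> g x"
    using borel_measurable_implies_sequence_metric[OF assms, of 0] by blast
  have "(\<lambda>\<phi>. \<Prod>x\<in>#\<phi>. s i x) \<in> borel_measurable (configs \<nu>)" for i
  proof (subst measurable_cong)
    fix \<phi> assume "\<phi> \<in> space (configs \<nu>)"
    then show "(\<Prod>x\<in>#\<phi>. s i x) = (\<Prod>c\<in>s i ` space \<nu>. c ^ points_in (s i -` {c} \<inter> space \<nu>) \<phi>)"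
      using s(1)[of i] by (intro prod_mset_finite_range) (auto simp: simple_function_def space_configs)
  next
    have "s i -` {c} \<inter> space \<nu> \<in> sets \<nu>" for c
      using s(1)[of i] by (rule simple_functionD)
    then show "(\<lambda>\<phi>. \<Prod>c\<in>s i ` space \<nu>. c ^ points_in (s i -` {c} \<inter> space \<nu>) \<phi>) \<in> borel_measurable (configs \<nu>)"
      by measurable
  qed
  then show ?thesis
    by (rule borel_measurable_LIMSEQ_real[rotated])
       (auto intro!: tendsto_prod_mset s(2) simp: space_configs)
qed

text \<open>A power of a counting variable is absorbed into the test function. This is the closure
  property that the criteria on counting variables ask of products over points.\<close>

lemma prod_mset_power_points_in:
  fixes t :: "'b::comm_monoid_mult"
  shows "t ^ points_in A \<phi> * (\<Prod>x\<in>#\<phi>. g x) = (\<Prod>x\<in>#\<phi>. (if x \<in> A then t else 1) * g x)"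
  by (induction \<phi>) (auto simp: mult_ac)

lemma prod_mset_nonneg:
  fixes g :: "'a \<Rightarrow> 'b::linordered_semidom"
  shows "(\<And>x. x \<in># \<phi> \<Longrightarrow> 0 \<le> g x) \<Longrightarrow> 0 \<le> (\<Prod>x\<in>#\<phi>. g x)"
  by (induction \<phi>) auto

lemma prod_mset_le_1:
  fixes g :: "'a \<Rightarrow> 'b::linordered_semidom"
  shows "(\<And>x. x \<in># \<phi> \<Longrightarrow> 0 \<le> g x \<and> g x \<le> 1) \<Longrightarrow> (\<Prod>x\<in>#\<phi>. g x) \<le> 1"
proof (induction \<phi>)
  case (add x \<phi>)
  then have "0 \<le> (\<Prod>x\<in>#\<phi>. g x)" by (intro prod_mset_nonneg) auto
  with add show ?case by (simp add: mult_le_one)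
qed simp

section \<open>Measurability and uniqueness of laws from generating functions of counts\<close>

section \<open>Kernels determined by generating functions of counting variables\<close>

text \<open>
  The indicator of \<open>c i = k\<close> is the limit as \<open>M \<rightarrow> \<infinity>\<close> of \<open>2 ^ (k * M) * (2 ^ (- M)) ^ c i * (1 - of_bool (c i < k))\<close>.
  By induction on \<open>k\<close> this expresses the probabilities of the sets \<open>{w. \<forall>(i, k)\<in>J. c i w = k}\<close> through
  integrals of the functions in \<open>V\<close>.
\<close>

lemma measurable_kernel_counts:
  fixes c :: "'i \<Rightarrow> 'b \<Rightarrow> nat" and V :: "('b \<Rightarrow> real) \<Rightarrow> bool"
  assumes c: "\<And>i. i \<in> I \<Longrightarrow> c i \<in> N \<rightarrow>\<^sub>M count_space UNIV"
    and gen: "sets N \<subseteq> sigma_sets (space N) {{w \<in> space N. c i w = k} | i k. i \<in> I}"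
    and K: "\<And>a. a \<in> space A \<Longrightarrow> subprob_space (K a)" "\<And>a. a \<in> space A \<Longrightarrow> sets (K a) = sets N"
    and V1: "V (\<lambda>_. 1)"
    and Vmult: "\<And>F i t. V F \<Longrightarrow> i \<in> I \<Longrightarrow> 0 < t \<Longrightarrow> t \<le> 1 \<Longrightarrow> V (\<lambda>w. t ^ c i w * F w)"
    and Vmeas: "\<And>F. V F \<Longrightarrow> F \<in> borel_measurable N"
    and Vbound: "\<And>F w. V F \<Longrightarrow> w \<in> space N \<Longrightarrow> \<bar>F w\<bar> \<le> 1"
    and VK: "\<And>F. V F \<Longrightarrow> (\<lambda>a. \<integral>w. F w \<partial>K a) \<in> borel_measurable A"
  shows "K \<in> A \<rightarrow>\<^sub>M subprob_algebra N"
proof -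
  \<comment> \<open>\<open>J\<close> may prescribe two values for the same counter, in which case
    \<open>E J\<close> is empty. Intersections then correspond to unions of index sets, and the sets
    \<open>E J\<close> form a pi-system without case distinctions.\<close>
  define E where "E J = {w \<in> space N. \<forall>(i, k)\<in>J. c i w = k}" for J
  define G where "G = {E J | J. finite J \<and> J \<subseteq> I \<times> UNIV}"
  note [measurable] = c Vmeas
  have E_meas [measurable]: "E J \<in> sets N" if "finite J" "J \<subseteq> I \<times> UNIV" for J
    unfolding E_def case_prod_beta
  proof (rule sets.sets_Collect_finite_All[OF _ that(1)])
    fix x assume "x \<in> J"
    with that have "fst x \<in> I" by auto
    from c[OF this] show "{w \<in> space N. c (fst x) w = snd x} \<in> sets N"
      by measurable
  qed
  have fin: "finite_measure (K a)" if "a \<in> space A" for a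
    using K(1)[OF that] by (rule subprob_space.axioms)
  have int: "integrable (K a) F"
    if "a \<in> space A" "F \<in> borel_measurable N" "\<And>w. w \<in> space N \<Longrightarrow> \<bar>F w\<bar> \<le> B" for a F and B :: real
    using that(2,3) fin[OF that(1)] sets_eq_imp_space_eq[OF K(2)[OF that(1)]] K(2)[OF that(1)]
    by (intro finite_measure.integrable_const_bound[where B = B]) (auto cong: measurable_cong_sets)
  \<comment> \<open>\<open>F\<close> stays arbitrary in the induction because a step replaces it by
    \<open>F' M\<close>, the same weight times a power of a counter.\<close>
  have main: "V F \<longrightarrow> (\<lambda>a. \<integral>w. indicator (E J) w * F w \<partial>K a) \<in> borel_measurable A"
    if "finite J" "J \<subseteq> I \<times> UNIV" for J F
    using that
  proof (induction J arbitrary: F rule: finite_induct)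
    case empty
    have *: "(\<integral>w. indicator (E {}) w * F w \<partial>K a) = (\<integral>w. F w \<partial>K a)" if "a \<in> space A" for a
      using sets_eq_imp_space_eq[OF K(2)[OF that]]
      by (intro Bochner_Integration.integral_cong) (auto simp: E_def)
    show ?case
      using VK[of F] by (auto simp: * cong: measurable_cong)
  next
    case (insert ik J)
    obtain i k where ik: "ik = (i, k)" by force
    have i: "i \<in> I" and J: "J \<subseteq> I \<times> UNIV" "finite J" using insert ik by auto
    have [measurable]: "c i \<in> N \<rightarrow>\<^sub>M count_space UNIV" using i c by auto
    note EJ [measurable] = E_meas[OF J(2,1)]
    define H where "H k = E J \<inter> {w \<in> space N. c i w = k}" for k
    have H_meas [measurable]: "H k \<in> sets N" for k
      unfolding H_def by measurable
    \<comment> \<open>The sets \<open>H n\<close> with \<open>n < k\<close> are the lower levels of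
      the new counter. Strong induction supplies their integrals, the outer induction that of
      \<open>E J\<close>.\<close>
    have "\<forall>F. V F \<longrightarrow> (\<lambda>a. \<integral>w. indicator (H k) w * F w \<partial>K a) \<in> borel_measurable A"
    proof (induction k rule: less_induct)
      case (less k)
      show ?case
      proof (intro allI impI)
        fix F assume F: "V F"
        note [measurable] = Vmeas[OF F]
        define L where "L M w = (2 ^ k) ^ M * ((1/2) ^ M) ^ c i w * (1 - (\<Sum>n<k. indicator (H n) w)) * indicator (E J) w * F w"
          for M w
        define F' where "F' M w = ((1/2) ^ M) ^ c i w * F w" for M w
        have VF': "V (F' M)" for M
          unfolding F'_def using F i by (intro Vmult) (auto simp: power_le_one)
        \<comment> \<open>The power of the counter goes into the weight \<open>F' M\<close>, so that
          \<open>L M\<close> is a combination of functions whose integrals are already known to be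
          measurable.\<close>
        have L_eq: "L M w = (2 ^ k) ^ M * (indicator (E J) w * F' M w - (\<Sum>n<k. indicator (H n) w * F' M w))" for M w
        proof -
          have "indicator (H n) w * F' M w = indicator (H n) w * (indicator (E J) w * F' M w)" for n
            by (auto simp: H_def split: split_indicator)
          then have "(\<Sum>n<k. indicator (H n) w * F' M w) = (\<Sum>n<k. indicator (H n) w) * (indicator (E J) w * F' M w)"
            by (simp only: sum_distrib_right)
          then show ?thesis
            by (simp add: L_def F'_def algebra_simps)
        qed
        have ind: "(\<Sum>n<k. indicator (H n) w) = (of_bool (c i w < k) :: real)" if "w \<in> E J" for w
        proof -
          have "(\<Sum>n<k. indicator (H n) w) = (\<Sum>n<k. if c i w = n then 1 else 0 :: real)"
            using that by (intro sum.cong) (auto simp: H_def E_def)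
          then show ?thesis by (auto simp: sum.delta)
        qed
        \<comment> \<open>Below level \<open>k\<close> the difference factor vanishes. From level
          \<open>k\<close> on the powers combine to the \<open>M\<close>-th power of
          \<open>(1/2) ^ (c i w - k)\<close>, which is 1 at the level itself and tends to 0 above
          it.\<close>
        have L_cases: "L M w = (if w \<in> E J \<and> c i w \<ge> k then ((1/2) ^ (c i w - k)) ^ M * F w else 0)" for M w
        proof (cases "w \<in> E J \<and> c i w \<ge> k")
          case True
          have "(2::real) ^ k * (1/2) ^ c i w = (1/2) ^ (c i w - k)"
            using True by (simp add: power_diff power_one_over field_simps)
          moreover have "((2::real) ^ k) ^ M * ((1/2) ^ M) ^ c i w = (2 ^ k * (1/2) ^ c i w) ^ M"
            by (simp only: power_mult_distrib power_mult[symmetric] mult.commute[of M])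
          ultimately have "((2::real) ^ k) ^ M * ((1/2) ^ M) ^ c i w = ((1/2) ^ (c i w - k)) ^ M"
            by simp
          then show ?thesis using True ind[of w] by (simp add: L_def)
        next
          case False
          then show ?thesis using ind[of w] by (auto simp: L_def indicator_def)
        qed
        show "(\<lambda>a. \<integral>w. indicator (H k) w * F w \<partial>K a) \<in> borel_measurable A"
        proof (rule borel_measurable_LIMSEQ_real)
          fix M
          have "(\<lambda>a. (2 ^ k) ^ M * ((\<integral>w. indicator (E J) w * F' M w \<partial>K a) - (\<Sum>n<k. \<integral>w. indicator (H n) w * F' M w \<partial>K a))) \<in> borel_measurable A"
            using insert.IH[OF J(1), of "F' M"] VF'[of M] less[rule_format, OF _ VF'[of M]]
            by (auto intro!: borel_measurable_times borel_measurable_diff borel_measurable_sum)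
          also have "?this \<longleftrightarrow> (\<lambda>a. \<integral>w. L M w \<partial>K a) \<in> borel_measurable A"
          proof (rule measurable_cong)
            fix a assume a: "a \<in> space A"
            have "integrable (K a) (\<lambda>w. indicator (X) w * F' M w)" if [measurable]: "X \<in> sets N" for X
            proof (rule int[OF a, where B=1])
              show "(\<lambda>w. indicator X w * F' M w) \<in> borel_measurable N"
                using Vmeas[OF VF'[of M]] by measurable
            qed (use Vbound[OF VF'[of M]] in \<open>auto split: split_indicator\<close>)
            then show "(2 ^ k) ^ M * ((\<integral>w. indicator (E J) w * F' M w \<partial>K a) - (\<Sum>n<k. \<integral>w. indicator (H n) w * F' M w \<partial>K a)) = (\<integral>w. L M w \<partial>K a)"
              unfolding L_eq
              by (subst Bochner_Integration.integral_mult_right_zero, subst Bochner_Integration.integral_diff)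
                 (simp_all add: Bochner_Integration.integral_sum del: sum_indicator_mult sum_mult_indicator)
          qed
          finally show "(\<lambda>a. \<integral>w. L M w \<partial>K a) \<in> borel_measurable A" .
        next
          fix a assume a: "a \<in> space A"
          have sp: "space (K a) = space N"
            using sets_eq_imp_space_eq[OF K(2)[OF a]] .
          show "(\<lambda>M. \<integral>w. L M w \<partial>K a) \<longlonglongrightarrow> (\<integral>w. indicator (H k) w * F w \<partial>K a)"
          proof (rule integral_dominated_convergence[where w = "\<lambda>_. 1"])
            show "integrable (K a) (\<lambda>_. 1 :: real)"
              by (rule int[OF a, where B=1]) auto
            show "AE w in K a. (\<lambda>M. L M w) \<longlonglongrightarrow> indicator (H k) w * F w"
            proof (rule AE_I2)
              fix w assume w: "w \<in> space (K a)"
              show "(\<lambda>M. L M w) \<longlonglongrightarrow> indicator (H k) w * F w"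
              proof (cases "w \<in> E J \<and> c i w > k")
                case True
                then have "norm ((1/2 :: real) ^ (c i w - k)) < 1"
                  by (simp add: power_less_one_iff)
                then have "(\<lambda>M. ((1/2 :: real) ^ (c i w - k)) ^ M * F w) \<longlonglongrightarrow> 0"
                  by (intro tendsto_mult_left_zero LIMSEQ_power_zero)
                then show ?thesis using True by (simp add: L_cases H_def)
              next
                case False
                then have "L M w = indicator (H k) w * F w" for M
                  using w by (cases "w \<in> E J \<and> c i w = k") (auto simp: L_cases H_def sp)
                then show ?thesis by simp
              qed
            qed
            show "AE w in K a. norm (L M w) \<le> 1" for M
            proof (rule AE_I2)
              fix w assume w: "w \<in> space (K a)"
              have "((1/2 :: real) ^ (c i w - k)) ^ M * \<bar>F w\<bar> \<le> 1"
                using Vbound[OF F, of w] w by (intro mult_le_one) (auto simp: sp power_le_one)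
              then show "norm (L M w) \<le> 1"
                by (auto simp: L_cases abs_mult)
            qed
            have [measurable]: "F' M \<in> borel_measurable N" for M using Vmeas[OF VF'[of M]] .
            have "(\<lambda>w. indicator (H k) w * F w) \<in> borel_measurable N" by measurable
            then show "(\<lambda>w. indicator (H k) w * F w) \<in> borel_measurable (K a)"
              using K(2)[OF a] by (simp cong: measurable_cong_sets)
            have "L M \<in> borel_measurable N" for M
              unfolding L_eq by measurable
            then show "L M \<in> borel_measurable (K a)" for M
              using K(2)[OF a] by (simp cong: measurable_cong_sets)
          qed
        qed
      qed
    qed
    moreover have "E (insert ik J) = H k"
      by (auto simp: E_def H_def ik)
    ultimately show ?case by auto
  qed
  show ?thesis
  proof (rule measurable_subprob_algebra_generated)
    show "sets N = sigma_sets (space N) G"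
    proof
      have "G \<subseteq> sets N"
        using E_meas by (auto simp: G_def)
      then show "sigma_sets (space N) G \<subseteq> sets N"
        by (rule sets.sigma_sets_subset)
      have "{{w \<in> space N. c i w = k} | i k. i \<in> I} \<subseteq> G"
      proof safe
        fix i k assume "i \<in> I"
        then show "{w \<in> space N. c i w = k} \<in> G"
          unfolding G_def by (intro CollectI exI[of _ "{(i, k)}"]) (auto simp: E_def)
      qed
      then show "sets N \<subseteq> sigma_sets (space N) G"
        by (intro order_trans[OF gen] sigma_sets_mono')
    qed
    show "Int_stable G"
    proof (rule Int_stableI)
      fix X Y assume "X \<in> G" "Y \<in> G"
      then obtain J J' where "finite J" "finite J'" "J \<subseteq> I \<times> UNIV" "J' \<subseteq> I \<times> UNIV" "X = E J" "Y = E J'"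
        by (auto simp: G_def)
      then show "X \<inter> Y \<in> G"
        unfolding G_def by (intro CollectI exI[of _ "J \<union> J'"]) (auto simp: E_def ball_Un)
    qed
    show "G \<subseteq> Pow (space N)"
      by (auto simp: G_def E_def)
    have *: "(\<lambda>a. emeasure (K a) (E J)) \<in> borel_measurable A" if J: "finite J" "J \<subseteq> I \<times> UNIV" for J
    proof (subst measurable_cong)
      fix a assume a: "a \<in> space A"
      interpret finite_measure "K a" using fin[OF a] .
      show "emeasure (K a) (E J) = ennreal (\<integral>w. indicator (E J) w * 1 \<partial>K a)"
        using E_meas[OF J] K(2)[OF a] by (simp add: emeasure_eq_measure)
    next
      show "(\<lambda>a. ennreal (\<integral>w. indicator (E J) w * 1 \<partial>K a)) \<in> borel_measurable A"
        using main[OF J, of "\<lambda>_. 1"] V1 by auto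
    qed
    then show "(\<lambda>a. emeasure (K a) X) \<in> borel_measurable A" if "X \<in> G" for X
      using that by (auto simp: G_def)
    show "(\<lambda>a. emeasure (K a) (space N)) \<in> borel_measurable A"
      using *[of "{}"] by (simp add: E_def)
  qed (use K in auto)
qed

text \<open>Two measures form a kernel over an indiscrete two-point space, and a measurable kernel
  there has equal values at both points. Uniqueness thus comes out of the measurability criterion
  instead of a second run of the limit argument.\<close>

lemma measure_eqI_counts:
  fixes c :: "'i \<Rightarrow> 'b \<Rightarrow> nat" and V :: "('b \<Rightarrow> real) \<Rightarrow> bool"
  assumes c: "\<And>i. i \<in> I \<Longrightarrow> c i \<in> N \<rightarrow>\<^sub>M count_space UNIV"
    and gen: "sets N \<subseteq> sigma_sets (space N) {{w \<in> space N. c i w = k} | i k. i \<in> I}"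
    and M: "subprob_space M" "sets M = sets N" "subprob_space M'" "sets M' = sets N"
    and V1: "V (\<lambda>_. 1)"
    and Vmult: "\<And>F i t. V F \<Longrightarrow> i \<in> I \<Longrightarrow> 0 < t \<Longrightarrow> t \<le> 1 \<Longrightarrow> V (\<lambda>w. t ^ c i w * F w)"
    and Vmeas: "\<And>F. V F \<Longrightarrow> F \<in> borel_measurable N"
    and Vbound: "\<And>F w. V F \<Longrightarrow> w \<in> space N \<Longrightarrow> \<bar>F w\<bar> \<le> 1"
    and VM: "\<And>F. V F \<Longrightarrow> (\<integral>w. F w \<partial>M) = (\<integral>w. F w \<partial>M')"
  shows "M = M'"
proof (rule measure_eqI)
  define A where "A = sigma (UNIV :: bool set) {}"
  define K where "K b = (if b then M else M')" for b
  have sp: "space A = UNIV" by (simp add: A_def)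
  have sets_A: "sets A = {{}, UNIV}" by (simp add: A_def sigma_sets_empty_eq)
  \<comment> \<open>a function on the indiscrete two-point space is measurable iff it is constant\<close>
  have K: "K \<in> A \<rightarrow>\<^sub>M subprob_algebra N"
  proof (rule measurable_kernel_counts[where V = V and c = c and I = I])
    fix F assume "V F"
    then have "(\<lambda>a. \<integral>w. F w \<partial>K a) = (\<lambda>_. \<integral>w. F w \<partial>M')"
      using VM by (auto simp: K_def fun_eq_iff)
    then show "(\<lambda>a. \<integral>w. F w \<partial>K a) \<in> borel_measurable A" by simp
  qed (use c gen V1 Vmult Vmeas Vbound M in \<open>auto simp: K_def\<close>)
  show "sets M = sets M'" using M by simp
  fix X assume "X \<in> sets M"
  then have X: "X \<in> sets N" using M by simp
  have "(\<lambda>b. emeasure (K b) X) \<in> borel_measurable A"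
    using K X by measurable
  then have "(\<lambda>b. emeasure (K b) X) -` {emeasure M X} \<inter> space A \<in> sets A"
    by (rule measurable_sets) auto
  then have "(\<lambda>b. emeasure (K b) X) -` {emeasure M X} = UNIV"
    unfolding sets_A sp by (auto simp: K_def set_eq_iff split: if_splits)
  then have "emeasure (K False) X = emeasure M X" by blast
  then show "emeasure M X = emeasure M' X"
    by (simp add: K_def)
qed

text \<open>The weights are now products over points of functions with values in [0,1]. This is how
  a random law of configurations is seen to depend measurably on its parameter when only its
  generating functional is computed.\<close>

lemma measurable_kernel_configs:
  fixes \<nu> :: "'a measure"
  assumes K: "\<And>a. a \<in> space A \<Longrightarrow> subprob_space (K a)" "\<And>a. a \<in> space A \<Longrightarrow> sets (K a) = sets (configs \<nu>)"
    and VK: "\<And>g :: 'a \<Rightarrow> real. g \<in> borel_measurable \<nu> \<Longrightarrow> (\<And>x. 0 \<le> g x) \<Longrightarrow> (\<And>x. g x \<le> 1) \<Longrightarrow>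
        (\<lambda>a. \<integral>\<phi>. (\<Prod>x\<in>#\<phi>. g x) \<partial>K a) \<in> borel_measurable A"
  shows "K \<in> A \<rightarrow>\<^sub>M subprob_algebra (configs \<nu>)"
proof (rule measurable_kernel_counts[where I = "sets \<nu>" and c = points_in and
      V = "\<lambda>F. \<exists>g. F = (\<lambda>\<phi>. \<Prod>x\<in>#\<phi>. g x) \<and> g \<in> borel_measurable \<nu> \<and> (\<forall>x. 0 \<le> g x \<and> g x \<le> 1)"])
  show "sets (configs \<nu>) \<subseteq> sigma_sets (space (configs \<nu>))
     {{w \<in> space (configs \<nu>). points_in i w = k} |i k. i \<in> sets \<nu>}"
    unfolding sets_configs space_configs by simp
  show "\<exists>g. (\<lambda>_. 1 :: real) = (\<lambda>\<phi>. \<Prod>x\<in>#\<phi>. g x) \<and> g \<in> borel_measurable \<nu> \<and> (\<forall>x. 0 \<le> g x \<and> g x \<le> 1)"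
    by (intro exI[of _ "\<lambda>_. 1"]) auto
  fix F :: "'a multiset \<Rightarrow> real" and A and t :: real
  assume "\<exists>g. F = (\<lambda>\<phi>. \<Prod>x\<in>#\<phi>. g x) \<and> g \<in> borel_measurable \<nu> \<and> (\<forall>x. 0 \<le> g x \<and> g x \<le> 1)"
    and A [measurable]: "A \<in> sets \<nu>" and t: "0 < t" "t \<le> 1"
  then obtain g where g: "F = (\<lambda>\<phi>. \<Prod>x\<in>#\<phi>. g x)" "\<forall>x. 0 \<le> g x \<and> g x \<le> 1"
    and [measurable]: "g \<in> borel_measurable \<nu>" by auto
  show "\<exists>g. (\<lambda>\<phi>. t ^ points_in A \<phi> * F \<phi>) = (\<lambda>\<phi>. \<Prod>x\<in>#\<phi>. g x) \<and> g \<in> borel_measurable \<nu> \<and> (\<forall>x. 0 \<le> g x \<and> g x \<le> 1)"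
  proof (intro exI conjI)
    show "(\<lambda>\<phi>. t ^ points_in A \<phi> * F \<phi>) = (\<lambda>\<phi>. \<Prod>x\<in>#\<phi>. (if x \<in> A then t else 1) * g x)"
      by (simp add: g(1) prod_mset_power_points_in)
    show "(\<lambda>x. (if x \<in> A then t else 1) * g x) \<in> borel_measurable \<nu>"
      by measurable
    show "\<forall>x. 0 \<le> (if x \<in> A then t else 1) * g x \<and> (if x \<in> A then t else 1) * g x \<le> 1"
      using g(2) t by (auto intro: mult_le_one)
  qed
next
  fix F :: "'a multiset \<Rightarrow> real"
  assume "\<exists>g. F = (\<lambda>\<phi>. \<Prod>x\<in>#\<phi>. g x) \<and> g \<in> borel_measurable \<nu> \<and> (\<forall>x. 0 \<le> g x \<and> g x \<le> 1)"
  then obtain g where g: "F = (\<lambda>\<phi>. \<Prod>x\<in>#\<phi>. g x)" "\<And>x. 0 \<le> g x" "\<And>x. g x \<le> 1" "g \<in> borel_measurable \<nu>"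
    by auto
  show "(\<lambda>a. \<integral>\<phi>. F \<phi> \<partial>K a) \<in> borel_measurable A"
    unfolding g(1) by (rule VK) (use g in auto)
  show "F \<in> borel_measurable (configs \<nu>)" "\<And>w. \<bar>F w\<bar> \<le> 1"
    unfolding g(1) using g by (auto simp: abs_of_nonneg prod_mset_nonneg intro!: prod_mset_le_1)
qed (use K in auto)

text \<open>The counters of a pair are those of either component, marked by a flag; a power of such
  a counter changes only \<open>h\<close> or only \<open>g\<close>.\<close>

lemma measure_eqI_configs_pair:
  fixes \<nu> :: "'a measure"
  assumes M: "subprob_space M" "sets M = sets (configs \<nu> \<Otimes>\<^sub>M configs \<nu>)"
      "subprob_space M'" "sets M' = sets (configs \<nu> \<Otimes>\<^sub>M configs \<nu>)"
    and VM: "\<And>h g :: 'a \<Rightarrow> real. h \<in> borel_measurable \<nu> \<Longrightarrow> (\<And>x. 0 \<le> h x) \<Longrightarrow> (\<And>x. h x \<le> 1) \<Longrightarrow>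
        g \<in> borel_measurable \<nu> \<Longrightarrow> (\<And>x. 0 \<le> g x) \<Longrightarrow> (\<And>x. g x \<le> 1) \<Longrightarrow>
        (\<integral>w. (\<Prod>x\<in>#fst w. h x) * (\<Prod>x\<in>#snd w. g x) \<partial>M) = (\<integral>w. (\<Prod>x\<in>#fst w. h x) * (\<Prod>x\<in>#snd w. g x) \<partial>M')"
  shows "M = M'"
proof -
  define N where "N = configs \<nu> \<Otimes>\<^sub>M configs \<nu>"
  define c :: "bool \<times> 'a set \<Rightarrow> 'a multiset \<times> 'a multiset \<Rightarrow> nat"
    where "c = (\<lambda>(b, A) w. points_in A (if b then fst w else snd w))"
  define V where "V F \<longleftrightarrow> (\<exists>h g. F = (\<lambda>w. (\<Prod>x\<in>#fst w. h x) * (\<Prod>x\<in>#snd w. g x)) \<and>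
      h \<in> borel_measurable \<nu> \<and> (\<forall>x. 0 \<le> h x \<and> h x \<le> 1) \<and>
      g \<in> borel_measurable \<nu> \<and> (\<forall>x. 0 \<le> g x \<and> g x \<le> 1))" for F :: "'a multiset \<times> 'a multiset \<Rightarrow> real"
  define G where "G = {{w \<in> space N. c i w = k} | i k. i \<in> UNIV \<times> sets \<nu>}"
  have G: "G \<subseteq> Pow (space N)" by (auto simp: G_def)
  show ?thesis
  proof (rule measure_eqI_counts[where I = "UNIV \<times> sets \<nu>" and c = c and V = V and N = N])
    show "c i \<in> N \<rightarrow>\<^sub>M count_space UNIV" if "i \<in> UNIV \<times> sets \<nu>" for i
      using that unfolding N_def c_def by (cases i; cases "fst i") auto
    \<comment> \<open>Both coordinate maps are measurable for the algebra generated by the counters,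
      hence so is the identity into the product space. This is the required generation
      property.\<close>
    have id: "(\<lambda>w. w) \<in> sigma (space N) G \<rightarrow>\<^sub>M configs \<nu> \<Otimes>\<^sub>M configs \<nu>"
    proof -
      have *: "(\<lambda>w. if b then fst w else snd w) \<in> sigma (space N) G \<rightarrow>\<^sub>M configs \<nu>" for b
      proof (rule measurable_configsI)
        fix w assume "w \<in> space (sigma (space N) G)"
        then show "set_mset (if b then fst w else snd w) \<subseteq> space \<nu>"
          using G by (auto simp: N_def space_pair_measure space_configs space_measure_of)
      next
        fix A assume "A \<in> sets \<nu>"
        then have "{w \<in> space N. c (b, A) w = k} \<in> sets (sigma (space N) G)" for k
          by (auto simp: sets_measure_of[OF G] G_def)
        then show "(\<lambda>w. points_in A (if b then fst w else snd w)) \<in> sigma (space N) G \<rightarrow>\<^sub>M count_space UNIV"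
          by (subst measurable_count_space_eq_countable)
             (auto simp: space_measure_of[OF G] c_def vimage_def Int_def conj_commute)
      qed
      show ?thesis
        using measurable_Pair[OF *[of True] *[of False]] by simp
    qed
    show "sets N \<subseteq> sigma_sets (space N) {{w \<in> space N. c i w = k} | i k. i \<in> UNIV \<times> sets \<nu>}"
    proof
      fix X assume X: "X \<in> sets N"
      then have "(\<lambda>w. w) -` X \<inter> space (sigma (space N) G) \<in> sets (sigma (space N) G)"
        using id unfolding N_def by (intro measurable_sets) auto
      moreover have "(\<lambda>w. w) -` X \<inter> space (sigma (space N) G) = X"
        using sets.sets_into_space[OF X] by (auto simp: space_measure_of[OF G])
      ultimately have "X \<in> sigma_sets (space N) G"
        by (simp add: sets_measure_of[OF G])
      then show "X \<in> sigma_sets (space N) {{w \<in> space N. c i w = k} | i k. i \<in> UNIV \<times> sets \<nu>}"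
        unfolding G_def .
    qed
    show "V (\<lambda>_. 1)"
      unfolding V_def by (intro exI[of _ "\<lambda>_. 1"]) auto
    show "V (\<lambda>w. t ^ c i w * F w)" if F: "V F" and i: "i \<in> UNIV \<times> sets \<nu>" and t: "0 < t" "t \<le> 1" for F i t
    proof -
      obtain b A where bA: "i = (b, A)" by force
      have [measurable]: "A \<in> sets \<nu>" using i bA by auto
      obtain h g where F: "F = (\<lambda>w. (\<Prod>x\<in>#fst w. h x) * (\<Prod>x\<in>#snd w. g x))"
        and bd: "\<forall>x. 0 \<le> h x \<and> h x \<le> 1" "\<forall>x. 0 \<le> g x \<and> g x \<le> 1"
        and [measurable]: "h \<in> borel_measurable \<nu>" "g \<in> borel_measurable \<nu>"
        using F unfolding V_def by auto
      define f' where "f' f x = (if x \<in> A then t else 1) * f x" for f :: "'a \<Rightarrow> real" and x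
      have f': "f' f \<in> borel_measurable \<nu>" "\<forall>x. 0 \<le> f' f x \<and> f' f x \<le> 1"
        if [measurable]: "f \<in> borel_measurable \<nu>" and "\<forall>x. 0 \<le> f x \<and> f x \<le> 1" for f
        unfolding f'_def using that t by (auto intro: mult_le_one)
      have *: "t ^ points_in A \<phi> * (\<Prod>x\<in>#\<phi>. f x) = (\<Prod>x\<in>#\<phi>. f' f x)" for f \<phi>
        by (simp add: prod_mset_power_points_in f'_def)
      show ?thesis
      proof (cases b)
        case True
        then show ?thesis unfolding V_def using f'[of h] bd *[of _ h]
          by (intro exI[of _ "f' h"] exI[of _ g]) (auto simp: F c_def bA mult.assoc[symmetric])
      next
        case False
        then show ?thesis unfolding V_def using f'[of g] bd *[of _ g]
          by (intro exI[of _ h] exI[of _ "f' g"]) (auto simp: F c_def bA mult.left_commute)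
      qed
    qed
    show "F \<in> borel_measurable N" if "V F" for F
      using that unfolding V_def N_def by auto
    show "\<bar>F w\<bar> \<le> 1" if "V F" "w \<in> space N" for F w
      using that unfolding V_def
      by (auto simp: abs_mult abs_of_nonneg prod_mset_nonneg intro!: mult_le_one prod_mset_le_1)
    show "(\<integral>w. F w \<partial>M) = (\<integral>w. F w \<partial>M')" if F: "V F" for F
    proof -
      obtain h g where "F = (\<lambda>w. (\<Prod>x\<in>#fst w. h x) * (\<Prod>x\<in>#snd w. g x))"
        "h \<in> borel_measurable \<nu>" "\<forall>x. 0 \<le> h x \<and> h x \<le> 1" "g \<in> borel_measurable \<nu>" "\<forall>x. 0 \<le> g x \<and> g x \<le> 1"
        using F unfolding V_def by blast
      then show ?thesis using VM[of h g] by simp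
    qed
  qed (use M in \<open>auto simp: N_def\<close>)
qed

section \<open>Leibniz rule for products over points and differentiation under the
  expectation\<close>

section \<open>Mixed derivatives of products over configurations\<close>

text \<open>
  \<open>dprod ds u Y\<close> is the mixed derivative at \<open>u\<close> in the directions \<open>ds\<close> of \<open>u \<mapsto> \<Prod>y\<in>#Y. u y\<close>: each
  direction is evaluated at a point of its own.
\<close>

primrec dprod :: "('b \<Rightarrow> real) list \<Rightarrow> ('b \<Rightarrow> real) \<Rightarrow> 'b multiset \<Rightarrow> real" where
  "dprod [] u Y = (\<Prod>y\<in>#Y. u y)"
| "dprod (d # ds) u Y = (\<Sum>y\<in>#Y. d y * dprod ds u (Y - {#y#}))"

text \<open>Both sides run over ordered pairs of distinct occurrences, that is, over all pairs minus
  the diagonal.\<close>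

lemma sum_mset_remove_swap:
  fixes f :: "'b \<Rightarrow> 'b \<Rightarrow> real"
  shows "(\<Sum>y\<in>#Y. \<Sum>y'\<in>#Y - {#y#}. f y y') = (\<Sum>y'\<in>#Y. \<Sum>y\<in>#Y - {#y'#}. f y y')"
proof -
  have remove: "(\<Sum>y'\<in>#Y - {#y#}. g y') = (\<Sum>y'\<in>#Y. g y') - g y" if "y \<in># Y" for y and g :: "'b \<Rightarrow> real"
    using that by (metis add_diff_cancel_left' insert_DiffM sum_mset.add_mset image_mset_add_mset)
  have sub: "(\<Sum>y\<in>#X. g y - k y) = (\<Sum>y\<in>#X. g y) - (\<Sum>y\<in>#X. k y)" for X and g k :: "'b \<Rightarrow> real"
    by (induction X) auto
  have "(\<Sum>y\<in>#Y. \<Sum>y'\<in>#Y - {#y#}. f y y') = (\<Sum>y\<in>#Y. (\<Sum>y'\<in>#Y. f y y') - f y y)"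
    by (intro arg_cong[of _ _ sum_mset] image_mset_cong) (simp add: remove)
  also have "\<dots> = (\<Sum>y'\<in>#Y. (\<Sum>y\<in>#Y. f y y') - f y' y')"
    unfolding sub by (subst sum_mset.swap) simp
  also have "\<dots> = (\<Sum>y'\<in>#Y. \<Sum>y\<in>#Y - {#y'#}. f y y')"
    by (intro arg_cong[of _ _ sum_mset] image_mset_cong) (simp add: remove)
  finally show ?thesis .
qed

lemma has_real_derivative_sum_mset:
  assumes "\<And>y. y \<in># Y \<Longrightarrow> (f y has_real_derivative f' y) F"
  shows "((\<lambda>t. \<Sum>y\<in>#Y. f y t) has_real_derivative (\<Sum>y\<in>#Y. f' y)) F"
  using assms by (induction Y) (auto intro!: derivative_eq_intros)

text \<open>Differentiation reaches only the innermost product, where the new direction picks its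
  point last. The points picked are distinct occurrences, so the order of picking is irrelevant and
  \<open>d\<close> can be moved to the front.\<close>

lemma dprod_has_derivative:
  "((\<lambda>t. dprod ds (\<lambda>y. u y + t * d y) Y) has_real_derivative dprod (d # ds) (\<lambda>y. u y + t * d y) Y) (at t)"
proof (induction ds arbitrary: Y)
  case Nil
  show ?case
  proof (induction Y)
    case (add x Y)
    let ?u = "\<lambda>y. u y + t * d y"
    have "(\<Sum>y\<in>#Y. d y * (\<Prod>y\<in>#add_mset x Y - {#y#}. ?u y)) = (\<Sum>y\<in>#Y. ?u x * (d y * (\<Prod>y\<in>#Y - {#y#}. ?u y)))"
      by (intro arg_cong[of _ _ sum_mset] image_mset_cong) (auto simp: add_mset_remove_trivial_If)
    also have "\<dots> = ?u x * (\<Sum>y\<in>#Y. d y * (\<Prod>y\<in>#Y - {#y#}. ?u y))"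
      by (simp add: sum_mset_distrib_left)
    finally show ?case
      using add by (auto intro!: derivative_eq_intros)
  qed simp
next
  case (Cons e ds)
  let ?u = "\<lambda>y. u y + t * d y"
  have "((\<lambda>t. dprod (e # ds) (\<lambda>y. u y + t * d y) Y) has_real_derivative
      (\<Sum>y\<in>#Y. e y * dprod (d # ds) ?u (Y - {#y#}))) (at t)"
    unfolding dprod.simps(2)[of e] by (intro has_real_derivative_sum_mset DERIV_cmult Cons.IH)
  also have "(\<Sum>y\<in>#Y. e y * dprod (d # ds) ?u (Y - {#y#})) =
      (\<Sum>y\<in>#Y. \<Sum>y'\<in>#Y - {#y#}. e y * d y' * dprod ds ?u (Y - {#y#} - {#y'#}))"
    by (simp add: sum_mset_distrib_left mult.assoc)
  also have "\<dots> = (\<Sum>y'\<in>#Y. \<Sum>y\<in>#Y - {#y'#}. e y * d y' * dprod ds ?u (Y - {#y#} - {#y'#}))"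
    by (rule sum_mset_remove_swap)
  also have "\<dots> = dprod (d # e # ds) ?u Y"
    by (simp add: sum_mset_distrib_left mult_ac diff_diff_add_mset add_mset_commute)
  finally show ?case .
qed

lemma abs_sum_mset_le:
  fixes f :: "'b \<Rightarrow> real" and C :: real
  assumes "\<And>y. y \<in># Y \<Longrightarrow> \<bar>f y\<bar> \<le> C"
  shows "\<bar>\<Sum>y\<in>#Y. f y\<bar> \<le> size Y * C"
  using assms
proof (induction Y)
  case (add x Y)
  have "\<bar>f x + (\<Sum>y\<in>#Y. f y)\<bar> \<le> C + size Y * C"
    using add.IH add.prems by (intro order_trans[OF abs_triangle_ineq] add_mono) auto
  then show ?case by (simp add: algebra_simps)
qed simp

text \<open>Each direction picks one of at most \<open>size Y\<close> points and contributes at most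
  \<open>B\<close>; the points not picked contribute factors bounded by \<open>r\<close>. For
  \<open>r < 1\<close> this leads to a bound uniform in the size of the configuration.\<close>

lemma dprod_bound:
  assumes "\<And>y. y \<in># Y \<Longrightarrow> \<bar>u y\<bar> \<le> r" "\<And>d y. d \<in> set ds \<Longrightarrow> y \<in># Y \<Longrightarrow> \<bar>d y\<bar> \<le> B" "0 \<le> r" "0 \<le> B"
  shows "\<bar>dprod ds u Y\<bar> \<le> B ^ length ds * (real (size Y) ^ length ds * r ^ (size Y - length ds))"
  using assms(1,2)
proof (induction ds arbitrary: Y)
  case Nil
  then show ?case
  proof (induction Y)
    case (add x Y)
    have "\<bar>u x\<bar> * \<bar>\<Prod>y\<in>#Y. u y\<bar> \<le> r * r ^ size Y"
      using add by (intro mult_mono) (auto simp: assms)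
    then show ?case by (simp add: abs_mult)
  qed simp
next
  case (Cons d ds)
  let ?k = "length ds"
  have "\<bar>dprod (d # ds) u Y\<bar> \<le> size Y * (B * (B ^ ?k * (real (size Y) ^ ?k * r ^ (size Y - Suc ?k))))"
    unfolding dprod.simps
  proof (rule abs_sum_mset_le)
    fix y assume y: "y \<in># Y"
    have "\<bar>dprod ds u (Y - {#y#})\<bar> \<le> B ^ ?k * (real (size (Y - {#y#})) ^ ?k * r ^ (size (Y - {#y#}) - ?k))"
      using Cons.prems by (intro Cons.IH) (auto dest: in_diffD)
    also have "\<dots> \<le> B ^ ?k * (real (size Y) ^ ?k * r ^ (size Y - Suc ?k))"
      using assms(3,4) y by (intro mult_mono power_mono) (auto simp: size_Diff_singleton)
    finally show "\<bar>d y * dprod ds u (Y - {#y#})\<bar> \<le> B * (B ^ ?k * (real (size Y) ^ ?k * r ^ (size Y - Suc ?k)))"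
      using Cons.prems(2)[of d y] y assms(4) by (auto simp: abs_mult intro!: mult_mono)
  qed
  then show ?case by (simp add: mult_ac)
qed

lemma bounded_power_times_geometric:
  fixes r :: real
  assumes "0 < r" "r < 1"
  shows "\<exists>C\<ge>0. \<forall>n. real n ^ k * r ^ (n - k) \<le> C"
proof (cases "k = 0")
  case True
  then show ?thesis using assms by (intro exI[of _ 1]) (auto simp: power_le_one)
next
  case False
  \<comment> \<open>A \<open>k\<close>-th root of \<open>r\<close> turns the claim into boundedness
    of \<open>(n * s ^ n) ^ k\<close>, and \<open>n * s ^ n\<close> tends to 0.\<close>
  define s where "s = root k r"
  have s: "0 < s" "s < 1" "s ^ k = r"
    using assms False by (auto simp: s_def)
  have "(\<lambda>n. real n * s ^ n) \<longlonglongrightarrow> 0"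
    using powser_times_n_limit_0[of s] s by simp
  then have "Bseq (\<lambda>n. real n * s ^ n)"
    by (rule convergent_imp_Bseq[OF convergentI])
  then obtain K where K: "K > 0" "\<And>n. norm (real n * s ^ n) \<le> K"
    unfolding Bseq_def by auto
  \<comment> \<open>The first summand serves \<open>n < k\<close>, where truncated subtraction makes
    the exponent 0; the second makes up for the missing factor \<open>r ^ k\<close>
    otherwise.\<close>
  have "real n ^ k * r ^ (n - k) \<le> real k ^ k + K ^ k / r ^ k" for n
  proof (cases "n \<ge> k")
    case True
    have "(s ^ n) ^ k = r ^ n"
      unfolding s(3)[symmetric] by (simp add: power_mult[symmetric] mult.commute)
    then have "real n ^ k * r ^ (n - k) = (real n * s ^ n) ^ k / r ^ k"
      using True assms by (simp add: power_diff power_mult_distrib)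
    also have "\<dots> \<le> K ^ k / r ^ k"
      using K(2)[of n] s assms by (intro divide_right_mono power_mono) auto
    finally show ?thesis by (simp add: add_increasing)
  next
    case False
    then have "real n ^ k * r ^ (n - k) \<le> real k ^ k"
      by (simp add: power_mono)
    moreover have "0 \<le> K ^ k / r ^ k" using K assms by simp
    ultimately show ?thesis by linarith
  qed
  then show ?thesis
    using K assms by (intro exI[of _ "real k ^ k + K ^ k / r ^ k"]) auto
qed

text \<open>A bound on the derivative near 0 bounds all difference quotients by the mean value
  inequality. Constants are integrable for a finite measure, so dominated convergence
  applies.\<close>

lemma has_real_derivative_integral_finite_measure:
  fixes F F' :: "real \<Rightarrow> 'w \<Rightarrow> real"
  assumes "finite_measure P" and "0 < \<delta>"
    and int: "\<And>t. \<bar>t\<bar> < \<delta> \<Longrightarrow> integrable P (F t)"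
    and meas: "F' 0 \<in> borel_measurable P"
    and deriv: "\<And>t \<omega>. \<omega> \<in> space P \<Longrightarrow> \<bar>t\<bar> < \<delta> \<Longrightarrow> ((\<lambda>t. F t \<omega>) has_real_derivative F' t \<omega>) (at t)"
    and bound: "\<And>t \<omega>. \<omega> \<in> space P \<Longrightarrow> \<bar>t\<bar> < \<delta> \<Longrightarrow> \<bar>F' t \<omega>\<bar> \<le> C"
  shows "((\<lambda>t. \<integral>\<omega>. F t \<omega> \<partial>P) has_real_derivative (\<integral>\<omega>. F' 0 \<omega> \<partial>P)) (at 0)"
proof -
  interpret finite_measure P by fact
  have lip: "\<bar>F t \<omega> - F 0 \<omega>\<bar> \<le> C * \<bar>t\<bar>" if "\<omega> \<in> space P" "\<bar>t\<bar> < \<delta>" for t \<omega>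
  proof -
    have "norm (F t \<omega> - F 0 \<omega>) \<le> C * norm (t - 0)"
    proof (rule field_differentiable_bound[where S = "{-\<delta><..<\<delta>}" and f' = "\<lambda>t. F' t \<omega>"])
      show "((\<lambda>t. F t \<omega>) has_field_derivative F' z \<omega>) (at z within {-\<delta><..<\<delta>})" if "z \<in> {-\<delta><..<\<delta>}" for z
        by (rule has_field_derivative_at_within[OF deriv]) (use that \<open>\<omega> \<in> space P\<close> in auto)
      show "norm (F' z \<omega>) \<le> C" if "z \<in> {-\<delta><..<\<delta>}" for z
        using that \<open>\<omega> \<in> space P\<close> unfolding real_norm_def by (intro bound) auto
    qed (use that \<open>0 < \<delta>\<close> in auto)
    then show ?thesis by simp
  qed
  show ?thesis
    unfolding has_field_derivative_iff tendsto_at_iff_sequentially comp_def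
  proof (intro allI impI)
    fix X :: "nat \<Rightarrow> real" assume X: "\<forall>i. X i \<in> UNIV - {0}" "X \<longlonglongrightarrow> 0"
    obtain N where N: "\<And>i. i \<ge> N \<Longrightarrow> \<bar>X i\<bar> < \<delta>"
      using tendstoD[OF X(2) \<open>0 < \<delta>\<close>] by (auto simp: eventually_sequentially)
    \<comment> \<open>The sequence is shifted by \<open>N\<close> so that all its terms lie within
      \<delta>, where the bound on the quotients is available.\<close>
    define Q where "Q i \<omega> = (F (X (i + N)) \<omega> - F 0 \<omega>) / X (i + N)" for i \<omega>
    have N': "\<bar>X (i + N)\<bar> < \<delta>" "X (i + N) \<noteq> 0" for i using N X by auto
    have "(\<lambda>i. \<integral>\<omega>. Q i \<omega> \<partial>P) \<longlonglongrightarrow> (\<integral>\<omega>. F' 0 \<omega> \<partial>P)"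
    proof (rule integral_dominated_convergence[where w = "\<lambda>_. C"])
      show "Q i \<in> borel_measurable P" for i
        unfolding Q_def using int[OF N'(1)[of i]] int[of 0] \<open>0 < \<delta>\<close> by auto
      show "AE \<omega> in P. (\<lambda>i. Q i \<omega>) \<longlonglongrightarrow> F' 0 \<omega>"
      proof (rule AE_I2)
        fix \<omega> assume "\<omega> \<in> space P"
        then have "((\<lambda>t. F t \<omega>) has_real_derivative F' 0 \<omega>) (at 0)"
          using deriv[of \<omega> 0] \<open>0 < \<delta>\<close> by simp
        then have "(\<lambda>i. (F (X i) \<omega> - F 0 \<omega>) / X i) \<longlonglongrightarrow> F' 0 \<omega>"
          using X unfolding has_field_derivative_iff tendsto_at_iff_sequentially comp_def by auto
        then show "(\<lambda>i. Q i \<omega>) \<longlonglongrightarrow> F' 0 \<omega>"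
          unfolding Q_def by (rule LIMSEQ_ignore_initial_segment)
      qed
      show "AE \<omega> in P. norm (Q i \<omega>) \<le> C" for i
        using lip N'[of i] by (intro AE_I2) (auto simp: Q_def abs_divide divide_le_eq)
    qed (use meas in auto)
    also have "(\<lambda>i. \<integral>\<omega>. Q i \<omega> \<partial>P) = (\<lambda>i. ((\<integral>\<omega>. F (X (i + N)) \<omega> \<partial>P) - (\<integral>\<omega>. F 0 \<omega> \<partial>P)) / (X (i + N) - 0))"
      unfolding Q_def using int[OF N'(1)] int[of 0] \<open>0 < \<delta>\<close>
      by (simp add: Bochner_Integration.integral_diff)
    finally show "(\<lambda>i. ((\<integral>\<omega>. F (X i) \<omega> \<partial>P) - (\<integral>\<omega>. F 0 \<omega> \<partial>P)) / (X i - 0)) \<longlonglongrightarrow> (\<integral>\<omega>. F' 0 \<omega> \<partial>P)"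
      by (rule LIMSEQ_offset)
  qed
qed

text \<open>A derivative in one more direction is a limit of difference quotients, so measurability
  passes from products over points to all mixed derivatives. The abstract class \<open>V\<close>
  allows test functions on a sum type, where measurability is known only for those built from an
  admissible pair.\<close>

lemma borel_measurable_dprod_general:
  fixes V :: "('b \<Rightarrow> real) \<Rightarrow> bool"
  assumes meas: "\<And>u. V u \<Longrightarrow> (\<lambda>\<omega>. \<Prod>y\<in>#Y \<omega>. u y) \<in> borel_measurable M"
    and closed: "\<And>u d t. V u \<Longrightarrow> d \<in> D \<Longrightarrow> V (\<lambda>y. u y + t * d y)"
    and "V u" "set ds \<subseteq> D"
  shows "(\<lambda>\<omega>. dprod ds u (Y \<omega>)) \<in> borel_measurable M"
  using assms(3,4)
proof (induction ds arbitrary: u)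
  case Nil
  then show ?case using meas by simp
next
  case (Cons d ds)
  let ?t = "\<lambda>n. 1 / real (Suc n)"
  show ?case
  proof (rule borel_measurable_LIMSEQ_real)
    show "(\<lambda>\<omega>. (dprod ds (\<lambda>y. u y + ?t n * d y) (Y \<omega>) - dprod ds u (Y \<omega>)) / ?t n) \<in> borel_measurable M" for n
      using Cons.prems
      by (intro borel_measurable_divide borel_measurable_diff borel_measurable_const Cons.IH closed) auto
    fix \<omega>
    have "((\<lambda>t. dprod ds (\<lambda>y. u y + t * d y) (Y \<omega>)) has_real_derivative dprod (d # ds) u (Y \<omega>)) (at 0)"
      using dprod_has_derivative[of ds u d "Y \<omega>" 0] by simp
    moreover have "?t \<longlonglongrightarrow> 0" by (rule LIMSEQ_inverse_real_of_nat[unfolded inverse_eq_divide])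
    ultimately show "(\<lambda>n. (dprod ds (\<lambda>y. u y + ?t n * d y) (Y \<omega>) - dprod ds u (Y \<omega>)) / ?t n) \<longlonglongrightarrow> dprod (d # ds) u (Y \<omega>)"
      unfolding has_field_derivative_iff tendsto_at_iff_sequentially comp_def
      by (auto simp del: dprod.simps dest!: spec[of _ ?t])
  qed
qed

lemma borel_measurable_dprod [measurable]:
  assumes "\<And>d. d \<in> set ds \<Longrightarrow> d \<in> borel_measurable \<nu>" "u \<in> borel_measurable \<nu>"
  shows "dprod ds u \<in> borel_measurable (configs \<nu>)"
  by (rule borel_measurable_dprod_general[where V = "\<lambda>u. u \<in> borel_measurable \<nu>" and Y = "\<lambda>\<phi>. \<phi>" and D = "set ds"])
     (use assms in auto)

lemma dprod_nonneg:
  assumes "\<And>d y. d \<in> set ds \<Longrightarrow> y \<in># Y \<Longrightarrow> 0 \<le> d y" "\<And>y. y \<in># Y \<Longrightarrow> 0 \<le> u y"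
  shows "0 \<le> dprod ds u Y"
  using assms
proof (induction ds arbitrary: Y)
  case Nil
  then show ?case by (auto intro: prod_mset_nonneg)
next
  case (Cons d ds)
  have "\<forall>x\<in>#image_mset (\<lambda>y. d y * dprod ds u (Y - {#y#})) Y. 0 \<le> x"
    using Cons by (auto intro!: mult_nonneg_nonneg Cons.IH dest: in_diffD)
  moreover have "0 \<le> sum_mset X" if "\<forall>x\<in>#X. 0 \<le> x" for X :: "real multiset"
    using that by (induction X) auto
  ultimately show ?case by simp
qed

text \<open>\<open>Y\<close> collects the points of both processes in a disjoint sum and
  \<open>case_sum h g\<close> is the test function on it. \<open>U\<close> singles out the pairs at
  which \<open>G\<close> is given by the expectation, which lets the marginal functional keep
  \<open>h\<close> fixed at 1. The bound \<open>r < 1\<close> at the points present makes the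
  derivatives of the product bounded, whatever the number of points.\<close>

theorem has_mixed_derivative_expectation:
  fixes Y :: "'w \<Rightarrow> ('a + 'a) multiset" and U :: "('a \<Rightarrow> real) \<Rightarrow> ('a \<Rightarrow> real) \<Rightarrow> bool"
  assumes P: "finite_measure P"
    and G: "\<And>h g. U h g \<Longrightarrow> G h g = (\<integral>\<omega>. (\<Prod>y\<in>#Y \<omega>. case_sum h g y) \<partial>P)"
    and meas: "\<And>h g. U h g \<Longrightarrow> (\<lambda>\<omega>. \<Prod>y\<in>#Y \<omega>. case_sum h g y) \<in> borel_measurable P"
    and closed: "\<And>h g d t. U h g \<Longrightarrow> d \<in> D \<Longrightarrow> U (\<lambda>x. h x + t * fst d x) (\<lambda>z. g z + t * snd d z)"
    and D: "\<And>d \<omega> y. d \<in> D \<Longrightarrow> \<omega> \<in> space P \<Longrightarrow> y \<in># Y \<omega> \<Longrightarrow> \<bar>case_sum (fst d) (snd d) y\<bar> \<le> B"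
    and ds: "set ds \<subseteq> D" and U: "U h g"
    and r: "\<And>\<omega> y. \<omega> \<in> space P \<Longrightarrow> y \<in># Y \<omega> \<Longrightarrow> \<bar>case_sum h g y\<bar> \<le> r" "0 \<le> r" "r < 1"
  shows "has_mixed_derivative G ds h g
    (\<integral>\<omega>. dprod (map (\<lambda>d. case_sum (fst d) (snd d)) ds) (case_sum h g) (Y \<omega>) \<partial>P)"
  using ds U r
proof (induction ds arbitrary: h g r)
  case Nil
  then show ?case by (simp add: G)
next
  case (Cons d ds)
  interpret finite_measure P by (rule P)
  define e where "e d = (case_sum (fst d) (snd d) :: 'a + 'a \<Rightarrow> real)" for d
  define es where "es = map e ds"
  have es_eq: "es = map (\<lambda>d. case_sum (fst d) (snd d)) ds"
    by (simp add: es_def e_def[abs_def])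
  define u where "u = case_sum h g"
  define F where "F t \<omega> = dprod es (\<lambda>y. u y + t * e d y) (Y \<omega>)" for t \<omega>
  define F' where "F' t \<omega> = dprod (e d # es) (\<lambda>y. u y + t * e d y) (Y \<omega>)" for t \<omega>
  \<comment> \<open>\<open>max\<close> makes the bound positive, so that it can be divided by.
    \<rho> is the midpoint between \<open>r\<close> and 1, and \<delta> is the step length for which
    an increment bounded by \<open>B'\<close> stays within this room; the induction continues with
    \<rho> in place of \<open>r\<close>.\<close>
  define B' where "B' = max B 1"
  define \<rho> where "\<rho> = (1 + r) / 2"
  define \<delta> where "\<delta> = (1 - r) / (2 * B')"
  have B': "0 < B'" "B \<le> B'" by (auto simp: B'_def)
  have \<rho>: "0 < \<rho>" "\<rho> < 1" and \<delta>: "0 < \<delta>" using Cons.prems B' by (auto simp: \<rho>_def \<delta>_def)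
  have ed: "\<bar>e d y\<bar> \<le> B'" if "d \<in> D" "\<omega> \<in> space P" "y \<in># Y \<omega>" for d \<omega> y
    using D[OF that] B' by (simp add: e_def)
  have dD: "d \<in> D" and dsD: "set ds \<subseteq> D" using Cons.prems by auto
  have esD: "\<bar>d y\<bar> \<le> B'" if "d \<in> set es" "\<omega> \<in> space P" "y \<in># Y \<omega>" for d \<omega> y
    using that ed dsD by (auto simp: es_def)
  have shift: "(\<lambda>y. u y + t * e d y) = case_sum (\<lambda>x. h x + t * fst d x) (\<lambda>z. g z + t * snd d z)" for t
    by (auto simp: u_def e_def fun_eq_iff split: sum.splits)
  have small: "\<bar>u y + t * e d y\<bar> \<le> \<rho>" if t: "\<bar>t\<bar> < \<delta>" and y: "\<omega> \<in> space P" "y \<in># Y \<omega>" for t \<omega> y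
  proof -
    have "\<bar>t * e d y\<bar> \<le> \<delta> * B'"
      unfolding abs_mult using t ed[OF dD y] \<delta> by (intro mult_mono) auto
    also have "\<delta> * B' = (1 - r) / 2" using B' by (simp add: \<delta>_def)
    finally show ?thesis
      using Cons.prems(3)[OF y] abs_triangle_ineq[of "u y" "t * e d y"]
      by (simp add: \<rho>_def u_def field_simps)
  qed
  have F_meas: "F t \<in> borel_measurable P" "F' t \<in> borel_measurable P" for t
  proof -
    have *: "(\<lambda>\<omega>. dprod xs (\<lambda>y. u y + t * e d y) (Y \<omega>)) \<in> borel_measurable P" if "set xs \<subseteq> e ` D" for xs
    proof (rule borel_measurable_dprod_general[where V = "\<lambda>u. \<exists>h g. u = case_sum h g \<and> U h g" and D = "e ` D"])
      fix u :: "'a + 'a \<Rightarrow> real" and x and t :: real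
      assume "\<exists>h g. u = case_sum h g \<and> U h g" "x \<in> e ` D"
      then obtain h g d where u: "u = case_sum h g" "U h g" "x = e d" "d \<in> D" by auto
      have "(\<lambda>y. u y + t * x y) = case_sum (\<lambda>x. h x + t * fst d x) (\<lambda>z. g z + t * snd d z)"
        by (auto simp: u e_def fun_eq_iff split: sum.splits)
      then show "\<exists>h g. (\<lambda>y. u y + t * x y) = case_sum h g \<and> U h g"
        using closed[OF u(2,4), of t] by blast
    qed (use meas that shift closed[OF Cons.prems(2) dD] in blast)+
    show "F t \<in> borel_measurable P" "F' t \<in> borel_measurable P"
      unfolding F_def F'_def using dD dsD by (intro *; force simp: es_def)+
  qed
  \<comment> \<open>Needed twice: for \<open>es\<close> it gives integrability of
    \<open>F t\<close>, for \<open>e d # es\<close> it dominates the derivative. The size of the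
    configuration disappears through \<open>bounded_power_times_geometric\<close>.\<close>
  have bound: "\<exists>C. \<forall>t \<omega>. \<bar>t\<bar> < \<delta> \<longrightarrow> \<omega> \<in> space P \<longrightarrow> \<bar>dprod xs (\<lambda>y. u y + t * e d y) (Y \<omega>)\<bar> \<le> C"
    if xs: "set xs \<subseteq> e ` D" for xs
  proof -
    obtain C where C: "\<And>n. real n ^ length xs * \<rho> ^ (n - length xs) \<le> C"
      using bounded_power_times_geometric[OF \<rho>, of "length xs"] by auto
    have "\<bar>dprod xs (\<lambda>y. u y + t * e d y) (Y \<omega>)\<bar> \<le> B' ^ length xs * C" if "\<bar>t\<bar> < \<delta>" "\<omega> \<in> space P" for t \<omega>
    proof -
      have "\<bar>dprod xs (\<lambda>y. u y + t * e d y) (Y \<omega>)\<bar> \<le>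
          B' ^ length xs * (real (size (Y \<omega>)) ^ length xs * \<rho> ^ (size (Y \<omega>) - length xs))"
        using small[OF that] ed that(2) xs \<rho> B' by (intro dprod_bound) auto
      also have "\<dots> \<le> B' ^ length xs * C"
        using C B' by (intro mult_left_mono) auto
      finally show ?thesis .
    qed
    then show ?thesis by blast
  qed
  have esub: "set es \<subseteq> e ` D" "set (e d # es) \<subseteq> e ` D" using dD dsD by (auto simp: es_def)
  obtain C where C: "\<And>t \<omega>. \<bar>t\<bar> < \<delta> \<Longrightarrow> \<omega> \<in> space P \<Longrightarrow> \<bar>F t \<omega>\<bar> \<le> C"
    using bound[OF esub(1)] unfolding F_def by blast
  obtain C' where C': "\<And>t \<omega>. \<bar>t\<bar> < \<delta> \<Longrightarrow> \<omega> \<in> space P \<Longrightarrow> \<bar>F' t \<omega>\<bar> \<le> C'"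
    using bound[OF esub(2)] unfolding F'_def by blast
  have "((\<lambda>t. \<integral>\<omega>. F t \<omega> \<partial>P) has_real_derivative (\<integral>\<omega>. F' 0 \<omega> \<partial>P)) (at 0)"
  proof (rule has_real_derivative_integral_finite_measure[OF P \<delta>])
    show "integrable P (F t)" if "\<bar>t\<bar> < \<delta>" for t
      using C[OF that] F_meas by (intro integrable_const_bound[where B = C]) auto
    show "((\<lambda>t. F t \<omega>) has_real_derivative F' t \<omega>) (at t)" for t \<omega>
      unfolding F_def F'_def by (rule dprod_has_derivative)
  qed (use F_meas C' in auto)
  moreover have "\<forall>\<^sub>F t in nhds 0. has_mixed_derivative G ds (\<lambda>x. h x + t * fst d x) (\<lambda>z. g z + t * snd d z) (\<integral>\<omega>. F t \<omega> \<partial>P)"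
    unfolding eventually_nhds_metric
  proof (intro exI[of _ \<delta>] conjI allI impI \<delta>)
    fix t :: real assume "dist t 0 < \<delta>"
    then have t: "\<bar>t\<bar> < \<delta>" by simp
    show "has_mixed_derivative G ds (\<lambda>x. h x + t * fst d x) (\<lambda>z. g z + t * snd d z) (\<integral>\<omega>. F t \<omega> \<partial>P)"
      unfolding F_def shift es_eq
    proof (rule Cons.IH[OF dsD])
      show "U (\<lambda>x. h x + t * fst d x) (\<lambda>z. g z + t * snd d z)"
        by (rule closed[OF Cons.prems(2) dD])
      show "\<bar>case_sum (\<lambda>x. h x + t * fst d x) (\<lambda>z. g z + t * snd d z) y\<bar> \<le> \<rho>"
        if "\<omega> \<in> space P" "y \<in># Y \<omega>" for \<omega> y
        using small[OF t that] by (simp add: shift[symmetric])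
    qed (use \<rho> in auto)
  qed
  moreover have "(\<integral>\<omega>. F' 0 \<omega> \<partial>P) = (\<integral>\<omega>. dprod (map (\<lambda>d. case_sum (fst d) (snd d)) (d # ds)) (case_sum h g) (Y \<omega>) \<partial>P)"
    by (simp add: F'_def es_eq e_def u_def)
  ultimately show ?case
    unfolding has_mixed_derivative.simps by (intro exI[of _ "\<lambda>t. \<integral>\<omega>. F t \<omega> \<partial>P"]) simp
qed

lemma has_mixed_derivative_unique:
  assumes "has_mixed_derivative G ds h g D" "has_mixed_derivative G ds h g D'"
  shows "D = D'"
  using assms
proof (induction ds arbitrary: h g D D')
  case (Cons d ds)
  from Cons.prems obtain f f' where
    f: "\<forall>\<^sub>F t in nhds 0. has_mixed_derivative G ds (\<lambda>x. h x + t * fst d x) (\<lambda>z. g z + t * snd d z) (f t)"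
      "(f has_real_derivative D) (at 0)" and
    f': "\<forall>\<^sub>F t in nhds 0. has_mixed_derivative G ds (\<lambda>x. h x + t * fst d x) (\<lambda>z. g z + t * snd d z) (f' t)"
      "(f' has_real_derivative D') (at 0)" by auto
  have "\<forall>\<^sub>F t in nhds 0. f t = f' t"
    using f(1) f'(1) by eventually_elim (rule Cons.IH)
  then have "(f' has_real_derivative D) (at 0)"
    using f(2) DERIV_cong_ev[OF refl _ refl] by blast
  then show ?case using f'(2) by (rule DERIV_unique)
qed simp

section \<open>Derivatives at zero as permanents\<close>

subsection \<open>Evaluation at zero\<close>

lemma dprod_image_mset:
  "dprod ds u (image_mset f Y) = dprod (map (\<lambda>d. d \<circ> f) ds) (u \<circ> f) Y"
proof (induction ds arbitrary: Y)
  case (Cons d ds)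
  have "(\<Sum>y\<in>#Y. d (f y) * dprod ds u (image_mset f Y - {#f y#})) =
      (\<Sum>y\<in>#Y. d (f y) * dprod (map (\<lambda>d. d \<circ> f) ds) (u \<circ> f) (Y - {#y#}))"
    by (intro arg_cong[of _ _ sum_mset] image_mset_cong) (simp add: Cons.IH[symmetric] image_mset_Diff)
  then show ?case by (simp add: image_mset.compositionality comp_def)
qed (simp add: image_mset.compositionality comp_def)

text \<open>At zero a point left over by the directions contributes the factor 0, and a direction
  left without a point gives an empty sum.\<close>

lemma dprod_zero_size:
  "size Y \<noteq> length ds \<Longrightarrow> dprod ds (\<lambda>_. 0) Y = 0"
proof (induction ds arbitrary: Y)
  case Nil
  then show ?case by (cases Y) auto
next
  case (Cons d ds)
  have "dprod ds (\<lambda>_. 0) (Y - {#y#}) = 0" if "y \<in># Y" for y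
  proof (rule Cons.IH)
    have "size Y = Suc (size (Y - {#y#}))" using that by (metis insert_DiffM size_add_mset)
    then show "size (Y - {#y#}) \<noteq> length ds" using Cons.prems by simp
  qed
  then have "(\<Sum>y\<in>#Y. d y * dprod ds (\<lambda>_. 0) (Y - {#y#})) = (\<Sum>y\<in>#Y. 0)"
    by (intro arg_cong[of _ _ sum_mset] image_mset_cong) simp
  then show ?case by simp
qed

text \<open>A direction of the first kind vanishes at points of the second kind and conversely. No
  direction crosses over, and the derivative factorizes.\<close>

lemma dprod_zero_sum:
  "dprod (map (\<lambda>d. case_sum d (\<lambda>_. 0)) ds @ map (\<lambda>d. case_sum (\<lambda>_. 0) d) es) (\<lambda>_. 0)
     (image_mset Inl \<phi> + image_mset Inr \<xi>) = dprod ds (\<lambda>_. 0) \<phi> * dprod es (\<lambda>_. 0) \<xi>"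
proof (induction ds arbitrary: \<phi>)
  case Nil
  show ?case
  proof (induction es arbitrary: \<xi>)
    case Nil
    then show ?case by (cases \<phi>; cases \<xi>) auto
  next
    case (Cons e es)
    let ?es = "map (\<lambda>d. case_sum (\<lambda>_. 0) d) es"
    have "(\<Sum>z\<in>#\<xi>. e z * dprod ?es (\<lambda>_. 0) (image_mset Inl \<phi> + image_mset Inr \<xi> - {#Inr z#})) =
        (\<Sum>z\<in>#\<xi>. dprod [] (\<lambda>_. 0) \<phi> * (e z * dprod es (\<lambda>_. 0) (\<xi> - {#z#})))"
    proof (intro arg_cong[of _ _ sum_mset] image_mset_cong)
      fix z assume "z \<in># \<xi>"
      then have "image_mset Inl \<phi> + image_mset Inr \<xi> - {#Inr z#} = image_mset Inl \<phi> + image_mset Inr (\<xi> - {#z#})"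
        by (subst diff_union_single_conv) (auto simp: image_mset_Diff)
      then show "e z * dprod ?es (\<lambda>_. 0) (image_mset Inl \<phi> + image_mset Inr \<xi> - {#Inr z#}) =
          dprod [] (\<lambda>_. 0) \<phi> * (e z * dprod es (\<lambda>_. 0) (\<xi> - {#z#}))"
        using Cons.IH[of "\<xi> - {#z#}"] by simp
    qed
    then show ?case
      by (simp add: image_mset.compositionality comp_def sum_mset_distrib_left)
  qed
next
  case (Cons d ds)
  let ?L = "map (\<lambda>d. case_sum d (\<lambda>_. 0)) ds @ map (\<lambda>d. case_sum (\<lambda>_. 0) d) es"
  have "(\<Sum>x\<in>#\<phi>. d x * dprod ?L (\<lambda>_. 0) (image_mset Inl \<phi> + image_mset Inr \<xi> - {#Inl x#})) =
      (\<Sum>x\<in>#\<phi>. (d x * dprod ds (\<lambda>_. 0) (\<phi> - {#x#})) * dprod es (\<lambda>_. 0) \<xi>)"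
  proof (intro arg_cong[of _ _ sum_mset] image_mset_cong)
    fix x assume "x \<in># \<phi>"
    \<comment> \<open>The summands are exchanged because the rule for removing an element acts on
      the right summand.\<close>
    then have "image_mset Inr \<xi> + image_mset Inl \<phi> - {#Inl x#} = image_mset Inr \<xi> + image_mset Inl (\<phi> - {#x#})"
      by (subst diff_union_single_conv) (auto simp: image_mset_Diff)
    then have "image_mset Inl \<phi> + image_mset Inr \<xi> - {#Inl x#} = image_mset Inl (\<phi> - {#x#}) + image_mset Inr \<xi>"
      by (simp only: add.commute)
    then show "d x * dprod ?L (\<lambda>_. 0) (image_mset Inl \<phi> + image_mset Inr \<xi> - {#Inl x#}) =
        (d x * dprod ds (\<lambda>_. 0) (\<phi> - {#x#})) * dprod es (\<lambda>_. 0) \<xi>"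
      using Cons.IH[of "\<phi> - {#x#}"] by simp
  qed
  then show ?case
    by (simp add: image_mset.compositionality comp_def sum_mset_distrib_right)
qed

text \<open>At zero the mixed derivative is the permanent of the matrix of directions and points:
  the directions use up every point exactly once, in some order.\<close>

lemma dprod_zero_permutations:
  assumes "finite I" "card I = length ds"
  shows "dprod ds (\<lambda>_. 0) (image_mset x (mset_set I)) =
    (\<Sum>l\<in>permutations_of_set I. \<Prod>k<length ds. (ds ! k) (x (l ! k)))"
  using assms
proof (induction ds arbitrary: I)
  case (Cons d ds)
  have I: "I \<noteq> {}" using Cons.prems by auto
  have "dprod (d # ds) (\<lambda>_. 0) (image_mset x (mset_set I)) =
      (\<Sum>i\<in>I. d (x i) * dprod ds (\<lambda>_. 0) (image_mset x (mset_set I) - {#x i#}))"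
    by (simp add: image_mset.compositionality comp_def sum_unfold_sum_mset)
  also have "\<dots> = (\<Sum>i\<in>I. d (x i) * (\<Sum>l\<in>permutations_of_set (I - {i}). \<Prod>k<length ds. (ds ! k) (x (l ! k))))"
  proof (intro sum.cong refl)
    fix i assume i: "i \<in> I"
    then have "image_mset x (mset_set I) - {#x i#} = image_mset x (mset_set (I - {i}))"
      using Cons.prems(1) by (simp add: image_mset_Diff mset_set_Diff)
    then show "d (x i) * dprod ds (\<lambda>_. 0) (image_mset x (mset_set I) - {#x i#}) =
        d (x i) * (\<Sum>l\<in>permutations_of_set (I - {i}). \<Prod>k<length ds. (ds ! k) (x (l ! k)))"
      using Cons.IH[of "I - {i}"] Cons.prems i by simp
  qed
  also have "\<dots> = (\<Sum>i\<in>I. \<Sum>l\<in>(#) i ` permutations_of_set (I - {i}). \<Prod>k<length (d # ds). ((d # ds) ! k) (x (l ! k)))"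
    by (intro sum.cong refl)
       (simp add: sum.reindex sum_distrib_left prod.lessThan_Suc_shift del: prod.lessThan_Suc)
  also have "\<dots> = (\<Sum>l\<in>permutations_of_set I. \<Prod>k<length (d # ds). ((d # ds) ! k) (x (l ! k)))"
    unfolding permutations_of_set_nonempty[OF I] using Cons.prems(1)
    by (subst sum.UNION_disjoint) auto
  finally show ?case .
qed simp

section \<open>Invariance under reordering of tuples, and recovery of densities from
  rectangles\<close>

section \<open>Integration over tuples\<close>

lemma product_sigma_finite_const:
  "sigma_finite_measure \<nu> \<Longrightarrow> product_sigma_finite (\<lambda>_. \<nu>)"
  by (simp add: product_sigma_finite_def)

lemma sigma_finite_tuples:
  "sigma_finite_measure \<nu> \<Longrightarrow> sigma_finite_measure (tuples \<nu> n)"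
  by (intro product_sigma_finite.sigma_finite product_sigma_finite_const) auto

text \<open>A permutation of \<open>{1..n}\<close> fixes all other indices, so composition preserves
  the default value outside the index set.\<close>

lemma comp_permutes_in_tuples:
  assumes "\<sigma> permutes {1..n}" "x \<in> space (tuples \<nu> n)"
  shows "x \<circ> \<sigma> \<in> space (tuples \<nu> n)"
  using assms permutes_in_image[OF assms(1)] permutes_not_in[OF assms(1)]
  by (auto simp: space_PiM PiE_def Pi_def extensional_def)

lemma measurable_comp_permutes:
  assumes "\<sigma> permutes {1..n}"
  shows "(\<lambda>x. x \<circ> \<sigma>) \<in> tuples \<nu> n \<rightarrow>\<^sub>M tuples \<nu> n"
  unfolding comp_def
proof (rule measurable_PiM_single')
  show "(\<lambda>x. x (\<sigma> i)) \<in> tuples \<nu> n \<rightarrow>\<^sub>M \<nu>" if "i \<in> {1..n}" for i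
    using that permutes_in_image[OF assms] by (intro measurable_component_singleton) auto
  show "(\<lambda>x i. x (\<sigma> i)) \<in> space (tuples \<nu> n) \<rightarrow> ({1..n} \<rightarrow>\<^sub>E space \<nu>)"
    using comp_permutes_in_tuples[OF assms, of _ \<nu>] by (auto simp: space_PiM comp_def)
qed

text \<open>The preimage of a rectangle is the rectangle with sides permuted by the inverse, and a
  product of masses does not see the order of its factors.\<close>

lemma distr_tuples_permutes:
  assumes \<nu>: "sigma_finite_measure \<nu>" and \<sigma>: "\<sigma> permutes {1..n}"
  shows "distr (tuples \<nu> n) (tuples \<nu> n) (\<lambda>x. x \<circ> \<sigma>) = tuples \<nu> n"
proof (rule product_sigma_finite.PiM_eqI[OF product_sigma_finite_const[OF \<nu>]])
  fix A assume A: "\<And>i. i \<in> {1..n} \<Longrightarrow> A i \<in> sets \<nu>"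
  have inv: "inv \<sigma> permutes {1..n}" using \<sigma> by (rule permutes_inv)
  have A': "A (inv \<sigma> i) \<in> sets \<nu>" if "i \<in> {1..n}" for i
    using that permutes_in_image[OF inv] by (intro A) simp
  have "(\<lambda>x. x \<circ> \<sigma>) -` (Pi\<^sub>E {1..n} A) \<inter> space (tuples \<nu> n) = Pi\<^sub>E {1..n} (\<lambda>i. A (inv \<sigma> i))"
  proof (intro set_eqI iffI)
    fix x assume x: "x \<in> (\<lambda>x. x \<circ> \<sigma>) -` (Pi\<^sub>E {1..n} A) \<inter> space (tuples \<nu> n)"
    have "x i \<in> A (inv \<sigma> i)" if "i \<in> {1..n}" for i
    proof -
      have "(x \<circ> \<sigma>) (inv \<sigma> i) \<in> A (inv \<sigma> i)"
        using x permutes_in_image[OF inv] that by (auto simp: PiE_def Pi_def)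
      then show ?thesis using permutes_inverses(1)[OF \<sigma>] by simp
    qed
    then show "x \<in> Pi\<^sub>E {1..n} (\<lambda>i. A (inv \<sigma> i))"
      using x by (auto simp: space_PiM PiE_def)
  next
    fix x assume x: "x \<in> Pi\<^sub>E {1..n} (\<lambda>i. A (inv \<sigma> i))"
    have sp: "x \<in> space (tuples \<nu> n)"
      using x A' sets.sets_into_space by (fastforce simp: space_PiM PiE_def Pi_def)
    have "(x \<circ> \<sigma>) i \<in> A i" if "i \<in> {1..n}" for i
    proof -
      have "x (\<sigma> i) \<in> A (inv \<sigma> (\<sigma> i))"
        using x permutes_in_image[OF \<sigma>, of i] that by (auto simp: PiE_def Pi_def)
      then show ?thesis using permutes_inverses(2)[OF \<sigma>] by simp
    qed
    then show "x \<in> (\<lambda>x. x \<circ> \<sigma>) -` (Pi\<^sub>E {1..n} A) \<inter> space (tuples \<nu> n)"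
      using sp comp_permutes_in_tuples[OF \<sigma> sp] by (auto simp: space_PiM PiE_def)
  qed
  then have "emeasure (distr (tuples \<nu> n) (tuples \<nu> n) (\<lambda>x. x \<circ> \<sigma>)) (Pi\<^sub>E {1..n} A) =
      emeasure (tuples \<nu> n) (Pi\<^sub>E {1..n} (\<lambda>i. A (inv \<sigma> i)))"
    using A by (subst emeasure_distr[OF measurable_comp_permutes[OF \<sigma>]]) (auto intro!: sets_PiM_I_finite)
  also have "\<dots> = (\<Prod>i\<in>{1..n}. emeasure \<nu> (A (inv \<sigma> i)))"
    by (rule product_sigma_finite.emeasure_PiM[OF product_sigma_finite_const[OF \<nu>]]) (auto intro: A')
  also have "\<dots> = (\<Prod>i\<in>{1..n}. emeasure \<nu> (A i))"
    using prod.permute[OF inv, of "\<lambda>i. emeasure \<nu> (A i)"] by (simp add: comp_def)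
  finally show "emeasure (distr (tuples \<nu> n) (tuples \<nu> n) (\<lambda>x. x \<circ> \<sigma>)) (Pi\<^sub>E {1..n} A) =
      (\<Prod>i\<in>{1..n}. emeasure \<nu> (A i))" .
qed auto

lemma nn_integral_tuples_permutes:
  assumes "sigma_finite_measure \<nu>" "\<sigma> permutes {1..n}" "f \<in> borel_measurable (tuples \<nu> n)"
  shows "(\<integral>\<^sup>+x. f (x \<circ> \<sigma>) \<partial>tuples \<nu> n) = (\<integral>\<^sup>+x. f x \<partial>tuples \<nu> n)"
  using nn_integral_distr[OF measurable_comp_permutes[OF assms(2)], of f \<nu>] assms(3)
  unfolding distr_tuples_permutes[OF assms(1,2)] by simp

lemma points_in_config_of: "points_in A (config_of n x) = (\<Sum>i\<in>{1..n}. of_bool (x i \<in> A))"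
proof -
  have "points_in A (image_mset x (mset_set I)) = (\<Sum>i\<in>I. of_bool (x i \<in> A))" if "finite I" for I
    using that by induction auto
  then show ?thesis by (simp add: config_of_def)
qed

lemma measurable_config_of [measurable]: "config_of n \<in> tuples \<nu> n \<rightarrow>\<^sub>M configs \<nu>"
proof (rule measurable_configsI)
  show "set_mset (config_of n x) \<subseteq> space \<nu>" if "x \<in> space (tuples \<nu> n)" for x
    using that by (auto simp: config_of_def space_PiM)
next
  fix A assume [measurable]: "A \<in> sets \<nu>"
  have *: "(\<lambda>x. of_bool (x i \<in> A) :: nat) \<in> tuples \<nu> n \<rightarrow>\<^sub>M count_space UNIV" if [measurable]: "i \<in> {1..n}" for i
    by measurable
  show "(\<lambda>x. points_in A (config_of n x)) \<in> tuples \<nu> n \<rightarrow>\<^sub>M count_space UNIV"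
    unfolding points_in_config_of by (intro measurable_sum_nat *)
qed

lemma size_config_of [simp]: "size (config_of n x) = n"
  by (simp add: config_of_def)

lemma config_of_comp_permutes:
  assumes "\<sigma> permutes {1..n}"
  shows "config_of n (x \<circ> \<sigma>) = config_of n x"
proof -
  have "image_mset (x \<circ> \<sigma>) (mset_set {1..n}) = image_mset x (image_mset \<sigma> (mset_set {1..n}))"
    by (simp add: image_mset.compositionality)
  also have "image_mset \<sigma> (mset_set {1..n}) = mset_set {1..n}"
    using permutes_inj_on[OF assms] permutes_image[OF assms] by (simp add: image_mset_mset_set)
  finally show ?thesis unfolding config_of_def .
qed

lemma prod_mset_config_of: "(\<Prod>y\<in>#config_of n x. g y) = (\<Prod>i=1..n. g (x i))"
  by (simp add: config_of_def image_mset.compositionality comp_def prod_unfold_prod_mset)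

text \<open>The permanent is a sum of \<open>fact m\<close> terms, each of them the plain product
  precomposed with a permutation. As \<open>f\<close> and the product measure are invariant, all
  terms have the same integral.\<close>

lemma nn_integral_dprod_config_of:
  fixes \<theta> :: "nat \<Rightarrow> 'a \<Rightarrow> real" and f :: "(nat \<Rightarrow> 'a) \<Rightarrow> ennreal"
  assumes \<nu>: "sigma_finite_measure \<nu>"
    and \<theta>: "test_directions \<nu> m \<theta>"
    and f: "f \<in> borel_measurable (tuples \<nu> m)"
    and sym: "symmetric_on_tuples \<nu> m f"
  shows "(\<integral>\<^sup>+z. ennreal (dprod (map \<theta> [1..<Suc m]) (\<lambda>_. 0) (config_of m z)) * f z \<partial>tuples \<nu> m) =
    fact m * (\<integral>\<^sup>+z. ennreal (\<Prod>k=1..m. \<theta> k (z k)) * f z \<partial>tuples \<nu> m)"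
proof -
  \<comment> \<open>Lists are indexed from 0 and tuples from 1, hence the shift. Indices outside
    \<open>{1..m}\<close> are fixed, as \<open>permutes\<close> demands.\<close>
  define s where "s l k = (if k \<in> {1..m} then l ! (k - 1) else k)" for l :: "nat list" and k
  have s: "s l permutes {1..m}" if "l \<in> permutations_of_set {1..m}" for l
  proof (rule bij_imp_permutes)
    have l: "set l = {1..m}" "distinct l" "length l = m"
      using that permutations_of_setD[OF that] distinct_card[of l] by auto
    have "bij_betw (\<lambda>i. i - 1) {1..m} {..<m}"
      by (rule bij_betw_byWitness[where f' = Suc]) auto
    moreover have "bij_betw ((!) l) {..<m} {1..m}"
      using bij_betw_nth[OF l(2), of "{..<m}" "{1..m}"] l by simp
    ultimately have "bij_betw ((!) l \<circ> (\<lambda>i. i - 1)) {1..m} {1..m}"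
      by (rule bij_betw_trans)
    then show "bij_betw (s l) {1..m} {1..m}"
      by (subst bij_betw_cong[of _ _ "(!) l \<circ> (\<lambda>i. i - 1)"]) (auto simp: s_def)
  qed (auto simp: s_def)
  note [measurable] = f
  have \<theta>_meas [measurable]: "\<theta> k \<in> borel_measurable \<nu>" if "k \<in> {1..m}" for k
    using \<theta> that by (auto simp: test_directions_def)
  define g where "g z = ennreal (\<Prod>k=1..m. \<theta> k (z k)) * f z" for z
  have g [measurable]: "g \<in> borel_measurable (tuples \<nu> m)"
    unfolding g_def by measurable
  have "(\<integral>\<^sup>+z. ennreal (dprod (map \<theta> [1..<Suc m]) (\<lambda>_. 0) (config_of m z)) * f z \<partial>tuples \<nu> m) =
      (\<integral>\<^sup>+z. (\<Sum>l\<in>permutations_of_set {1..m}. g (z \<circ> s l)) \<partial>tuples \<nu> m)"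
  proof (intro nn_integral_cong)
    fix z assume z: "z \<in> space (tuples \<nu> m)"
    have len: "length (map \<theta> [1..<Suc m]) = m" by simp
    have *: "(\<Prod>k<m. (map \<theta> [1..<Suc m] ! k) (z (l ! k))) = (\<Prod>k=1..m. \<theta> k ((z \<circ> s l) k))" for l
      by (rule prod.reindex_bij_witness[where i = "\<lambda>k. k - 1" and j = Suc]) (auto simp: s_def simp del: upt_Suc)
    have "dprod (map \<theta> [1..<Suc m]) (\<lambda>_. 0) (config_of m z) =
        (\<Sum>l\<in>permutations_of_set {1..m}. \<Prod>k<length (map \<theta> [1..<Suc m]). (map \<theta> [1..<Suc m] ! k) (z (l ! k)))"
      unfolding config_of_def by (rule dprod_zero_permutations) auto
    then have dp: "dprod (map \<theta> [1..<Suc m]) (\<lambda>_. 0) (config_of m z) =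
        (\<Sum>l\<in>permutations_of_set {1..m}. \<Prod>k=1..m. \<theta> k ((z \<circ> s l) k))"
      unfolding len * .
    have nn: "0 \<le> (\<Prod>k=1..m. \<theta> k ((z \<circ> s l) k))" if "l \<in> permutations_of_set {1..m}" for l
    proof (rule prod_nonneg)
      fix k assume k: "k \<in> {1..m}"
      have "(z \<circ> s l) k \<in> space \<nu>"
        using comp_permutes_in_tuples[OF s[OF that] z] k by (auto simp: space_PiM)
      then show "0 \<le> \<theta> k ((z \<circ> s l) k)" using \<theta> k by (auto simp: test_directions_def)
    qed
    have "ennreal (dprod (map \<theta> [1..<Suc m]) (\<lambda>_. 0) (config_of m z)) * f z =
        (\<Sum>l\<in>permutations_of_set {1..m}. ennreal (\<Prod>k=1..m. \<theta> k ((z \<circ> s l) k)) * f z)"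
      unfolding dp by (subst sum_ennreal[OF nn, symmetric]) (simp_all only: sum_distrib_right)
    also have "\<dots> = (\<Sum>l\<in>permutations_of_set {1..m}. g (z \<circ> s l))"
      unfolding g_def using sym s z by (intro sum.cong) (auto simp: symmetric_on_tuples_def)
    finally show "ennreal (dprod (map \<theta> [1..<Suc m]) (\<lambda>_. 0) (config_of m z)) * f z =
        (\<Sum>l\<in>permutations_of_set {1..m}. g (z \<circ> s l))" .
  qed
  also have "\<dots> = (\<Sum>l\<in>permutations_of_set {1..m}. \<integral>\<^sup>+z. g (z \<circ> s l) \<partial>tuples \<nu> m)"
    by (rule nn_integral_sum) (rule measurable_compose[OF measurable_comp_permutes[OF s] g])
  also have "\<dots> = (\<Sum>l\<in>permutations_of_set {1..m}. \<integral>\<^sup>+z. g z \<partial>tuples \<nu> m)"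
    by (intro sum.cong refl nn_integral_tuples_permutes \<nu> s g)
  also have "\<dots> = fact m * (\<integral>\<^sup>+z. g z \<partial>tuples \<nu> m)"
    by simp
  finally show ?thesis unfolding g_def .
qed

text \<open>The two densities define measures that agree on a pi-system containing the whole space,
  where they are finite; equal measures have almost everywhere equal densities.\<close>

lemma AE_eq_of_generator:
  fixes f f' :: "'b \<Rightarrow> ennreal"
  assumes M: "sigma_finite_measure M"
    and f [measurable]: "f \<in> borel_measurable M" "f' \<in> borel_measurable M"
    and E: "Int_stable E" "E \<subseteq> Pow (space M)" "sets M = sigma_sets (space M) E" "space M \<in> E"
    and eq: "\<And>X. X \<in> E \<Longrightarrow> (\<integral>\<^sup>+x. indicator X x * f x \<partial>M) = (\<integral>\<^sup>+x. indicator X x * f' x \<partial>M)"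
    and fin: "(\<integral>\<^sup>+x. f x \<partial>M) < \<infinity>"
  shows "AE x in M. f x = f' x"
proof -
  have "density M f = density M f'"
  proof (rule measure_eqI_generator_eq[OF E(1,2), where A = "\<lambda>_. space M"])
    fix X assume X: "X \<in> E"
    then have "X \<in> sets M" using E(3) by auto
    then show "emeasure (density M f) X = emeasure (density M f') X"
      using eq[OF X] by (simp add: emeasure_density mult.commute)
  next
    show "emeasure (density M f) (space M) \<noteq> \<infinity>" for i :: nat
      using fin by (simp add: emeasure_density)
  qed (use E in auto)
  then show ?thesis
    using sigma_finite_measure.density_unique[OF M f] by simp
qed

text \<open>Products of indicators are indicators of rectangles, which generate the product space.
  They are also admissible directions of differentiation, so moments supply exactly the integrals
  compared here.\<close>

lemma AE_eq_tuples_pair: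
  fixes f f' :: "(nat \<Rightarrow> 'a) \<times> (nat \<Rightarrow> 'a) \<Rightarrow> ennreal"
  assumes \<nu>: "sigma_finite_measure \<nu>"
    and f: "f \<in> borel_measurable (tuples \<nu> n \<Otimes>\<^sub>M tuples \<nu> m)" "f' \<in> borel_measurable (tuples \<nu> n \<Otimes>\<^sub>M tuples \<nu> m)"
    and eq: "\<And>A B. (\<And>i. i \<in> {1..n} \<Longrightarrow> A i \<in> sets \<nu>) \<Longrightarrow> (\<And>i. i \<in> {1..m} \<Longrightarrow> B i \<in> sets \<nu>) \<Longrightarrow>
       (\<integral>\<^sup>+w. ennreal ((\<Prod>i=1..n. indicator (A i) (fst w i)) * (\<Prod>k=1..m. indicator (B k) (snd w k))) * f w \<partial>(tuples \<nu> n \<Otimes>\<^sub>M tuples \<nu> m)) =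
       (\<integral>\<^sup>+w. ennreal ((\<Prod>i=1..n. indicator (A i) (fst w i)) * (\<Prod>k=1..m. indicator (B k) (snd w k))) * f' w \<partial>(tuples \<nu> n \<Otimes>\<^sub>M tuples \<nu> m))"
    and fin: "(\<integral>\<^sup>+w. f w \<partial>(tuples \<nu> n \<Otimes>\<^sub>M tuples \<nu> m)) < \<infinity>"
  shows "AE w in tuples \<nu> n \<Otimes>\<^sub>M tuples \<nu> m. f w = f' w"
proof -
  define R where "R k = {Pi\<^sub>E {1..k} A | A. A \<in> {1..k} \<rightarrow> sets \<nu>}" for k :: nat
  define E where "E = {X \<times> Z | X Z. X \<in> R n \<and> Z \<in> R m}"
  have R: "R k = prod_algebra {1..k} (\<lambda>_. \<nu>)" for k
    unfolding R_def by (subst prod_algebra_eq_finite) auto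
  have R_int: "X \<inter> Y \<in> R k" if "X \<in> R k" "Y \<in> R k" for k X Y
    using Int_stable_prod_algebra[of "{1..k}" "\<lambda>_. \<nu>"] that unfolding R Int_stable_def by blast
  have R_sub: "R k \<subseteq> Pow (space (tuples \<nu> k))" for k
    unfolding R using prod_algebra_sets_into_space[of "{1..k}" "\<lambda>_. \<nu>"] by (simp add: space_PiM)
  have R_sets: "sets (tuples \<nu> k) = sigma_sets (space (tuples \<nu> k)) (R k)" for k
    unfolding R sets_PiM space_PiM ..
  have R_space: "space (tuples \<nu> k) \<in> R k" for k
    unfolding R_def space_PiM by (intro CollectI exI[of _ "\<lambda>_. space \<nu>"]) auto
  have E_sub: "E \<subseteq> Pow (space (tuples \<nu> n \<Otimes>\<^sub>M tuples \<nu> m))"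
    using R_sub unfolding E_def space_pair_measure by blast
  have "sets (tuples \<nu> n \<Otimes>\<^sub>M tuples \<nu> m) =
      sets (sigma (space (tuples \<nu> n) \<times> space (tuples \<nu> m)) {a \<times> b | a b. a \<in> R n \<and> b \<in> R m})"
    by (rule sets_pair_eq[where Ca = "{space (tuples \<nu> n)}" and Cb = "{space (tuples \<nu> m)}"])
       (use R_sub R_sets R_space in auto)
  then have E_sets: "sets (tuples \<nu> n \<Otimes>\<^sub>M tuples \<nu> m) = sigma_sets (space (tuples \<nu> n \<Otimes>\<^sub>M tuples \<nu> m)) E"
    using E_sub unfolding E_def by (simp add: space_pair_measure)
  show ?thesis
  proof (rule AE_eq_of_generator[OF _ f _ E_sub E_sets _ _ fin])
    show "sigma_finite_measure (tuples \<nu> n \<Otimes>\<^sub>M tuples \<nu> m)"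
      by (intro sigma_finite_pair_measure sigma_finite_tuples \<nu>)
    show "Int_stable E"
    proof (rule Int_stableI)
      fix X Y assume "X \<in> E" "Y \<in> E"
      then obtain a b c d where "X = a \<times> b" "Y = c \<times> d" "a \<in> R n" "c \<in> R n" "b \<in> R m" "d \<in> R m"
        by (auto simp: E_def)
      then show "X \<inter> Y \<in> E"
        using R_int unfolding E_def by (intro CollectI exI[of _ "a \<inter> c"] exI[of _ "b \<inter> d"]) auto
    qed
    show "space (tuples \<nu> n \<Otimes>\<^sub>M tuples \<nu> m) \<in> E"
      unfolding E_def space_pair_measure using R_space by blast
    fix X assume "X \<in> E"
    then obtain A B where AB: "A \<in> {1..n} \<rightarrow> sets \<nu>" "B \<in> {1..m} \<rightarrow> sets \<nu>"
      and X: "X = Pi\<^sub>E {1..n} A \<times> Pi\<^sub>E {1..m} B"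
      unfolding E_def R_def by blast
    have A: "\<And>i. i \<in> {1..n} \<Longrightarrow> A i \<in> sets \<nu>" and B: "\<And>i. i \<in> {1..m} \<Longrightarrow> B i \<in> sets \<nu>"
      using AB by auto
    \<comment> \<open>The identity needs \<open>x\<close> in the space of tuples: membership in
      \<open>Pi\<^sub>E\<close> also demands the default value outside the index set.\<close>
    have ind: "indicator (Pi\<^sub>E {1..k} C) x = (\<Prod>i=1..k. indicator (C i) (x i) :: real)"
      if "x \<in> space (tuples \<nu> k)" for k C x
    proof -
      have "x \<in> Pi\<^sub>E {1..k} C \<longleftrightarrow> (\<forall>i\<in>{1..k}. x i \<in> C i)"
        using that by (auto simp: space_PiM PiE_def)
      then show ?thesis by (auto simp: indicator_def)
    qed
    have *: "indicator X w = ennreal ((\<Prod>i=1..n. indicator (A i) (fst w i)) * (\<Prod>k=1..m. indicator (B k) (snd w k)))"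
      if "w \<in> space (tuples \<nu> n \<Otimes>\<^sub>M tuples \<nu> m)" for w
    proof -
      have "indicator X w = ennreal (indicator (Pi\<^sub>E {1..n} A) (fst w) * indicator (Pi\<^sub>E {1..m} B) (snd w))"
        by (cases w) (auto simp: X indicator_def)
      moreover have "fst w \<in> space (tuples \<nu> n)" "snd w \<in> space (tuples \<nu> m)"
        using that by (auto simp: space_pair_measure)
      ultimately show ?thesis using ind by simp
    qed
    have **: "(\<integral>\<^sup>+w. indicator X w * f w \<partial>(tuples \<nu> n \<Otimes>\<^sub>M tuples \<nu> m)) =
        (\<integral>\<^sup>+w. ennreal ((\<Prod>i=1..n. indicator (A i) (fst w i)) * (\<Prod>k=1..m. indicator (B k) (snd w k))) * f w \<partial>(tuples \<nu> n \<Otimes>\<^sub>M tuples \<nu> m))" for f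
      by (intro nn_integral_cong) (simp only: *)
    show "(\<integral>\<^sup>+w. indicator X w * f w \<partial>(tuples \<nu> n \<Otimes>\<^sub>M tuples \<nu> m)) =
        (\<integral>\<^sup>+w. indicator X w * f' w \<partial>(tuples \<nu> n \<Otimes>\<^sub>M tuples \<nu> m))"
      unfolding ** by (rule eq) (rule A B, assumption)+
  qed
qed

section \<open>Partial matchings and their generating function\<close>

section \<open>Sums over injections\<close>

lemma prod_diff_fact:
  assumes "s \<le> n"
  shows "(\<Prod>i<s. real (n - i)) = fact n / fact (n - s)"
  using assms
proof (induction s)
  case (Suc s)
  have "fact (n - s) = real (n - s) * fact (n - Suc s)"
    using Suc.prems by (simp add: Suc_diff_Suc fact_reduce)
  moreover have "(\<Prod>i<s. real (n - i)) = fact n / fact (n - s)" "real (n - s) \<noteq> 0"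
    using Suc by auto
  ultimately show ?case by simp
qed simp

lemma card_injections:
  assumes "finite S" "finite I" "card S \<le> card I"
  shows "real (card {\<pi>. \<pi> \<in> S \<rightarrow>\<^sub>E I \<and> inj_on \<pi> S}) = fact (card I) / fact (card I - card S)"
proof -
  have "real (card {\<pi>. \<pi> \<in> S \<rightarrow>\<^sub>E I \<and> inj_on \<pi> S}) = (\<Prod>i<card S. real (card I - i))"
    using card_inj_on_subset_funcset[of S I S] assms by (simp add: atLeast0LessThan)
  then show ?thesis using prod_diff_fact[OF assms(3)] by simp
qed

lemma finite_injections:
  "finite S \<Longrightarrow> finite I \<Longrightarrow> finite {\<pi>. \<pi> \<in> S \<rightarrow>\<^sub>E I \<and> inj_on \<pi> S}"
  by (rule finite_subset[of _ "S \<rightarrow>\<^sub>E I"]) (auto intro: finite_PiE)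

text \<open>Group the injections by their image \<open>T\<close>. Each \<open>T\<close> of the right
  size is the image of \<open>fact (card S)\<close> of them, all with the same product.\<close>

lemma sum_injections_prod:
  fixes b :: "'i \<Rightarrow> real"
  assumes "finite S" "finite I"
  shows "(\<Sum>\<pi> | \<pi> \<in> S \<rightarrow>\<^sub>E I \<and> inj_on \<pi> S. \<Prod>i\<in>S. b (\<pi> i)) =
    fact (card S) * (\<Sum>T | T \<subseteq> I \<and> card T = card S. \<Prod>l\<in>T. b l)"
proof -
  let ?J = "{\<pi>. \<pi> \<in> S \<rightarrow>\<^sub>E I \<and> inj_on \<pi> S}"
  let ?T = "{T. T \<subseteq> I \<and> card T = card S}"
  have "(\<Sum>\<pi>\<in>?J. \<Prod>i\<in>S. b (\<pi> i)) = (\<Sum>T\<in>?T. \<Sum>\<pi> | \<pi> \<in> ?J \<and> \<pi> ` S = T. \<Prod>i\<in>S. b (\<pi> i))"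
    by (rule sum.group[symmetric]) (use assms in \<open>auto intro!: finite_injections simp: card_image\<close>)
  also have "\<dots> = (\<Sum>T\<in>?T. fact (card S) * (\<Prod>l\<in>T. b l))"
  proof (intro sum.cong refl)
    fix T assume T: "T \<in> ?T"
    then have finT: "finite T" using assms by (auto intro: finite_subset)
    have eq: "{\<pi>. \<pi> \<in> ?J \<and> \<pi> ` S = T} = {\<pi>. \<pi> \<in> S \<rightarrow>\<^sub>E T \<and> inj_on \<pi> S}"
    proof (intro set_eqI iffI)
      fix \<pi> assume "\<pi> \<in> {\<pi>. \<pi> \<in> S \<rightarrow>\<^sub>E T \<and> inj_on \<pi> S}"
      then have "\<pi> \<in> S \<rightarrow>\<^sub>E T" "inj_on \<pi> S" by auto
      moreover then have "\<pi> ` S = T"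
        using T finT by (intro card_subset_eq) (auto simp: card_image)
      ultimately show "\<pi> \<in> {\<pi>. \<pi> \<in> ?J \<and> \<pi> ` S = T}"
        using T by (auto simp: PiE_def Pi_def)
    qed (auto simp: PiE_def Pi_def)
    have "(\<Sum>\<pi> | \<pi> \<in> ?J \<and> \<pi> ` S = T. \<Prod>i\<in>S. b (\<pi> i)) = (\<Sum>\<pi> | \<pi> \<in> ?J \<and> \<pi> ` S = T. \<Prod>l\<in>T. b l)"
      by (intro sum.cong refl) (auto simp: prod.reindex)
    also have "\<dots> = real (card {\<pi>. \<pi> \<in> S \<rightarrow>\<^sub>E T \<and> inj_on \<pi> S}) * (\<Prod>l\<in>T. b l)"
      unfolding eq by simp
    also have "\<dots> = fact (card S) * (\<Prod>l\<in>T. b l)"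
      using card_injections[OF assms(1) finT] T by simp
    finally show "(\<Sum>\<pi> | \<pi> \<in> ?J \<and> \<pi> ` S = T. \<Prod>i\<in>S. b (\<pi> i)) = fact (card S) * (\<Prod>l\<in>T. b l)" .
  qed
  finally show ?thesis by (simp add: sum_distrib_left)
qed

lemma sum_over_card:
  fixes g :: "nat \<Rightarrow> real"
  shows "(\<Sum>S | S \<subseteq> {1..m} \<and> card S \<le> n. g (card S)) = (\<Sum>s\<le>n. real (m choose s) * g s)"
proof -
  have "(\<Sum>S | S \<subseteq> {1..m} \<and> card S \<le> n. g (card S)) =
      (\<Sum>s\<le>n. \<Sum>S | S \<in> {S. S \<subseteq> {1..m} \<and> card S \<le> n} \<and> card S = s. g (card S))"
    by (rule sum.group[symmetric]) auto
  also have "\<dots> = (\<Sum>s\<le>n. real (m choose s) * g s)"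
  proof (intro sum.cong refl)
    fix s assume "s \<in> {..n}"
    then have "{S. S \<in> {S. S \<subseteq> {1..m} \<and> card S \<le> n} \<and> card S = s} = {S. S \<subseteq> {1..m} \<and> card S = s}"
      by auto
    then show "(\<Sum>S | S \<in> {S. S \<subseteq> {1..m} \<and> card S \<le> n} \<and> card S = s. g (card S)) = real (m choose s) * g s"
      using n_subsets[of "{1..m}" s] by simp
  qed
  finally show ?thesis .
qed

text \<open>This is the exponential generating function, in the number of observations, of partial
  matchings with hidden points. Only the size \<open>s\<close> of \<open>S\<close> matters. Choosing
  and matching \<open>S\<close> leaves \<open>c ^ (m - s) / fact (m - s)\<close>, a shifted
  exponential series in \<open>m\<close>, times the \<open>s\<close>-th elementary symmetric
  polynomial of \<open>b\<close>; weighted by powers of \<open>q\<close>, these polynomials expand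
  the product.\<close>

lemma sums_partial_injections:
  fixes b :: "nat \<Rightarrow> real" and c q :: real
  shows "(\<lambda>m. 1 / fact m * (\<Sum>S | S \<subseteq> {1..m} \<and> card S \<le> n.
      q ^ (n - card S) * c ^ (m - card S) * (\<Sum>\<pi> | \<pi> \<in> S \<rightarrow>\<^sub>E {1..n} \<and> inj_on \<pi> S. \<Prod>i\<in>S. b (\<pi> i))))
    sums (exp c * (\<Prod>l=1..n. q + b l))"
proof -
  define e where "e s = (\<Sum>T | T \<subseteq> {1..n} \<and> card T = s. \<Prod>l\<in>T. b l)" for s
  have term_eq: "1 / fact m * (\<Sum>S | S \<subseteq> {1..m} \<and> card S \<le> n.
      q ^ (n - card S) * c ^ (m - card S) * (\<Sum>\<pi> | \<pi> \<in> S \<rightarrow>\<^sub>E {1..n} \<and> inj_on \<pi> S. \<Prod>i\<in>S. b (\<pi> i))) =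
    (\<Sum>s\<le>n. q ^ (n - s) * e s * (if m < s then 0 else c ^ (m - s) / fact (m - s)))" for m
  proof -
    have "(\<Sum>S | S \<subseteq> {1..m} \<and> card S \<le> n.
        q ^ (n - card S) * c ^ (m - card S) * (\<Sum>\<pi> | \<pi> \<in> S \<rightarrow>\<^sub>E {1..n} \<and> inj_on \<pi> S. \<Prod>i\<in>S. b (\<pi> i))) =
      (\<Sum>S | S \<subseteq> {1..m} \<and> card S \<le> n. q ^ (n - card S) * c ^ (m - card S) * (fact (card S) * e (card S)))"
      unfolding e_def by (intro sum.cong refl arg_cong2[of _ _ _ _ "(*)"] sum_injections_prod) (auto intro: finite_subset)
    also have "\<dots> = (\<Sum>s\<le>n. real (m choose s) * (q ^ (n - s) * c ^ (m - s) * (fact s * e s)))"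
      by (rule sum_over_card)
    also have "1 / fact m * \<dots> = (\<Sum>s\<le>n. q ^ (n - s) * e s * (if m < s then 0 else c ^ (m - s) / fact (m - s)))"
      unfolding sum_distrib_left
    proof (intro sum.cong refl)
      fix s
      show "1 / fact m * (real (m choose s) * (q ^ (n - s) * c ^ (m - s) * (fact s * e s))) =
          q ^ (n - s) * e s * (if m < s then 0 else c ^ (m - s) / fact (m - s))"
      proof (cases "m < s")
        case False
        then have "real (m choose s) = fact m / (fact s * fact (m - s))"
          by (simp add: binomial_fact)
        then show ?thesis using False by simp
      qed (simp add: binomial_eq_0)
    qed
    finally show ?thesis .
  qed
  have "(\<lambda>m. if m < s then 0 else c ^ (m - s) / fact (m - s)) sums exp c" for s
  proof -
    have "(\<lambda>m. (\<lambda>m. if m < s then 0 else c ^ (m - s) / fact (m - s)) (m + s)) sums exp c"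
      using exp_converges[of c] by (simp add: divide_inverse mult.commute)
    then show ?thesis by (subst (asm) sums_iff_shift) simp
  qed
  then have "(\<lambda>m. \<Sum>s\<le>n. q ^ (n - s) * e s * (if m < s then 0 else c ^ (m - s) / fact (m - s)))
      sums (\<Sum>s\<le>n. q ^ (n - s) * e s * exp c)"
    by (intro sums_sum sums_mult)
  also have "(\<Sum>s\<le>n. q ^ (n - s) * e s * exp c) = exp c * (\<Prod>l=1..n. q + b l)"
  proof -
    have "(\<Prod>l=1..n. q + b l) = (\<Prod>l\<in>{1..n}. b l + q)" by (simp add: add.commute)
    also have "\<dots> = (\<Sum>T\<in>Pow {1..n}. (\<Prod>l\<in>T. b l) * q ^ (n - card T))"
      unfolding prod_add[OF finite_atLeastAtMost]
      by (intro sum.cong refl) (auto simp: card_Diff_subset finite_subset)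
    also have "\<dots> = (\<Sum>s\<le>n. \<Sum>T | T \<in> Pow {1..n} \<and> card T = s. (\<Prod>l\<in>T. b l) * q ^ (n - card T))"
      by (rule sum.group[symmetric]) (use card_mono[of "{1..n}"] in auto)
    also have "\<dots> = (\<Sum>s\<le>n. q ^ (n - s) * e s)"
      unfolding e_def sum_distrib_left by (intro sum.cong refl) auto
    finally show ?thesis by (simp add: sum_distrib_left mult_ac)
  qed
  finally show ?thesis unfolding term_eq .
qed

section \<open>Symmetry and integrals of the joint formula\<close>

section \<open>The explicit formulas\<close>

text \<open>Serves to realize an assignment of observations as a permutation of coordinates, under
  which the Janossy density is invariant. The complements have equal cardinality, so a bijection
  between them completes \<open>f\<close>.\<close>

lemma extend_injection_permutes:
  assumes "finite B" "A \<subseteq> B" "inj_on f A" "f ` A \<subseteq> B"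
  shows "\<exists>\<sigma>. \<sigma> permutes B \<and> (\<forall>i\<in>A. \<sigma> i = f i)"
proof -
  have "card (B - A) = card (B - f ` A)"
    using assms by (simp add: card_Diff_subset finite_subset card_image)
  then obtain h where h: "bij_betw h (B - A) (B - f ` A)"
    using finite_same_card_bij[of "B - A" "B - f ` A"] assms(1) by auto
  define \<sigma> where "\<sigma> i = (if i \<in> A then f i else if i \<in> B then h i else i)" for i
  have "bij_betw \<sigma> A (f ` A)"
    using bij_betw_imageI[OF assms(3) refl] by (subst bij_betw_cong[of _ _ f]) (auto simp: \<sigma>_def)
  moreover have "bij_betw \<sigma> (B - A) (B - f ` A)"
    using h by (subst bij_betw_cong[of _ _ h]) (auto simp: \<sigma>_def)
  ultimately have "bij_betw \<sigma> (A \<union> (B - A)) (f ` A \<union> (B - f ` A))"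
    by (rule bij_betw_combine) auto
  moreover have "A \<union> (B - A) = B" "f ` A \<union> (B - f ` A) = B" using assms by auto
  ultimately have "\<sigma> permutes B"
    using assms(2) by (intro bij_imp_permutes) (auto simp: \<sigma>_def)
  then show ?thesis by (intro exI[of _ \<sigma>]) (auto simp: \<sigma>_def)
qed

text \<open>The analytic data of the two formulas, without a probability space. \<open>lt\<close>
  has finite mass for each hidden point rather than mass 1, since detection may fail.\<close>

locale detection_model =
  fixes \<nu> :: "'a measure" and j :: "nat \<Rightarrow> (nat \<Rightarrow> 'a) \<Rightarrow> real"
    and q :: real and lt :: "'a \<Rightarrow> 'a \<Rightarrow> real" and lc :: "'a \<Rightarrow> real"
  assumes sf: "sigma_finite_measure \<nu>"
    and j_meas [measurable]: "\<And>n. j n \<in> borel_measurable (tuples \<nu> n)"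
    and j_sym: "\<And>n. symmetric_on_tuples \<nu> n (j n)"
    and j_nonneg: "\<And>n x. x \<in> space (tuples \<nu> n) \<Longrightarrow> 0 \<le> j n x"
    and q_nonneg: "0 \<le> q"
    and lt_meas: "(\<lambda>(z, x). lt z x) \<in> borel_measurable (\<nu> \<Otimes>\<^sub>M \<nu>)"
    and lt_nonneg: "\<And>z x. z \<in> space \<nu> \<Longrightarrow> x \<in> space \<nu> \<Longrightarrow> 0 \<le> lt z x"
    and lt_finite: "\<And>x. x \<in> space \<nu> \<Longrightarrow> (\<integral>\<^sup>+z. ennreal (lt z x) \<partial>\<nu>) < \<infinity>"
    and lc_meas [measurable]: "lc \<in> borel_measurable \<nu>"
    and lc_nonneg: "\<And>z. z \<in> space \<nu> \<Longrightarrow> 0 \<le> lc z"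
    and lc_finite: "(\<integral>\<^sup>+z. ennreal (lc z) \<partial>\<nu>) < \<infinity>"
begin

abbreviation injections :: "nat set \<Rightarrow> nat \<Rightarrow> (nat \<Rightarrow> nat) set" where
  "injections S n \<equiv> {\<pi>. \<pi> \<in> S \<rightarrow>\<^sub>E {1..n} \<and> inj_on \<pi> S}"

abbreviation jf :: "nat \<Rightarrow> nat \<Rightarrow> (nat \<Rightarrow> 'a) \<Rightarrow> (nat \<Rightarrow> 'a) \<Rightarrow> real" where
  "jf \<equiv> joint_formula \<nu> j q lt lc"

abbreviation void :: real where "void \<equiv> exp (- (\<integral>y. lc y \<partial>\<nu>))"

lemma tuples_space: "x \<in> space (tuples \<nu> n) \<Longrightarrow> i \<in> {1..n} \<Longrightarrow> x i \<in> space \<nu>"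
  by (auto simp: space_PiM)

lemma lt_section_meas [measurable]: "x \<in> space \<nu> \<Longrightarrow> (\<lambda>z. lt z x) \<in> borel_measurable \<nu>"
  using measurable_compose[OF measurable_Pair2' lt_meas, of x] by simp

lemma lt_section_meas' [measurable]: "z \<in> space \<nu> \<Longrightarrow> (\<lambda>x. lt z x) \<in> borel_measurable \<nu>"
  using measurable_compose[OF measurable_Pair1' lt_meas, of z] by simp

lemma jf_alt:
  "jf n m x z = (\<Sum>S | S \<subseteq> {1..m} \<and> card S \<le> n. \<Sum>\<pi>\<in>injections S n.
     void * j n x * (q ^ (n - card S) * (\<Prod>k\<in>{1..m} - S. lc (z k)) * (\<Prod>i\<in>S. lt (z i) (x (\<pi> i)))))"
  by (simp add: joint_formula_def sum_distrib_left mult.assoc)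

lemma jf_meas: "(\<lambda>(x, z). jf n m x z) \<in> borel_measurable (tuples \<nu> n \<Otimes>\<^sub>M tuples \<nu> m)"
proof -
  have lt': "(\<lambda>w. lt (snd w i) (fst w l)) \<in> borel_measurable (tuples \<nu> n \<Otimes>\<^sub>M tuples \<nu> m)"
    if [measurable]: "i \<in> {1..m}" "l \<in> {1..n}" for i l
  proof -
    have "(\<lambda>w. (snd w i, fst w l)) \<in> tuples \<nu> n \<Otimes>\<^sub>M tuples \<nu> m \<rightarrow>\<^sub>M \<nu> \<Otimes>\<^sub>M \<nu>"
      by measurable
    from measurable_compose[OF this lt_meas] show ?thesis by simp
  qed
  have lc': "(\<lambda>w. lc (snd w k)) \<in> borel_measurable (tuples \<nu> n \<Otimes>\<^sub>M tuples \<nu> m)"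
    if [measurable]: "k \<in> {1..m}" for k
    by measurable
  have j': "(\<lambda>w. j n (fst w)) \<in> borel_measurable (tuples \<nu> n \<Otimes>\<^sub>M tuples \<nu> m)"
    by measurable
  have "(\<lambda>w. \<Prod>i\<in>S. lt (snd w i) (fst w (\<pi> i))) \<in> borel_measurable (tuples \<nu> n \<Otimes>\<^sub>M tuples \<nu> m)"
    if "S \<subseteq> {1..m}" "\<pi> \<in> injections S n" for S \<pi>
    using that by (intro borel_measurable_prod lt') auto
  moreover have "(\<lambda>w. \<Prod>k\<in>{1..m} - S. lc (snd w k)) \<in> borel_measurable (tuples \<nu> n \<Otimes>\<^sub>M tuples \<nu> m)" for S
    by (intro borel_measurable_prod lc') auto
  ultimately show ?thesis
    unfolding case_prod_beta jf_alt
    by (intro borel_measurable_sum borel_measurable_times j' borel_measurable_const) auto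
qed

lemma jf_meas_x: "z \<in> space (tuples \<nu> m) \<Longrightarrow> (\<lambda>x. jf n m x z) \<in> borel_measurable (tuples \<nu> n)"
  using measurable_compose[OF measurable_Pair2' jf_meas, of z m n] by simp

lemma jf_meas_z: "x \<in> space (tuples \<nu> n) \<Longrightarrow> (\<lambda>z. jf n m x z) \<in> borel_measurable (tuples \<nu> m)"
  using measurable_compose[OF measurable_Pair1' jf_meas, of x n m] by simp

lemma jf_nonneg:
  assumes "x \<in> space (tuples \<nu> n)" "z \<in> space (tuples \<nu> m)"
  shows "0 \<le> jf n m x z"
  unfolding jf_alt
  by (intro sum_nonneg mult_nonneg_nonneg prod_nonneg j_nonneg lt_nonneg lc_nonneg zero_le_power q_nonneg
      tuples_space[OF assms(1)] tuples_space[OF assms(2)] assms) auto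

text \<open>Permuting the hidden points permutes the values of the assignments, a bijection on the
  injections out of each \<open>S\<close>; \<open>j n\<close> itself is symmetric.\<close>

lemma jf_permute_x:
  assumes \<sigma>: "\<sigma> permutes {1..n}" and x: "x \<in> space (tuples \<nu> n)"
  shows "jf n m (x \<circ> \<sigma>) z = jf n m x z"
proof -
  have inv: "inv \<sigma> permutes {1..n}" using \<sigma> by (rule permutes_inv)
  have inj: "(\<lambda>i\<in>S. \<tau> (\<pi> i)) \<in> injections S n" if "\<pi> \<in> injections S n" "\<tau> permutes {1..n}" for \<pi> \<tau> S
    using that permutes_in_image[OF that(2)] permutes_inj[OF that(2)]
    by (auto simp: PiE_def Pi_def inj_on_def dest: injD)
  have "(\<Sum>\<pi>\<in>injections S n. \<Prod>i\<in>S. lt (z i) ((x \<circ> \<sigma>) (\<pi> i))) =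
      (\<Sum>\<pi>\<in>injections S n. \<Prod>i\<in>S. lt (z i) (x (\<pi> i)))" for S
  proof (rule sum.reindex_bij_witness[where i = "\<lambda>\<pi>. \<lambda>i\<in>S. inv \<sigma> (\<pi> i)" and j = "\<lambda>\<pi>. \<lambda>i\<in>S. \<sigma> (\<pi> i)"])
    fix \<pi> assume \<pi>: "\<pi> \<in> injections S n"
    show "(\<lambda>i\<in>S. \<sigma> (\<pi> i)) \<in> injections S n" "(\<lambda>i\<in>S. inv \<sigma> (\<pi> i)) \<in> injections S n"
      using inj \<pi> \<sigma> inv by blast+
    show "(\<lambda>i\<in>S. inv \<sigma> ((\<lambda>i\<in>S. \<sigma> (\<pi> i)) i)) = \<pi>" "(\<lambda>i\<in>S. \<sigma> ((\<lambda>i\<in>S. inv \<sigma> (\<pi> i)) i)) = \<pi>"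
      using \<pi> permutes_inverses[OF \<sigma>] by (auto simp: fun_eq_iff PiE_def extensional_def restrict_def)
    show "(\<Prod>i\<in>S. lt (z i) (x ((\<lambda>i\<in>S. \<sigma> (\<pi> i)) i))) = (\<Prod>i\<in>S. lt (z i) ((x \<circ> \<sigma>) (\<pi> i)))"
      by (intro prod.cong) auto
  qed
  moreover have "j n (x \<circ> \<sigma>) = j n x"
    using j_sym \<sigma> x by (auto simp: symmetric_on_tuples_def)
  ultimately show ?thesis unfolding joint_formula_def by simp
qed

text \<open>Permuting the observations moves the detected set \<open>S\<close> to its image and
  relabels the domain of each assignment; restriction keeps the relabelled maps in the extensional
  function space.\<close>

lemma jf_permute_z:
  assumes \<sigma>: "\<sigma> permutes {1..m}"
  shows "jf n m x (z \<circ> \<sigma>) = jf n m x z"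
proof -
  have inv: "inv \<sigma> permutes {1..m}" using \<sigma> by (rule permutes_inv)
  let ?\<S> = "{S. S \<subseteq> {1..m} \<and> card S \<le> n}"
  let ?t = "\<lambda>z S. q ^ (n - card S) * (\<Prod>k\<in>{1..m} - S. lc (z k)) * (\<Sum>\<pi>\<in>injections S n. \<Prod>i\<in>S. lt (z i) (x (\<pi> i)))"
  have im: "\<tau> ` S \<in> ?\<S>" if "S \<in> ?\<S>" "\<tau> permutes {1..m}" for S \<tau>
    using that permutes_image[OF that(2)] card_image[of \<tau> S] permutes_inj_on[OF that(2)]
    by (auto simp: permutes_in_image)
  have inj: "(\<lambda>i\<in>\<tau> ` S. \<pi> (inv \<tau> i)) \<in> injections (\<tau> ` S) n"
    if \<pi>: "\<pi> \<in> injections S n" and \<tau>: "\<tau> permutes {1..m}" for S \<tau> \<pi>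
  proof -
    have "\<pi> (inv \<tau> i) \<in> {1..n}" if "i \<in> \<tau> ` S" for i
      using that \<pi> permutes_inverses(2)[OF \<tau>] by auto
    moreover have "inj_on (\<lambda>i. \<pi> (inv \<tau> i)) (\<tau> ` S)"
      using \<pi> permutes_inverses(2)[OF \<tau>] by (auto simp: inj_on_def)
    ultimately show ?thesis
      by (simp add: restrict_PiE_iff)
  qed
  have "(\<Sum>S\<in>?\<S>. ?t (z \<circ> \<sigma>) S) = (\<Sum>S\<in>?\<S>. ?t z S)"
  proof (rule sum.reindex_bij_witness[where i = "(`) (inv \<sigma>)" and j = "(`) \<sigma>"])
    fix S assume S: "S \<in> ?\<S>"
    show "inv \<sigma> ` \<sigma> ` S = S" "\<sigma> ` inv \<sigma> ` S = S"
      using permutes_inverses[OF \<sigma>] by (auto simp: image_image)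
    show "\<sigma> ` S \<in> ?\<S>" by (rule im[OF S \<sigma>])
    show "inv \<sigma> ` S \<in> ?\<S>" by (rule im[OF S inv])
    have card: "card (\<sigma> ` S) = card S"
      using card_image permutes_inj_on[OF \<sigma>] by blast
    have diff: "{1..m} - \<sigma> ` S = \<sigma> ` ({1..m} - S)"
      using permutes_image[OF \<sigma>] image_set_diff[OF permutes_inj[OF \<sigma>], of "{1..m}" S] by simp
    have lc_eq: "(\<Prod>k\<in>{1..m} - \<sigma> ` S. lc (z k)) = (\<Prod>k\<in>{1..m} - S. lc ((z \<circ> \<sigma>) k))"
      unfolding diff by (subst prod.reindex) (auto simp: permutes_inj_on[OF \<sigma>])
    have "(\<Sum>\<pi>\<in>injections (\<sigma> ` S) n. \<Prod>i\<in>\<sigma> ` S. lt (z i) (x (\<pi> i))) =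
        (\<Sum>\<pi>\<in>injections S n. \<Prod>i\<in>S. lt ((z \<circ> \<sigma>) i) (x (\<pi> i)))"
    proof (rule sum.reindex_bij_witness[where i = "\<lambda>\<pi>. \<lambda>i\<in>\<sigma> ` S. \<pi> (inv \<sigma> i)" and j = "\<lambda>\<pi>. \<lambda>i\<in>S. \<pi> (\<sigma> i)"])
      fix \<pi> assume \<pi>: "\<pi> \<in> injections (\<sigma> ` S) n"
      show "(\<lambda>i\<in>S. \<pi> (\<sigma> i)) \<in> injections S n"
        using \<pi> permutes_inj[OF \<sigma>] by (auto simp: restrict_PiE_iff inj_on_def dest: injD)
      show "(\<lambda>i\<in>\<sigma> ` S. (\<lambda>i\<in>S. \<pi> (\<sigma> i)) (inv \<sigma> i)) = \<pi>"
        using \<pi> permutes_inverses[OF \<sigma>] by (auto simp: fun_eq_iff PiE_def extensional_def restrict_def image_iff)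
      show "(\<Prod>i\<in>S. lt ((z \<circ> \<sigma>) i) (x ((\<lambda>i\<in>S. \<pi> (\<sigma> i)) i))) = (\<Prod>i\<in>\<sigma> ` S. lt (z i) (x (\<pi> i)))"
        by (subst prod.reindex) (auto simp: permutes_inj_on[OF \<sigma>])
    next
      fix \<pi> assume \<pi>: "\<pi> \<in> injections S n"
      show "(\<lambda>i\<in>\<sigma> ` S. \<pi> (inv \<sigma> i)) \<in> injections (\<sigma> ` S) n"
        by (rule inj[OF \<pi> \<sigma>])
      show "(\<lambda>i\<in>S. (\<lambda>i\<in>\<sigma> ` S. \<pi> (inv \<sigma> i)) (\<sigma> i)) = \<pi>"
        using \<pi> permutes_inverses[OF \<sigma>] by (auto simp: fun_eq_iff PiE_def extensional_def restrict_def)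
    qed
    then show "?t z (\<sigma> ` S) = ?t (z \<circ> \<sigma>) S"
      unfolding card lc_eq by simp
  qed
  then show ?thesis unfolding joint_formula_def by simp
qed

lemma nn_integral_weighted:
  assumes f: "f \<in> borel_measurable \<nu>" "\<And>y. y \<in> space \<nu> \<Longrightarrow> 0 \<le> f y" "(\<integral>\<^sup>+y. ennreal (f y) \<partial>\<nu>) < \<infinity>"
    and g: "g \<in> borel_measurable \<nu>" "\<And>y. 0 \<le> g y" "\<And>y. g y \<le> 1"
  shows "(\<integral>\<^sup>+y. ennreal (g y * f y) \<partial>\<nu>) = ennreal (\<integral>y. g y * f y \<partial>\<nu>)"
    and "integrable \<nu> (\<lambda>y. g y * f y)"
    and "0 \<le> (\<integral>y. g y * f y \<partial>\<nu>)"
proof -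
  note [measurable] = f(1) g(1)
  have "(\<integral>\<^sup>+y. ennreal (g y * f y) \<partial>\<nu>) \<le> (\<integral>\<^sup>+y. ennreal (f y) \<partial>\<nu>)"
    using f(2) g by (intro nn_integral_mono ennreal_leI) (auto simp: mult_left_le_one_le)
  then have fin: "(\<integral>\<^sup>+y. ennreal (g y * f y) \<partial>\<nu>) < \<infinity>" using f(3) by (rule le_less_trans)
  show int: "integrable \<nu> (\<lambda>y. g y * f y)"
    using f(2) g(2) fin by (intro integrableI_nonneg) (auto intro!: AE_I2)
  show "(\<integral>\<^sup>+y. ennreal (g y * f y) \<partial>\<nu>) = ennreal (\<integral>y. g y * f y \<partial>\<nu>)"
    using f(2) g(2) int by (intro nn_integral_eq_integral) (auto intro!: AE_I2)
  show "0 \<le> (\<integral>y. g y * f y \<partial>\<nu>)"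
    using f(2) g(2) by (intro Bochner_Integration.integral_nonneg) auto
qed

text \<open>For fixed hidden points the integral over the observations splits, for each detected set
  and assignment, into one-dimensional integrals: \<open>b\<close> for detections and
  \<open>c\<close> for clutter. The series that remains is
  \<open>sums_partial_injections\<close>.\<close>

lemma suminf_pgfl_jf:
  fixes g :: "'a \<Rightarrow> real"
  assumes x: "x \<in> space (tuples \<nu> n)"
    and g: "g \<in> borel_measurable \<nu>" "\<And>y. 0 \<le> g y" "\<And>y. g y \<le> 1"
  shows "(\<Sum>m. ennreal (1 / fact m) * (\<integral>\<^sup>+z. ennreal (\<Prod>k=1..m. g (z k)) * ennreal (jf n m x z) \<partial>tuples \<nu> m)) =
    ennreal (void * exp (\<integral>y. g y * lc y \<partial>\<nu>) * j n x * (\<Prod>i=1..n. q + (\<integral>y. g y * lt y (x i) \<partial>\<nu>)))"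
proof -
  note [measurable] = g(1)
  define b where "b l = (\<integral>y. g y * lt y (x l) \<partial>\<nu>)" for l
  define c where "c = (\<integral>y. g y * lc y \<partial>\<nu>)"
  have xl: "x l \<in> space \<nu>" if "l \<in> {1..n}" for l
    using tuples_space[OF x that] .
  have b: "(\<integral>\<^sup>+y. ennreal (g y * lt y (x l)) \<partial>\<nu>) = ennreal (b l)" "0 \<le> b l" if "l \<in> {1..n}" for l
    unfolding b_def using xl[OF that] g lt_nonneg lt_finite by (auto intro!: nn_integral_weighted)
  have c: "(\<integral>\<^sup>+y. ennreal (g y * lc y) \<partial>\<nu>) = ennreal c" "0 \<le> c"
    unfolding c_def using g lc_nonneg lc_finite by (auto intro!: nn_integral_weighted)
  define A where "A m = (\<Sum>S | S \<subseteq> {1..m} \<and> card S \<le> n.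
      q ^ (n - card S) * c ^ (m - card S) * (\<Sum>\<pi>\<in>injections S n. \<Prod>i\<in>S. b (\<pi> i)))" for m
  have jn: "0 \<le> void * j n x" using j_nonneg[OF x] by simp
  have b\<pi>: "0 \<le> b (\<pi> i)" if "\<pi> \<in> injections S n" "i \<in> S" for S \<pi> i
    using that by (intro b(2)) (blast dest: PiE_mem)
  have A_nonneg: "0 \<le> A m" for m
    unfolding A_def
    by (intro sum_nonneg mult_nonneg_nonneg prod_nonneg zero_le_power q_nonneg c(2)) (rule b\<pi>)
  have "(\<integral>\<^sup>+z. ennreal (\<Prod>k=1..m. g (z k)) * ennreal (jf n m x z) \<partial>tuples \<nu> m) = ennreal (void * j n x * A m)" for m
  proof -
    \<comment> \<open>The density of the \<open>k\<close>-th observation according to its role, so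
      that the products over \<open>S\<close> and its complement merge into one product over all
      coordinates.\<close>
    define d where "d S \<pi> k y = (if k \<in> S then lt y (x (\<pi> k)) else lc y)" for S :: "nat set" and \<pi> and k :: nat and y
    define C where "C S = void * j n x * q ^ (n - card S)" for S :: "nat set"
    have C: "0 \<le> C S" for S unfolding C_def using jn q_nonneg by simp
    have d_meas [measurable]: "d S \<pi> k \<in> borel_measurable \<nu>" if "\<pi> \<in> injections S n" for S \<pi> k
    proof (cases "k \<in> S")
      case True
      then have "x (\<pi> k) \<in> space \<nu>" using that by (intro xl) auto
      then show ?thesis unfolding d_def using True by simp
    qed (simp add: d_def[abs_def])
    have d_nonneg: "0 \<le> d S \<pi> k y" if "\<pi> \<in> injections S n" "y \<in> space \<nu>" for S \<pi> k y
      using that xl lt_nonneg lc_nonneg by (auto simp: d_def Pi_iff PiE_def)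
    have split: "(\<Prod>k=1..m. if k \<in> S then u k else v k) = (\<Prod>k\<in>S. u k) * (\<Prod>k\<in>{1..m} - S. v k)"
      if "S \<subseteq> {1..m}" for S and u v :: "nat \<Rightarrow> real"
    proof -
      have "{1..m} \<inter> {k. k \<in> S} = S" "{1..m} \<inter> - {k. k \<in> S} = {1..m} - S" using that by auto
      then show ?thesis by (simp add: prod.If_cases)
    qed
    have "(\<integral>\<^sup>+z. ennreal (\<Prod>k=1..m. g (z k)) * ennreal (jf n m x z) \<partial>tuples \<nu> m) =
        (\<integral>\<^sup>+z. (\<Sum>S | S \<subseteq> {1..m} \<and> card S \<le> n. \<Sum>\<pi>\<in>injections S n.
            ennreal (C S) * (\<Prod>k=1..m. ennreal (g (z k) * d S \<pi> k (z k)))) \<partial>tuples \<nu> m)"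
    proof (intro nn_integral_cong)
      fix z assume z: "z \<in> space (tuples \<nu> m)"
      have nn: "0 \<le> g (z k) * d S \<pi> k (z k)" if "k \<in> {1..m}" "\<pi> \<in> injections S n" for S \<pi> k
        using d_nonneg[OF that(2) tuples_space[OF z that(1)]] g(2) by simp
      have "(\<Prod>k=1..m. g (z k)) * jf n m x z =
          (\<Sum>S | S \<subseteq> {1..m} \<and> card S \<le> n. \<Sum>\<pi>\<in>injections S n. C S * (\<Prod>k=1..m. g (z k) * d S \<pi> k (z k)))"
        unfolding jf_alt sum_distrib_left
      proof (intro sum.cong refl)
        fix S \<pi> assume "S \<in> {S. S \<subseteq> {1..m} \<and> card S \<le> n}" "\<pi> \<in> injections S n"
        then have "(\<Prod>k=1..m. g (z k) * d S \<pi> k (z k)) =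
            (\<Prod>k=1..m. g (z k)) * ((\<Prod>k\<in>S. lt (z k) (x (\<pi> k))) * (\<Prod>k\<in>{1..m} - S. lc (z k)))"
          unfolding prod.distrib d_def by (subst split) auto
        then show "(\<Prod>k=1..m. g (z k)) * (void * j n x * (q ^ (n - card S) * (\<Prod>k\<in>{1..m} - S. lc (z k)) * (\<Prod>i\<in>S. lt (z i) (x (\<pi> i))))) =
            C S * (\<Prod>k=1..m. g (z k) * d S \<pi> k (z k))"
          by (simp add: C_def mult_ac)
      qed
      then have "ennreal (\<Prod>k=1..m. g (z k)) * ennreal (jf n m x z) =
          ennreal (\<Sum>S | S \<subseteq> {1..m} \<and> card S \<le> n. \<Sum>\<pi>\<in>injections S n. C S * (\<Prod>k=1..m. g (z k) * d S \<pi> k (z k)))"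
        using jf_nonneg[OF x z] g(2) by (simp add: ennreal_mult[symmetric] prod_nonneg)
      also have "\<dots> = (\<Sum>S | S \<subseteq> {1..m} \<and> card S \<le> n. \<Sum>\<pi>\<in>injections S n.
            ennreal (C S * (\<Prod>k=1..m. g (z k) * d S \<pi> k (z k))))"
      proof -
        have nn': "0 \<le> C S * (\<Prod>k=1..m. g (z k) * d S \<pi> k (z k))" if "\<pi> \<in> injections S n" for S \<pi>
          by (rule mult_nonneg_nonneg[OF C prod_nonneg]) (rule nn[OF _ that])
        have "(\<Sum>\<pi>\<in>injections S n. ennreal (C S * (\<Prod>k=1..m. g (z k) * d S \<pi> k (z k)))) =
            ennreal (\<Sum>\<pi>\<in>injections S n. C S * (\<Prod>k=1..m. g (z k) * d S \<pi> k (z k)))" for S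
          by (rule sum_ennreal) (rule nn')
        moreover have "0 \<le> (\<Sum>\<pi>\<in>injections S n. C S * (\<Prod>k=1..m. g (z k) * d S \<pi> k (z k)))" for S
          by (rule sum_nonneg) (rule nn')
        ultimately show ?thesis by (simp only: sum_ennreal)
      qed
      also have "\<dots> = (\<Sum>S | S \<subseteq> {1..m} \<and> card S \<le> n. \<Sum>\<pi>\<in>injections S n.
            ennreal (C S) * (\<Prod>k=1..m. ennreal (g (z k) * d S \<pi> k (z k))))"
      proof (intro sum.cong refl)
        fix S \<pi> assume \<pi>: "\<pi> \<in> injections S n"
        have P: "(\<Prod>k=1..m. ennreal (g (z k) * d S \<pi> k (z k))) = ennreal (\<Prod>k=1..m. g (z k) * d S \<pi> k (z k))"
          by (rule prod_ennreal) (rule nn[OF _ \<pi>])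
        show "ennreal (C S * (\<Prod>k=1..m. g (z k) * d S \<pi> k (z k))) =
            ennreal (C S) * (\<Prod>k=1..m. ennreal (g (z k) * d S \<pi> k (z k)))"
          unfolding P by (rule ennreal_mult[OF C prod_nonneg]) (rule nn[OF _ \<pi>])
      qed
      finally show "ennreal (\<Prod>k=1..m. g (z k)) * ennreal (jf n m x z) =
          (\<Sum>S | S \<subseteq> {1..m} \<and> card S \<le> n. \<Sum>\<pi>\<in>injections S n.
            ennreal (C S) * (\<Prod>k=1..m. ennreal (g (z k) * d S \<pi> k (z k))))" .
    qed
    also have "\<dots> = (\<Sum>S | S \<subseteq> {1..m} \<and> card S \<le> n. \<Sum>\<pi>\<in>injections S n.
            ennreal (C S) * (\<Prod>k=1..m. \<integral>\<^sup>+y. ennreal (g y * d S \<pi> k y) \<partial>\<nu>))"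
    proof -
      have 1: "(\<integral>\<^sup>+z. (\<Prod>k=1..m. ennreal (g (z k) * d S \<pi> k (z k))) \<partial>tuples \<nu> m) =
          (\<Prod>k=1..m. \<integral>\<^sup>+y. ennreal (g y * d S \<pi> k y) \<partial>\<nu>)" if "\<pi> \<in> injections S n" for S \<pi>
        using that by (intro product_sigma_finite.product_nn_integral_prod product_sigma_finite_const sf) auto
      have 2: "(\<lambda>z. \<Prod>k=1..m. ennreal (g (z k) * d S \<pi> k (z k))) \<in> borel_measurable (tuples \<nu> m)"
        if [measurable]: "\<pi> \<in> injections S n" for S \<pi>
        by measurable
      have 3: "(\<lambda>z. ennreal (C S) * (\<Prod>k=1..m. ennreal (g (z k) * d S \<pi> k (z k)))) \<in> borel_measurable (tuples \<nu> m)"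
        if "\<pi> \<in> injections S n" for S \<pi>
        using 2[OF that] by measurable
      show ?thesis
        by (subst nn_integral_sum, rule borel_measurable_sum, erule 3, intro sum.cong refl,
            subst nn_integral_sum, erule 3, intro sum.cong refl, subst nn_integral_cmult, erule 2, subst 1) auto
    qed
    also have "\<dots> = (\<Sum>S | S \<subseteq> {1..m} \<and> card S \<le> n. \<Sum>\<pi>\<in>injections S n.
            ennreal (C S * (c ^ (m - card S) * (\<Prod>i\<in>S. b (\<pi> i)))))"
    proof (intro sum.cong refl)
      fix S \<pi> assume S: "S \<in> {S. S \<subseteq> {1..m} \<and> card S \<le> n}" and \<pi>: "\<pi> \<in> injections S n"
      have \<pi>n: "\<pi> k \<in> {1..n}" if "k \<in> S" for k using \<pi> that by auto
      have fS: "finite S" using S by (auto intro: finite_subset)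
      have "(\<integral>\<^sup>+y. ennreal (g y * d S \<pi> k y) \<partial>\<nu>) = ennreal (if k \<in> S then b (\<pi> k) else c)" for k
        using b(1)[OF \<pi>n] c(1) by (simp add: d_def)
      then have "(\<Prod>k=1..m. \<integral>\<^sup>+y. ennreal (g y * d S \<pi> k y) \<partial>\<nu>) = (\<Prod>k=1..m. ennreal (if k \<in> S then b (\<pi> k) else c))"
        by simp
      also have "\<dots> = ennreal (\<Prod>k=1..m. if k \<in> S then b (\<pi> k) else c)"
        using b(2)[OF \<pi>n] c(2) by (intro prod_ennreal) auto
      also have "(\<Prod>k=1..m. if k \<in> S then b (\<pi> k) else c) = c ^ (m - card S) * (\<Prod>i\<in>S. b (\<pi> i))"
        using S fS by (subst split) (auto simp: card_Diff_subset)
      finally show "ennreal (C S) * (\<Prod>k=1..m. \<integral>\<^sup>+y. ennreal (g y * d S \<pi> k y) \<partial>\<nu>) =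
          ennreal (C S * (c ^ (m - card S) * (\<Prod>i\<in>S. b (\<pi> i))))"
        using b(2)[OF \<pi>n] c(2) C[of S] by (simp add: ennreal_mult prod_nonneg)
    qed
    also have "\<dots> = ennreal (\<Sum>S | S \<subseteq> {1..m} \<and> card S \<le> n. \<Sum>\<pi>\<in>injections S n.
            C S * (c ^ (m - card S) * (\<Prod>i\<in>S. b (\<pi> i))))"
    proof -
      have nn: "0 \<le> C S * (c ^ (m - card S) * (\<Prod>i\<in>S. b (\<pi> i)))" if "\<pi> \<in> injections S n" for S \<pi>
        by (intro mult_nonneg_nonneg C prod_nonneg zero_le_power c(2)) (rule b\<pi>[OF that])
      have "(\<Sum>\<pi>\<in>injections S n. ennreal (C S * (c ^ (m - card S) * (\<Prod>i\<in>S. b (\<pi> i))))) =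
          ennreal (\<Sum>\<pi>\<in>injections S n. C S * (c ^ (m - card S) * (\<Prod>i\<in>S. b (\<pi> i))))" for S
        by (rule sum_ennreal) (rule nn)
      moreover have "0 \<le> (\<Sum>\<pi>\<in>injections S n. C S * (c ^ (m - card S) * (\<Prod>i\<in>S. b (\<pi> i))))" for S
        by (rule sum_nonneg) (rule nn)
      ultimately show ?thesis by (simp only: sum_ennreal)
    qed
    also have "(\<Sum>S | S \<subseteq> {1..m} \<and> card S \<le> n. \<Sum>\<pi>\<in>injections S n.
            C S * (c ^ (m - card S) * (\<Prod>i\<in>S. b (\<pi> i)))) = void * j n x * A m"
      unfolding A_def C_def sum_distrib_left by (intro sum.cong refl) (simp add: mult_ac)
    finally show ?thesis .
  qed
  then have "(\<Sum>m. ennreal (1 / fact m) * (\<integral>\<^sup>+z. ennreal (\<Prod>k=1..m. g (z k)) * ennreal (jf n m x z) \<partial>tuples \<nu> m)) =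
      (\<Sum>m. ennreal (void * j n x * (1 / fact m * A m)))"
    using A_nonneg jn by (simp add: ennreal_mult[symmetric] mult_ac)
  also have "\<dots> = ennreal (void * j n x * (exp c * (\<Prod>l=1..n. q + b l)))"
  proof (rule suminf_ennreal_eq)
    show "0 \<le> void * j n x * (1 / fact m * A m)" for m
      using A_nonneg[of m] jn by simp
    show "(\<lambda>m. void * j n x * (1 / fact m * A m)) sums (void * j n x * (exp c * (\<Prod>l=1..n. q + b l)))"
      unfolding A_def by (intro sums_mult sums_partial_injections)
  qed
  finally show ?thesis unfolding b_def c_def by (simp add: mult_ac)
qed

text \<open>Once the hidden points are integrated out, all assignments of a given \<open>S\<close>
  contribute equally, by the symmetry of \<open>j n\<close>. Their number
  \<open>fact n / fact (n - card S)\<close> meets the factor \<open>1 / fact n\<close> of the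
  Janossy expansion.\<close>

lemma suminf_integral_jf:
  assumes z: "z \<in> space (tuples \<nu> m)"
  shows "(\<Sum>n. ennreal (1 / fact n) * (\<integral>\<^sup>+x. ennreal (jf n m x z) \<partial>tuples \<nu> n)) =
    observation_formula \<nu> j q lt lc m z"
proof -
  define I where "I n S = (\<integral>\<^sup>+x. ennreal (j n x *
      (\<Prod>i=1..card S. lt (z (sorted_list_of_set S ! (i - 1))) (x i))) \<partial>tuples \<nu> n)" for n and S :: "nat set"
  define C where "C n S = void * (q ^ (n - card S) * (\<Prod>k\<in>{1..m} - S. lc (z k)))" for n and S :: "nat set"
  have zk: "z k \<in> space \<nu>" if "k \<in> {1..m}" for k
    using tuples_space[OF z that] .
  have lc_prod: "0 \<le> (\<Prod>k\<in>{1..m} - S. lc (z k))" for S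
    using zk lc_nonneg by (intro prod_nonneg) auto
  have C: "0 \<le> C n S" for n S
    unfolding C_def using lc_prod q_nonneg by simp
  have lt_prod_meas: "(\<lambda>x. \<Prod>i\<in>S. lt (z (s i)) (x (\<pi> i))) \<in> borel_measurable (tuples \<nu> n)"
    if "\<And>i. i \<in> S \<Longrightarrow> s i \<in> {1..m}" "\<And>i. i \<in> S \<Longrightarrow> \<pi> i \<in> {1..n}" for S :: "nat set" and s \<pi> n
  proof (rule borel_measurable_prod)
    fix i assume i: "i \<in> S"
    have "(\<lambda>x. x (\<pi> i)) \<in> tuples \<nu> n \<rightarrow>\<^sub>M \<nu>"
      using that(2)[OF i] by (rule measurable_component_singleton)
    from measurable_compose[OF this lt_section_meas'[OF zk[OF that(1)[OF i]]]]
    show "(\<lambda>x. lt (z (s i)) (x (\<pi> i))) \<in> borel_measurable (tuples \<nu> n)" .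
  qed
  have perm: "(\<integral>\<^sup>+x. ennreal (j n x * (\<Prod>i\<in>S. lt (z i) (x (\<pi> i)))) \<partial>tuples \<nu> n) = I n S"
    if S: "S \<subseteq> {1..m}" "card S \<le> n" and \<pi>: "\<pi> \<in> injections S n" for n S \<pi>
  proof -
    have fS: "finite S" using S by (auto intro: finite_subset)
    \<comment> \<open>The increasing enumeration of \<open>S\<close>, counted from 1 as in the
      formula.\<close>
    define L where "L i = sorted_list_of_set S ! (i - 1)" for i
    have "bij_betw (\<lambda>i. i - 1) {1..card S} {..<card S}"
      by (rule bij_betw_byWitness[where f' = Suc]) auto
    moreover have "bij_betw ((!) (sorted_list_of_set S)) {..<card S} S"
      using bij_betw_nth[of "sorted_list_of_set S" "{..<card S}" S] fS by simp
    ultimately have "bij_betw ((!) (sorted_list_of_set S) \<circ> (\<lambda>i. i - 1)) {1..card S} S"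
      by (rule bij_betw_trans)
    then have L: "bij_betw L {1..card S} S"
      by (simp add: L_def[abs_def] comp_def)
    have inj: "inj_on (\<pi> \<circ> L) {1..card S}"
      using L \<pi> by (intro comp_inj_on) (auto simp: bij_betw_def)
    have im: "(\<pi> \<circ> L) ` {1..card S} \<subseteq> {1..n}"
      using L \<pi> by (auto simp: bij_betw_def image_comp[symmetric] simp del: image_comp)
    \<comment> \<open>\<pi> after \<open>L\<close> injects \<open>{1..card S}\<close> into
      \<open>{1..n}\<close>. Precomposition with a permutation extending it turns the integrand of
      the formula, where observation \<open>L i\<close> belongs to point \<open>i\<close>, into the
      one with assignment \<pi>.\<close>
    obtain \<sigma> where \<sigma>: "\<sigma> permutes {1..n}" "\<And>i. i \<in> {1..card S} \<Longrightarrow> \<sigma> i = \<pi> (L i)"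
      using extend_injection_permutes[OF _ _ inj im] S(2) by auto
    have LS: "L i \<in> S" if "i \<in> {1..card S}" for i
      using L that by (auto simp: bij_betw_def)
    define F where "F x = ennreal (j n x * (\<Prod>i=1..card S. lt (z (L i)) (x i)))" for x
    have "(\<lambda>x. \<Prod>i=1..card S. lt (z (L i)) (x i)) \<in> borel_measurable (tuples \<nu> n)"
    proof (rule lt_prod_meas)
      show "L i \<in> {1..m}" if "i \<in> {1..card S}" for i
        using LS[OF that] S(1) by blast
      show "i \<in> {1..n}" if "i \<in> {1..card S}" for i
        using that S(2) by auto
    qed
    then have F: "F \<in> borel_measurable (tuples \<nu> n)"
      unfolding F_def by measurable
    have "I n S = (\<integral>\<^sup>+x. F x \<partial>tuples \<nu> n)"
      by (simp add: I_def F_def L_def)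
    also have "\<dots> = (\<integral>\<^sup>+x. F (x \<circ> \<sigma>) \<partial>tuples \<nu> n)"
      by (rule nn_integral_tuples_permutes[OF sf \<sigma>(1) F, symmetric])
    also have "\<dots> = (\<integral>\<^sup>+x. ennreal (j n x * (\<Prod>i\<in>S. lt (z i) (x (\<pi> i)))) \<partial>tuples \<nu> n)"
    proof (intro nn_integral_cong)
      fix x assume x: "x \<in> space (tuples \<nu> n)"
      have "j n (x \<circ> \<sigma>) = j n x"
        using j_sym \<sigma>(1) x by (auto simp: symmetric_on_tuples_def)
      moreover have "(\<Prod>i=1..card S. lt (z (L i)) ((x \<circ> \<sigma>) i)) = (\<Prod>i=1..card S. lt (z (L i)) (x (\<pi> (L i))))"
        by (intro prod.cong refl) (simp add: \<sigma>(2))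
      moreover have "\<dots> = (\<Prod>i\<in>S. lt (z i) (x (\<pi> i)))"
        by (rule prod.reindex_bij_betw[OF L])
      ultimately show "F (x \<circ> \<sigma>) = ennreal (j n x * (\<Prod>i\<in>S. lt (z i) (x (\<pi> i))))"
        by (simp add: F_def)
    qed
    finally show ?thesis by simp
  qed
  have "ennreal (1 / fact n) * (\<integral>\<^sup>+x. ennreal (jf n m x z) \<partial>tuples \<nu> n) =
      ennreal void * (\<Sum>S | S \<subseteq> {1..m} \<and> card S \<le> n.
        ennreal ((\<Prod>k\<in>{1..m} - S. lc (z k)) * (q ^ (n - card S) / fact (n - card S))) * I n S)" for n
  proof -
    let ?f = "\<lambda>S \<pi> x. j n x * (\<Prod>i\<in>S. lt (z i) (x (\<pi> i)))"
    have f_nonneg: "0 \<le> ?f S \<pi> x" if "S \<subseteq> {1..m}" "\<pi> \<in> injections S n" "x \<in> space (tuples \<nu> n)" for S \<pi> x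
    proof (rule mult_nonneg_nonneg[OF j_nonneg[OF that(3)] prod_nonneg])
      fix i assume i: "i \<in> S"
      then have "\<pi> i \<in> {1..n}" "i \<in> {1..m}" using that(1,2) by (blast dest: PiE_mem)+
      then show "0 \<le> lt (z i) (x (\<pi> i))" by (intro lt_nonneg zk tuples_space[OF that(3)])
    qed
    have f_meas: "(\<lambda>x. ennreal (?f S \<pi> x)) \<in> borel_measurable (tuples \<nu> n)"
      if "S \<subseteq> {1..m}" "\<pi> \<in> injections S n" for S \<pi>
    proof -
      have "(\<lambda>x. \<Prod>i\<in>S. lt (z i) (x (\<pi> i))) \<in> borel_measurable (tuples \<nu> n)"
        using that by (intro lt_prod_meas) (blast dest: PiE_mem)+
      then show ?thesis by measurable
    qed
    have "(\<integral>\<^sup>+x. ennreal (jf n m x z) \<partial>tuples \<nu> n) =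
        (\<integral>\<^sup>+x. (\<Sum>S | S \<subseteq> {1..m} \<and> card S \<le> n. \<Sum>\<pi>\<in>injections S n. ennreal (C n S) * ennreal (?f S \<pi> x)) \<partial>tuples \<nu> n)"
    proof (intro nn_integral_cong)
      fix x assume x: "x \<in> space (tuples \<nu> n)"
      have cf: "0 \<le> C n S * ?f S \<pi> x" if "S \<subseteq> {1..m}" "\<pi> \<in> injections S n" for S \<pi>
        by (rule mult_nonneg_nonneg[OF C f_nonneg[OF that x]])
      have jf_eq: "jf n m x z = (\<Sum>S | S \<subseteq> {1..m} \<and> card S \<le> n. \<Sum>\<pi>\<in>injections S n. C n S * ?f S \<pi> x)"
        unfolding jf_alt C_def by (intro sum.cong refl) (simp add: mult_ac)
      have "ennreal (jf n m x z) = (\<Sum>S | S \<subseteq> {1..m} \<and> card S \<le> n. ennreal (\<Sum>\<pi>\<in>injections S n. C n S * ?f S \<pi> x))"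
        unfolding jf_eq
      proof (rule sum_ennreal[symmetric], rule sum_nonneg)
        fix S \<pi> assume "S \<in> {S. S \<subseteq> {1..m} \<and> card S \<le> n}" "\<pi> \<in> injections S n"
        then show "0 \<le> C n S * ?f S \<pi> x" by (intro cf) simp_all
      qed
      also have "\<dots> = (\<Sum>S | S \<subseteq> {1..m} \<and> card S \<le> n. \<Sum>\<pi>\<in>injections S n. ennreal (C n S * ?f S \<pi> x))"
      proof (rule sum.cong[OF refl])
        fix S assume S: "S \<in> {S. S \<subseteq> {1..m} \<and> card S \<le> n}"
        then have "S \<subseteq> {1..m}" by simp
        then show "ennreal (\<Sum>\<pi>\<in>injections S n. C n S * ?f S \<pi> x) = (\<Sum>\<pi>\<in>injections S n. ennreal (C n S * ?f S \<pi> x))"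
          by (intro sum_ennreal[symmetric] cf)
      qed
      also have "\<dots> = (\<Sum>S | S \<subseteq> {1..m} \<and> card S \<le> n. \<Sum>\<pi>\<in>injections S n. ennreal (C n S) * ennreal (?f S \<pi> x))"
        by (intro sum.cong refl ennreal_mult[OF C f_nonneg[OF _ _ x]]) auto
      finally show "ennreal (jf n m x z) =
          (\<Sum>S | S \<subseteq> {1..m} \<and> card S \<le> n. \<Sum>\<pi>\<in>injections S n. ennreal (C n S) * ennreal (?f S \<pi> x))" .
    qed
    also have "\<dots> = (\<Sum>S | S \<subseteq> {1..m} \<and> card S \<le> n. \<Sum>\<pi>\<in>injections S n.
        ennreal (C n S) * (\<integral>\<^sup>+x. ennreal (?f S \<pi> x) \<partial>tuples \<nu> n))"
    proof -
      have 3: "(\<lambda>x. ennreal (C n S) * ennreal (?f S \<pi> x)) \<in> borel_measurable (tuples \<nu> n)"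
        if "S \<subseteq> {1..m}" "\<pi> \<in> injections S n" for S \<pi>
        using f_meas[OF that] by measurable
      have 4: "(\<lambda>x. \<Sum>\<pi>\<in>injections S n. ennreal (C n S) * ennreal (?f S \<pi> x)) \<in> borel_measurable (tuples \<nu> n)"
        if "S \<subseteq> {1..m}" for S
        using 3[OF that] by (intro borel_measurable_sum) auto
      show ?thesis
        by (subst nn_integral_sum, use 4 in blast, intro sum.cong refl, subst nn_integral_sum, use 3 in blast,
            intro sum.cong refl nn_integral_cmult f_meas) auto
    qed
    also have "\<dots> = (\<Sum>S | S \<subseteq> {1..m} \<and> card S \<le> n. \<Sum>\<pi>\<in>injections S n. ennreal (C n S) * I n S)"
      by (intro sum.cong refl arg_cong2[of _ _ _ _ "(*)"] perm) auto
    also have "\<dots> = (\<Sum>S | S \<subseteq> {1..m} \<and> card S \<le> n. ennreal (real (card (injections S n))) * (ennreal (C n S) * I n S))"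
      by (simp add: ennreal_of_nat_eq_real_of_nat)
    finally have "ennreal (1 / fact n) * (\<integral>\<^sup>+x. ennreal (jf n m x z) \<partial>tuples \<nu> n) =
        (\<Sum>S | S \<subseteq> {1..m} \<and> card S \<le> n. ennreal (1 / fact n) * (ennreal (real (card (injections S n))) * (ennreal (C n S) * I n S)))"
      by (simp add: sum_distrib_left)
    also have "\<dots> = (\<Sum>S | S \<subseteq> {1..m} \<and> card S \<le> n. ennreal void *
        (ennreal ((\<Prod>k\<in>{1..m} - S. lc (z k)) * (q ^ (n - card S) / fact (n - card S))) * I n S))"
    proof (intro sum.cong refl)
      fix S assume S: "S \<in> {S. S \<subseteq> {1..m} \<and> card S \<le> n}"
      then have "finite S" by (auto intro: finite_subset)
      then have card: "real (card (injections S n)) = fact n / fact (n - card S)"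
        using card_injections[of S "{1..n}"] S by simp
      have "ennreal (1 / fact n) * (ennreal (real (card (injections S n))) * ennreal (C n S)) =
          ennreal (1 / fact n * (real (card (injections S n)) * C n S))"
        unfolding ennreal_mult''[OF C, symmetric] by (rule ennreal_mult'[symmetric]) simp
      also have "1 / fact n * (real (card (injections S n)) * C n S) =
          void * ((\<Prod>k\<in>{1..m} - S. lc (z k)) * (q ^ (n - card S) / fact (n - card S)))"
        unfolding card C_def by simp
      also have "ennreal \<dots> = ennreal void * ennreal ((\<Prod>k\<in>{1..m} - S. lc (z k)) * (q ^ (n - card S) / fact (n - card S)))"
        using lc_prod[of S] q_nonneg by (intro ennreal_mult mult_nonneg_nonneg) auto
      finally show "ennreal (1 / fact n) * (ennreal (real (card (injections S n))) * (ennreal (C n S) * I n S)) =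
          ennreal void * (ennreal ((\<Prod>k\<in>{1..m} - S. lc (z k)) * (q ^ (n - card S) / fact (n - card S))) * I n S)"
        by (simp only: mult.assoc[symmetric])
    qed
    finally show ?thesis by (simp add: sum_distrib_left)
  qed
  then show ?thesis
    unfolding observation_formula_def I_def by (simp only: ennreal_suminf_cmult)
qed

end

section \<open>Thinning and shifting of a hidden configuration\<close>

section \<open>Generating functionals of the measurement process\<close>

lemma prod_mset_sum:
  "finite I \<Longrightarrow> (\<Prod>y\<in>#(\<Sum>i\<in>I. \<phi> i). g y) = (\<Prod>i\<in>I. \<Prod>y\<in>#\<phi> i. g y)"
  by (induction I rule: finite_induct) auto

context
  fixes \<nu> :: "'a measure" and p :: real and ld :: "'a \<Rightarrow> 'a \<Rightarrow> real"
  assumes sf: "sigma_finite_measure \<nu>" and p: "0 \<le> p" "p \<le> 1" and ld: "shift_density \<nu> ld"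
begin

interpretation \<nu>: sigma_finite_measure \<nu> by (rule sf)

lemma ld_meas: "(\<lambda>(z, x). ld z x) \<in> borel_measurable (\<nu> \<Otimes>\<^sub>M \<nu>)"
  using ld by (simp add: shift_density_def)

lemma ld_section_meas: "x \<in> space \<nu> \<Longrightarrow> (\<lambda>z. ld z x) \<in> borel_measurable \<nu>"
  using measurable_compose[OF measurable_Pair2' ld_meas, of x] by simp

lemma prob_space_shift: "x \<in> space \<nu> \<Longrightarrow> prob_space (density \<nu> (\<lambda>z. ennreal (ld z x)))"
  using ld ld_section_meas by (intro prob_spaceI) (simp add: emeasure_density shift_density_def cong: nn_integral_cong)

text \<open>The generating functional of the contribution of a single hidden point at
  \<open>x\<close>: the value 1 when it is missed, \<open>g\<close> at the shifted position when it
  is kept.\<close>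

definition survival_pgf :: "('a \<Rightarrow> real) \<Rightarrow> 'a \<Rightarrow> real" where
  "survival_pgf g x = (1 - p) + (\<integral>y. g y * (p * ld y x) \<partial>\<nu>)"

lemma survival_pgf_meas:
  assumes [measurable]: "g \<in> borel_measurable \<nu>"
  shows "survival_pgf g \<in> borel_measurable \<nu>"
proof -
  have "(\<lambda>w. ld (snd w) (fst w)) \<in> borel_measurable (\<nu> \<Otimes>\<^sub>M \<nu>)"
    using measurable_compose[OF measurable_pair_swap' ld_meas] by (simp add: case_prod_beta)
  then have "(\<lambda>(x, y). g y * (p * ld y x)) \<in> borel_measurable (\<nu> \<Otimes>\<^sub>M \<nu>)"
    unfolding case_prod_beta by measurable
  then show ?thesis
    unfolding survival_pgf_def by measurable
qed

lemma detection_map_meas: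
  "(\<lambda>(kept, z). if kept then {#z#} else {#})
     \<in> measure_pmf (bernoulli_pmf p) \<Otimes>\<^sub>M density \<nu> f \<rightarrow>\<^sub>M configs \<nu>"
proof (rule measurable_configsI)
  fix w assume "w \<in> space (measure_pmf (bernoulli_pmf p) \<Otimes>\<^sub>M density \<nu> f)"
  then show "set_mset (case w of (kept, z) \<Rightarrow> if kept then {#z#} else {#}) \<subseteq> space \<nu>"
    by (auto simp: space_pair_measure split: if_splits)
next
  fix A assume [measurable]: "A \<in> sets \<nu>"
  have "sets (measure_pmf (bernoulli_pmf p) \<Otimes>\<^sub>M density \<nu> f) = sets (count_space UNIV \<Otimes>\<^sub>M \<nu>)"
    by (intro sets_pair_measure_cong) auto
  moreover have "(\<lambda>w. points_in A (case w of (kept, z) \<Rightarrow> if kept then {#z#} else {#})) =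
      (\<lambda>w. if fst w \<and> snd w \<in> A then 1 else 0)"
    by (auto simp: fun_eq_iff points_in_def)
  moreover have "(\<lambda>w. if fst w \<and> snd w \<in> A then 1 else 0 :: nat) \<in> (count_space UNIV \<Otimes>\<^sub>M \<nu>) \<rightarrow>\<^sub>M count_space UNIV"
    by measurable
  ultimately show "(\<lambda>w. points_in A (case w of (kept, z) \<Rightarrow> if kept then {#z#} else {#}))
      \<in> measure_pmf (bernoulli_pmf p) \<Otimes>\<^sub>M density \<nu> f \<rightarrow>\<^sub>M count_space UNIV"
    by (simp cong: measurable_cong_sets)
qed

lemma sets_detection_law [simp]: "sets (detection_law \<nu> p ld x) = sets (configs \<nu>)"
  by (simp add: detection_law_def)

lemma prob_space_detection_law:
  assumes x: "x \<in> space \<nu>"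
  shows "prob_space (detection_law \<nu> p ld x)"
proof -
  interpret D: prob_space "density \<nu> (\<lambda>z. ennreal (ld z x))" by (rule prob_space_shift[OF x])
  interpret PP: pair_prob_space "measure_pmf (bernoulli_pmf p)" "density \<nu> (\<lambda>z. ennreal (ld z x))" ..
  show ?thesis
    unfolding detection_law_def by (rule PP.prob_space_distr[OF detection_map_meas])
qed

lemma detection_law_pgfl:
  assumes x: "x \<in> space \<nu>" and g: "g \<in> borel_measurable \<nu>" "\<And>y. 0 \<le> g y" "\<And>y. g y \<le> 1"
  shows "(\<integral>\<^sup>+\<psi>. ennreal (\<Prod>y\<in>#\<psi>. g y) \<partial>detection_law \<nu> p ld x) = ennreal (survival_pgf g x)"
    and "0 \<le> survival_pgf g x" "survival_pgf g x \<le> 1"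
proof -
  interpret D: prob_space "density \<nu> (\<lambda>z. ennreal (ld z x))" by (rule prob_space_shift[OF x])
  note [measurable] = g(1) ld_section_meas[OF x]
  have ld_nonneg: "0 \<le> ld z x" if "z \<in> space \<nu>" for z
    using ld x that by (simp add: shift_density_def)
  have ld1: "(\<integral>\<^sup>+z. ennreal (ld z x) \<partial>\<nu>) = 1"
    using ld x by (simp add: shift_density_def)
  have le: "(\<integral>\<^sup>+z. ennreal (g z * ld z x) \<partial>\<nu>) \<le> 1"
    unfolding ld1[symmetric] using ld_nonneg g by (intro nn_integral_mono ennreal_leI) (auto simp: mult_left_le_one_le)
  then have fin: "(\<integral>\<^sup>+z. ennreal (g z * ld z x) \<partial>\<nu>) < \<infinity>"
    by (rule le_less_trans) simp
  have int: "integrable \<nu> (\<lambda>z. g z * ld z x)"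
    using ld_nonneg g(2) fin by (intro integrableI_nonneg) (auto intro!: AE_I2)
  have eq: "(\<integral>\<^sup>+z. ennreal (g z * ld z x) \<partial>\<nu>) = ennreal (\<integral>z. g z * ld z x \<partial>\<nu>)"
    using ld_nonneg g(2) int by (intro nn_integral_eq_integral) (auto intro!: AE_I2)
  have nonneg: "0 \<le> (\<integral>z. g z * ld z x \<partial>\<nu>)"
    using ld_nonneg g(2) by (intro Bochner_Integration.integral_nonneg) auto
  have le1: "(\<integral>z. g z * ld z x \<partial>\<nu>) \<le> 1"
    using le unfolding eq by simp
  have pgf: "survival_pgf g x = p * (\<integral>z. g z * ld z x \<partial>\<nu>) + (1 - p)"
    by (simp add: survival_pgf_def mult.left_commute)
  show "0 \<le> survival_pgf g x"
    unfolding pgf using nonneg p by simp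
  show "survival_pgf g x \<le> 1"
    unfolding pgf using mult_left_mono[OF le1 p(1)] by simp
  let ?m = "\<lambda>(kept, z). if kept then {#z#} else {#} :: 'a multiset"
  have [measurable]: "(\<lambda>\<psi>. ennreal (\<Prod>y\<in>#\<psi>. g y)) \<in> borel_measurable (configs \<nu>)" by measurable
  have "(\<integral>\<^sup>+\<psi>. ennreal (\<Prod>y\<in>#\<psi>. g y) \<partial>detection_law \<nu> p ld x) =
      (\<integral>\<^sup>+w. ennreal (\<Prod>y\<in>#?m w. g y) \<partial>(measure_pmf (bernoulli_pmf p) \<Otimes>\<^sub>M density \<nu> (\<lambda>z. ennreal (ld z x))))"
    unfolding detection_law_def by (rule nn_integral_distr[OF detection_map_meas]) measurable
  also have "\<dots> = (\<integral>\<^sup>+kept. \<integral>\<^sup>+z. ennreal (\<Prod>y\<in>#?m (kept, z). g y) \<partial>density \<nu> (\<lambda>z. ennreal (ld z x)) \<partial>measure_pmf (bernoulli_pmf p))"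
    by (rule D.nn_integral_fst[symmetric]) (rule measurable_compose[OF detection_map_meas], measurable)
  also have "\<dots> = (\<integral>\<^sup>+z. ennreal (g z) \<partial>density \<nu> (\<lambda>z. ennreal (ld z x))) * ennreal p + ennreal (1 - p)"
    using p D.emeasure_space_1 by (subst nn_integral_bernoulli_pmf) auto
  also have "(\<integral>\<^sup>+z. ennreal (g z) \<partial>density \<nu> (\<lambda>z. ennreal (ld z x))) = (\<integral>\<^sup>+z. ennreal (g z * ld z x) \<partial>\<nu>)"
    using ld_nonneg g(2) by (subst nn_integral_density) (auto intro!: nn_integral_cong simp: ennreal_mult mult.commute)
  also have "\<dots> * ennreal p + ennreal (1 - p) = ennreal (survival_pgf g x)"
    unfolding eq pgf using nonneg p by (simp add: ennreal_mult[symmetric] ennreal_plus[symmetric] mult.commute del: ennreal_plus)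
  finally show "(\<integral>\<^sup>+\<psi>. ennreal (\<Prod>y\<in>#\<psi>. g y) \<partial>detection_law \<nu> p ld x) = ennreal (survival_pgf g x)" .
qed

lemma sum_config_meas:
  assumes "finite S"
  shows "(\<lambda>\<psi>. \<Sum>x\<in>S. \<psi> x) \<in> Pi\<^sub>M S (\<lambda>_. configs \<nu>) \<rightarrow>\<^sub>M configs \<nu>"
proof (rule measurable_configsI)
  fix \<psi> assume "\<psi> \<in> space (Pi\<^sub>M S (\<lambda>_. configs \<nu>))"
  then have "set_mset (\<psi> x) \<subseteq> space \<nu>" if "x \<in> S" for x
    using that by (auto simp: space_PiM space_configs)
  then show "set_mset (\<Sum>x\<in>S. \<psi> x) \<subseteq> space \<nu>"
    using assms by (auto simp: set_mset_sum)
next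
  fix A assume A: "A \<in> sets \<nu>"
  have "(\<lambda>\<psi>. points_in A (\<psi> x)) \<in> Pi\<^sub>M S (\<lambda>_. configs \<nu>) \<rightarrow>\<^sub>M count_space UNIV" if "x \<in> S" for x
    using measurable_compose[OF measurable_component_singleton[OF that, of "\<lambda>_. configs \<nu>"] measurable_points_in[OF A]] .
  then show "(\<lambda>\<psi>. points_in A (\<Sum>x\<in>S. \<psi> x)) \<in> Pi\<^sub>M S (\<lambda>_. configs \<nu>) \<rightarrow>\<^sub>M count_space UNIV"
    unfolding points_in_sum[OF assms] by (intro measurable_sum_nat)
qed

text \<open>Independence makes the contributions of the points a product measure, and a product over
  a sum of configurations factorizes, so the functional is a product over the points of
  \<phi>.\<close>

lemma thinned_shifted_law_pgfl:
  assumes \<phi>: "set_mset \<phi> \<subseteq> space \<nu>"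
  shows "prob_space (thinned_shifted_law \<nu> p ld \<phi>)"
    and "sets (thinned_shifted_law \<nu> p ld \<phi>) = sets (configs \<nu>)"
    and "g \<in> borel_measurable \<nu> \<Longrightarrow> (\<And>y. 0 \<le> g y) \<Longrightarrow> (\<And>y. g y \<le> 1) \<Longrightarrow>
      (\<integral>\<^sup>+\<psi>. ennreal (\<Prod>y\<in>#\<psi>. g y) \<partial>thinned_shifted_law \<nu> p ld \<phi>) = (\<Prod>x\<in>set_mset \<phi>. ennreal (survival_pgf g x))"
proof -
  \<comment> \<open>the detection law is a probability measure only for points of the space\<close>
  define \<delta> where "\<delta> x = (if x \<in> space \<nu> then detection_law \<nu> p ld x else return (configs \<nu>) {#})" for x
  define S where "S = set_mset \<phi>"
  have S: "finite S" "S \<subseteq> space \<nu>" using \<phi> by (auto simp: S_def)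
  have \<delta>: "prob_space (\<delta> x)" "sets (\<delta> x) = sets (configs \<nu>)" for x
    by (auto simp: \<delta>_def prob_space_detection_law space_configs intro!: prob_space_return)
  interpret product_prob_space \<delta>
    by (rule product_prob_spaceI) (rule \<delta>)
  have PiM_eq: "Pi\<^sub>M S (detection_law \<nu> p ld) = Pi\<^sub>M S \<delta>"
    using S by (intro PiM_cong) (auto simp: \<delta>_def)
  have sets_Pi: "sets (Pi\<^sub>M S \<delta>) = sets (Pi\<^sub>M S (\<lambda>_. configs \<nu>))"
    by (intro sets_PiM_cong) (auto simp: \<delta>)
  have meas: "(\<lambda>\<psi>. \<Sum>x\<in>S. \<psi> x) \<in> Pi\<^sub>M S \<delta> \<rightarrow>\<^sub>M configs \<nu>"
    using sum_config_meas[OF S(1)] by (simp cong: measurable_cong_sets add: measurable_cong_sets[OF sets_Pi refl])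
  have law: "thinned_shifted_law \<nu> p ld \<phi> = distr (Pi\<^sub>M S \<delta>) (configs \<nu>) (\<lambda>\<psi>. \<Sum>x\<in>S. \<psi> x)"
    unfolding thinned_shifted_law_def S_def[symmetric] PiM_eq ..
  have "prob_space (Pi\<^sub>M S \<delta>)"
    by (rule prob_space_PiM) (rule \<delta>)
  then show "prob_space (thinned_shifted_law \<nu> p ld \<phi>)"
    unfolding law using meas by (rule prob_space.prob_space_distr)
  show "sets (thinned_shifted_law \<nu> p ld \<phi>) = sets (configs \<nu>)"
    by (simp add: law)
  assume g: "g \<in> borel_measurable \<nu>" "\<And>y. 0 \<le> g y" "\<And>y. g y \<le> 1"
  note [measurable] = g(1)
  have "(\<integral>\<^sup>+\<psi>. ennreal (\<Prod>y\<in>#\<psi>. g y) \<partial>thinned_shifted_law \<nu> p ld \<phi>) =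
      (\<integral>\<^sup>+\<psi>. ennreal (\<Prod>y\<in>#(\<Sum>x\<in>S. \<psi> x). g y) \<partial>Pi\<^sub>M S \<delta>)"
    unfolding law by (rule nn_integral_distr[OF meas]) measurable
  also have "\<dots> = (\<integral>\<^sup>+\<psi>. (\<Prod>x\<in>S. ennreal (\<Prod>y\<in>#\<psi> x. g y)) \<partial>Pi\<^sub>M S \<delta>)"
    using g(2) S(1) by (simp add: prod_mset_sum prod_ennreal prod_mset_nonneg)
  also have "\<dots> = (\<Prod>x\<in>S. \<integral>\<^sup>+\<psi>. ennreal (\<Prod>y\<in>#\<psi>. g y) \<partial>\<delta> x)"
    using S(1) by (intro product_nn_integral_prod) (auto simp: measurable_cong_sets[OF \<delta>(2) refl])
  also have "\<dots> = (\<Prod>x\<in>S. ennreal (survival_pgf g x))"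
    using S(2) g by (intro prod.cong refl) (auto simp: \<delta>_def detection_law_pgfl)
  finally show "(\<integral>\<^sup>+\<psi>. ennreal (\<Prod>y\<in>#\<psi>. g y) \<partial>thinned_shifted_law \<nu> p ld \<phi>) =
      (\<Prod>x\<in>set_mset \<phi>. ennreal (survival_pgf g x))" by (simp add: S_def)
qed

lemma prod_mset_simple:
  assumes "\<And>x. count \<phi> x \<le> 1"
  shows "(\<Prod>x\<in>#\<phi>. u x) = (\<Prod>x\<in>set_mset \<phi>. u x)"
proof -
  have "\<phi> = mset_set (set_mset \<phi>)"
  proof (rule multiset_eqI)
    fix x
    show "count \<phi> x = count (mset_set (set_mset \<phi>)) x"
    proof (cases "x \<in># \<phi>")
      case True
      then have "0 < count \<phi> x" by simp
      with assms[of x] have "count \<phi> x = 1" by linarith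
      with True show ?thesis by simp
    qed (simp add: not_in_iff)
  qed
  then show ?thesis
    by (metis prod_unfold_prod_mset)
qed

text \<open>The defining identity of \<open>thinned_shifted\<close> concerns rectangles only. It is
  extended to functionals in two stages, first in \<Psi> with an event of \<Phi> held fixed, then in
  \<Phi>, each time by identifying two measures.\<close>

lemma thinned_shifted_pgfl:
  assumes P: "prob_space P" and \<Phi>: "simple_point_process P \<nu> \<Phi>" and \<Psi>: "thinned_shifted P \<nu> p ld \<Phi> \<Psi>"
    and h: "h \<in> borel_measurable \<nu>" "\<And>y. 0 \<le> h y" "\<And>y. h y \<le> 1"
    and g: "g \<in> borel_measurable \<nu>" "\<And>y. 0 \<le> g y" "\<And>y. g y \<le> 1"
  shows "(\<integral>\<^sup>+\<omega>. ennreal (\<Prod>x\<in>#\<Phi> \<omega>. h x) * ennreal (\<Prod>y\<in>#\<Psi> \<omega>. g y) \<partial>P) =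
    (\<integral>\<^sup>+\<omega>. ennreal (\<Prod>x\<in>#\<Phi> \<omega>. h x * survival_pgf g x) \<partial>P)"
proof -
  interpret prob_space P by (rule P)
  note [measurable] = h(1) g(1)
  have \<Phi>_meas [measurable]: "\<Phi> \<in> P \<rightarrow>\<^sub>M configs \<nu>" and \<Phi>_simple: "AE \<omega> in P. \<forall>x. count (\<Phi> \<omega>) x \<le> 1"
    using \<Phi> by (auto simp: simple_point_process_def)
  have \<Psi>_meas [measurable]: "\<Psi> \<in> P \<rightarrow>\<^sub>M configs \<nu>"
    using \<Psi> by (simp add: thinned_shifted_def)
  obtain N where N: "N \<in> null_sets P" "{\<omega> \<in> space P. \<not> (\<forall>x. count (\<Phi> \<omega>) x \<le> 1)} \<subseteq> N"
    using \<Phi>_simple by (auto simp: eventually_ae_filter)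
  have [measurable]: "N \<in> sets P" using N by auto
  \<comment> \<open>the thinned law only sees the set of points, so its generating functional is a product over
    all points with multiplicity, hence measurable, only off the null set of repeated points\<close>
  define \<kappa> where "\<kappa> \<omega> = (if \<omega> \<in> N then return (configs \<nu>) {#} else thinned_shifted_law \<nu> p ld (\<Phi> \<omega>))" for \<omega>
  have \<Phi>_sub: "set_mset (\<Phi> \<omega>) \<subseteq> space \<nu>" if "\<omega> \<in> space P" for \<omega>
    using measurable_space[OF \<Phi>_meas that] by (simp add: space_configs)
  have \<kappa>: "prob_space (\<kappa> \<omega>)" "sets (\<kappa> \<omega>) = sets (configs \<nu>)" if "\<omega> \<in> space P" for \<omega>
    using thinned_shifted_law_pgfl[OF \<Phi>_sub[OF that]]
    by (auto simp: \<kappa>_def space_configs intro!: prob_space_return)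
  have \<kappa>_pgfl: "(\<integral>\<^sup>+\<psi>. ennreal (\<Prod>y\<in>#\<psi>. g y) \<partial>\<kappa> \<omega>) = ennreal (if \<omega> \<in> N then 1 else \<Prod>x\<in>#\<Phi> \<omega>. survival_pgf g x)"
    if "\<omega> \<in> space P" and g: "g \<in> borel_measurable \<nu>" "\<And>y. 0 \<le> g y" "\<And>y. g y \<le> 1" for \<omega> g
  proof (cases "\<omega> \<in> N")
    case True
    have "(\<lambda>\<psi>. ennreal (\<Prod>y\<in>#\<psi>. g y)) \<in> borel_measurable (configs \<nu>)" using g(1) by measurable
    then have "(\<integral>\<^sup>+\<psi>. ennreal (\<Prod>y\<in>#\<psi>. g y) \<partial>return (configs \<nu>) {#}) = ennreal (\<Prod>y\<in>#{#}. g y)"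
      by (intro nn_integral_return) (auto simp: space_configs)
    then show ?thesis using True by (simp add: \<kappa>_def)
  next
    case False
    then have "\<forall>x. count (\<Phi> \<omega>) x \<le> 1" using N(2) that(1) by auto
    then have "(\<Prod>x\<in>#\<Phi> \<omega>. survival_pgf g x) = (\<Prod>x\<in>set_mset (\<Phi> \<omega>). survival_pgf g x)"
      by (intro prod_mset_simple) auto
    moreover have "(\<Prod>x\<in>set_mset (\<Phi> \<omega>). ennreal (survival_pgf g x)) = ennreal (\<Prod>x\<in>set_mset (\<Phi> \<omega>). survival_pgf g x)"
      using detection_law_pgfl(2)[OF _ g] \<Phi>_sub[OF that(1)] by (intro prod_ennreal) auto
    ultimately show ?thesis
      using False thinned_shifted_law_pgfl(3)[OF \<Phi>_sub[OF that(1)] g] by (simp add: \<kappa>_def)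
  qed
  have \<kappa>_meas [measurable]: "\<kappa> \<in> P \<rightarrow>\<^sub>M subprob_algebra (configs \<nu>)"
  proof (rule measurable_kernel_configs)
    show "subprob_space (\<kappa> \<omega>)" if "\<omega> \<in> space P" for \<omega>
      using \<kappa>(1)[OF that] by (rule prob_space_imp_subprob_space)
    fix g :: "'a \<Rightarrow> real" assume g: "g \<in> borel_measurable \<nu>" "\<And>y. 0 \<le> g y" "\<And>y. g y \<le> 1"
    have [measurable]: "survival_pgf g \<in> borel_measurable \<nu>" by (rule survival_pgf_meas[OF g(1)])
    have "(\<integral>\<psi>. (\<Prod>y\<in>#\<psi>. g y) \<partial>\<kappa> \<omega>) = (if \<omega> \<in> N then 1 else \<Prod>x\<in>#\<Phi> \<omega>. survival_pgf g x)"
      if "\<omega> \<in> space P" for \<omega>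
    proof -
      have nn: "0 \<le> (if \<omega> \<in> N then 1 else \<Prod>x\<in>#\<Phi> \<omega>. survival_pgf g x)"
        using detection_law_pgfl(2)[OF _ g] \<Phi>_sub[OF that] by (auto intro!: prod_mset_nonneg)
      have "(\<lambda>\<psi>. \<Prod>y\<in>#\<psi>. g y) \<in> borel_measurable (\<kappa> \<omega>)"
        unfolding measurable_cong_sets[OF \<kappa>(2)[OF that] refl] by (rule borel_measurable_prod_mset[OF g(1)])
      then have "(\<integral>\<psi>. (\<Prod>y\<in>#\<psi>. g y) \<partial>\<kappa> \<omega>) = enn2real (\<integral>\<^sup>+\<psi>. ennreal (\<Prod>y\<in>#\<psi>. g y) \<partial>\<kappa> \<omega>)"
        using g(2) by (intro integral_eq_nn_integral) (auto intro!: AE_I2 prod_mset_nonneg)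
      then show ?thesis
        unfolding \<kappa>_pgfl[OF that g] using nn by simp
    qed
    then show "(\<lambda>\<omega>. \<integral>\<psi>. (\<Prod>y\<in>#\<psi>. g y) \<partial>\<kappa> \<omega>) \<in> borel_measurable P"
      by (subst measurable_cong[where g = "\<lambda>\<omega>. if \<omega> \<in> N then 1 else \<Prod>x\<in>#\<Phi> \<omega>. survival_pgf g x"]) auto
  qed (rule \<kappa>)
  have rect: "emeasure P {\<omega> \<in> space P. \<Phi> \<omega> \<in> A \<and> \<Psi> \<omega> \<in> B} = (\<integral>\<^sup>+\<omega>. indicator A (\<Phi> \<omega>) * emeasure (\<kappa> \<omega>) B \<partial>P)"
    if "A \<in> sets (configs \<nu>)" "B \<in> sets (configs \<nu>)" for A B
  proof -
    have "AE \<omega> in P. \<omega> \<notin> N" using N(1) by (rule AE_not_in)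
    then have "AE \<omega> in P. indicator A (\<Phi> \<omega>) * emeasure (thinned_shifted_law \<nu> p ld (\<Phi> \<omega>)) B =
        indicator A (\<Phi> \<omega>) * emeasure (\<kappa> \<omega>) B"
      by eventually_elim (simp add: \<kappa>_def)
    then show ?thesis
      using \<Psi> that by (auto simp: thinned_shifted_def intro: nn_integral_cong_AE)
  qed
  define F where "F \<psi> = ennreal (\<Prod>y\<in>#\<psi>. g y)" for \<psi>
  have F [measurable]: "F \<in> borel_measurable (configs \<nu>)" unfolding F_def by measurable
  have K [measurable]: "(\<lambda>\<omega>. \<integral>\<^sup>+\<psi>. F \<psi> \<partial>\<kappa> \<omega>) \<in> borel_measurable P"
    by (rule measurable_compose[OF \<kappa>_meas nn_integral_measurable_subprob_algebra[OF F]])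
  have step1: "(\<integral>\<^sup>+\<omega>. indicator A (\<Phi> \<omega>) * F (\<Psi> \<omega>) \<partial>P) = (\<integral>\<^sup>+\<omega>. indicator A (\<Phi> \<omega>) * (\<integral>\<^sup>+\<psi>. F \<psi> \<partial>\<kappa> \<omega>) \<partial>P)"
    if [measurable]: "A \<in> sets (configs \<nu>)" for A
  proof -
    \<comment> \<open>\<open>PA\<close> is \<open>P\<close> restricted to the event that \<Phi> lies
      in \<open>A\<close>. The rectangle identity says that under \<open>PA\<close> the distribution
      of \<Psi> is the mixture of the laws \<kappa>.\<close>
    define PA where "PA = density P (\<lambda>\<omega>. indicator A (\<Phi> \<omega>))"
    have \<kappa>A: "\<kappa> \<in> PA \<rightarrow>\<^sub>M subprob_algebra (configs \<nu>)" and \<Psi>A: "\<Psi> \<in> PA \<rightarrow>\<^sub>M configs \<nu>"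
      by (auto simp: PA_def)
    have ne: "space PA \<noteq> {}" using not_empty by (simp add: PA_def)
    have "distr PA (configs \<nu>) \<Psi> = PA \<bind> \<kappa>"
    proof (rule measure_eqI)
      show "sets (distr PA (configs \<nu>) \<Psi>) = sets (PA \<bind> \<kappa>)"
        using sets_bind[OF _ ne, of \<kappa> "configs \<nu>"] \<kappa>(2) by (simp add: PA_def)
      fix B assume "B \<in> sets (distr PA (configs \<nu>) \<Psi>)"
      then have B [measurable]: "B \<in> sets (configs \<nu>)" by simp
      have "emeasure (distr PA (configs \<nu>) \<Psi>) B = (\<integral>\<^sup>+\<omega>. indicator A (\<Phi> \<omega>) * indicator (\<Psi> -` B \<inter> space P) \<omega> \<partial>P)"
        using \<Psi>A unfolding PA_def by (subst emeasure_distr) (auto simp: emeasure_density)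
      also have "\<dots> = (\<integral>\<^sup>+\<omega>. indicator {\<omega> \<in> space P. \<Phi> \<omega> \<in> A \<and> \<Psi> \<omega> \<in> B} \<omega> \<partial>P)"
        by (intro nn_integral_cong) (auto split: split_indicator)
      also have "\<dots> = emeasure P {\<omega> \<in> space P. \<Phi> \<omega> \<in> A \<and> \<Psi> \<omega> \<in> B}"
        by (rule nn_integral_indicator) measurable
      also have "\<dots> = (\<integral>\<^sup>+\<omega>. indicator A (\<Phi> \<omega>) * emeasure (\<kappa> \<omega>) B \<partial>P)"
        by (rule rect) fact+
      also have "\<dots> = emeasure (PA \<bind> \<kappa>) B"
        unfolding emeasure_bind[OF ne \<kappa>A B] unfolding PA_def by (subst nn_integral_density) auto
      finally show "emeasure (distr PA (configs \<nu>) \<Psi>) B = emeasure (PA \<bind> \<kappa>) B" .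
    qed
    then have "(\<integral>\<^sup>+\<psi>. F \<psi> \<partial>distr PA (configs \<nu>) \<Psi>) = (\<integral>\<^sup>+\<psi>. F \<psi> \<partial>(PA \<bind> \<kappa>))" by simp
    then have "(\<integral>\<^sup>+\<omega>. F (\<Psi> \<omega>) \<partial>PA) = (\<integral>\<^sup>+\<omega>. \<integral>\<^sup>+\<psi>. F \<psi> \<partial>\<kappa> \<omega> \<partial>PA)"
      using \<Psi>A by (simp add: nn_integral_distr nn_integral_bind[OF F \<kappa>A])
    then show ?thesis
      unfolding PA_def by (simp add: nn_integral_density)
  qed
  \<comment> \<open>The first stage says that the two weights on \<open>P\<close> give the same
    image measure under \<Phi>; the product of \<open>h\<close> is then integrated against
    it.\<close>
  have "distr (density P (\<lambda>\<omega>. F (\<Psi> \<omega>))) (configs \<nu>) \<Phi> = distr (density P (\<lambda>\<omega>. \<integral>\<^sup>+\<psi>. F \<psi> \<partial>\<kappa> \<omega>)) (configs \<nu>) \<Phi>"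
  proof (rule measure_eqI)
    fix A assume "A \<in> sets (distr (density P (\<lambda>\<omega>. F (\<Psi> \<omega>))) (configs \<nu>) \<Phi>)"
    then have A [measurable]: "A \<in> sets (configs \<nu>)" by simp
    have *: "emeasure (distr (density P G) (configs \<nu>) \<Phi>) A = (\<integral>\<^sup>+\<omega>. indicator A (\<Phi> \<omega>) * G \<omega> \<partial>P)"
      if [measurable]: "G \<in> borel_measurable P" for G
    proof -
      have "emeasure (distr (density P G) (configs \<nu>) \<Phi>) A = (\<integral>\<^sup>+\<omega>. G \<omega> * indicator (\<Phi> -` A \<inter> space P) \<omega> \<partial>P)"
        by (subst emeasure_distr) (auto simp: emeasure_density)
      also have "\<dots> = (\<integral>\<^sup>+\<omega>. indicator A (\<Phi> \<omega>) * G \<omega> \<partial>P)"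
        by (intro nn_integral_cong) (auto split: split_indicator)
      finally show ?thesis .
    qed
    show "emeasure (distr (density P (\<lambda>\<omega>. F (\<Psi> \<omega>))) (configs \<nu>) \<Phi>) A =
        emeasure (distr (density P (\<lambda>\<omega>. \<integral>\<^sup>+\<psi>. F \<psi> \<partial>\<kappa> \<omega>)) (configs \<nu>) \<Phi>) A"
      using step1[OF A] by (simp add: *)
  qed simp
  then have "(\<integral>\<^sup>+\<phi>. ennreal (\<Prod>x\<in>#\<phi>. h x) \<partial>distr (density P (\<lambda>\<omega>. F (\<Psi> \<omega>))) (configs \<nu>) \<Phi>) =
      (\<integral>\<^sup>+\<phi>. ennreal (\<Prod>x\<in>#\<phi>. h x) \<partial>distr (density P (\<lambda>\<omega>. \<integral>\<^sup>+\<psi>. F \<psi> \<partial>\<kappa> \<omega>)) (configs \<nu>) \<Phi>)" by simp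
  then have "(\<integral>\<^sup>+\<omega>. ennreal (\<Prod>x\<in>#\<Phi> \<omega>. h x) * F (\<Psi> \<omega>) \<partial>P) = (\<integral>\<^sup>+\<omega>. ennreal (\<Prod>x\<in>#\<Phi> \<omega>. h x) * (\<integral>\<^sup>+\<psi>. F \<psi> \<partial>\<kappa> \<omega>) \<partial>P)"
    by (simp add: nn_integral_distr nn_integral_density mult.commute)
  also have "\<dots> = (\<integral>\<^sup>+\<omega>. ennreal (\<Prod>x\<in>#\<Phi> \<omega>. h x * survival_pgf g x) \<partial>P)"
  proof (rule nn_integral_cong_AE)
    have "AE \<omega> in P. \<omega> \<notin> N" using N(1) by (rule AE_not_in)
    then show "AE \<omega> in P. ennreal (\<Prod>x\<in>#\<Phi> \<omega>. h x) * (\<integral>\<^sup>+\<psi>. F \<psi> \<partial>\<kappa> \<omega>) = ennreal (\<Prod>x\<in>#\<Phi> \<omega>. h x * survival_pgf g x)"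
      using AE_space
    proof eventually_elim
      fix \<omega> assume \<omega>: "\<omega> \<notin> N" "\<omega> \<in> space P"
      have "0 \<le> (\<Prod>x\<in>#\<Phi> \<omega>. survival_pgf g x)" "0 \<le> (\<Prod>x\<in>#\<Phi> \<omega>. h x)"
        using detection_law_pgfl(2)[OF _ g] \<Phi>_sub[OF \<omega>(2)] h(2) by (auto intro!: prod_mset_nonneg)
      then show "ennreal (\<Prod>x\<in>#\<Phi> \<omega>. h x) * (\<integral>\<^sup>+\<psi>. F \<psi> \<partial>\<kappa> \<omega>) = ennreal (\<Prod>x\<in>#\<Phi> \<omega>. h x * survival_pgf g x)"
        unfolding F_def \<kappa>_pgfl[OF \<omega>(2) g] using \<omega>(1) by (simp add: ennreal_mult prod_mset.distrib)
    qed
  qed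
  finally show ?thesis unfolding F_def .
qed

end

section \<open>Generating functional of a Poisson process\<close>

lemma nn_integral_power_poisson:
  fixes X :: "'w \<Rightarrow> nat" and \<mu> c :: real
  assumes P: "prob_space P" and X [measurable]: "X \<in> P \<rightarrow>\<^sub>M count_space UNIV"
    and dist: "\<And>k. measure P {\<omega> \<in> space P. X \<omega> = k} = \<mu> ^ k / fact k * exp (- \<mu>)"
    and "0 \<le> \<mu>" "0 \<le> c"
  shows "(\<integral>\<^sup>+\<omega>. ennreal c ^ X \<omega> \<partial>P) = ennreal (exp (c * \<mu> - \<mu>))"
proof -
  interpret prob_space P by (rule P)
  define E where "E k = {\<omega> \<in> space P. X \<omega> = k}" for k
  have E [measurable]: "E k \<in> sets P" for k unfolding E_def by measurable
  have "(\<integral>\<^sup>+\<omega>. ennreal c ^ X \<omega> \<partial>P) = (\<integral>\<^sup>+\<omega>. (\<Sum>k. ennreal c ^ k * indicator (E k) \<omega>) \<partial>P)"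
  proof (intro nn_integral_cong)
    fix \<omega> assume "\<omega> \<in> space P"
    then have "\<omega> \<in> E (X \<omega>)" by (simp add: E_def)
    then show "ennreal c ^ X \<omega> = (\<Sum>k. ennreal c ^ k * indicator (E k) \<omega>)"
      by (intro suminf_cmult_indicator[symmetric]) (auto simp: disjoint_family_on_def E_def)
  qed
  also have "\<dots> = (\<Sum>k. \<integral>\<^sup>+\<omega>. ennreal c ^ k * indicator (E k) \<omega> \<partial>P)"
    by (rule nn_integral_suminf) measurable
  also have "\<dots> = (\<Sum>k. ennreal (exp (- \<mu>) * ((c * \<mu>) ^ k /\<^sub>R fact k)))"
  proof (rule suminf_cong)
    fix k
    have "(\<integral>\<^sup>+\<omega>. ennreal c ^ k * indicator (E k) \<omega> \<partial>P) = ennreal c ^ k * emeasure P (E k)"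
      by (rule nn_integral_cmult_indicator) measurable
    also have "emeasure P (E k) = ennreal (\<mu> ^ k / fact k * exp (- \<mu>))"
      unfolding E_def emeasure_eq_measure dist ..
    also have "ennreal c ^ k * \<dots> = ennreal (exp (- \<mu>) * ((c * \<mu>) ^ k /\<^sub>R fact k))"
      using assms(4,5)
      by (simp add: ennreal_power ennreal_mult[symmetric] power_mult_distrib divide_inverse mult_ac)
    finally show "(\<integral>\<^sup>+\<omega>. ennreal c ^ k * indicator (E k) \<omega> \<partial>P) = ennreal (exp (- \<mu>) * ((c * \<mu>) ^ k /\<^sub>R fact k))" .
  qed
  also have "\<dots> = ennreal (exp (- \<mu>) * exp (c * \<mu>))"
    using assms(4,5) by (intro suminf_ennreal_eq sums_mult exp_converges) auto
  finally show ?thesis by (simp add: exp_add[symmetric])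
qed

text \<open>The level sets of \<open>g\<close> are disjoint, so their counts are independent Poisson
  variables and the functional is a product of Poisson generating functions.\<close>

lemma poisson_pgfl_finite_range:
  fixes \<nu> :: "'a measure" and g :: "'a \<Rightarrow> real"
  assumes P: "prob_space P" and C: "poisson_process P \<nu> l C"
    and g: "g \<in> borel_measurable \<nu>" "\<And>y. 0 \<le> g y" "finite (g ` space \<nu>)"
  shows "(\<integral>\<^sup>+\<omega>. ennreal (\<Prod>y\<in>#C \<omega>. g y) \<partial>P) = ennreal (exp ((\<integral>y. g y * l y \<partial>\<nu>) - (\<integral>y. l y \<partial>\<nu>)))"
proof -
  interpret prob_space P by (rule P)
  have [measurable]: "C \<in> P \<rightarrow>\<^sub>M configs \<nu>" and l [measurable]: "l \<in> borel_measurable \<nu>"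
    and l_nonneg: "\<And>z. z \<in> space \<nu> \<Longrightarrow> 0 \<le> l z" and l_fin: "(\<integral>\<^sup>+z. ennreal (l z) \<partial>\<nu>) < \<infinity>"
    and dist: "\<And>A k. A \<in> sets \<nu> \<Longrightarrow> measure P {\<omega>\<in>space P. points_in A (C \<omega>) = k} =
        (\<integral>z\<in>A. l z \<partial>\<nu>) ^ k / fact k * exp (- (\<integral>z\<in>A. l z \<partial>\<nu>))"
    and indep: "\<And>(I::nat set) A. finite I \<Longrightarrow> (\<And>i. i \<in> I \<Longrightarrow> A i \<in> sets \<nu>) \<Longrightarrow> disjoint_family_on A I \<Longrightarrow>
        indep_vars (\<lambda>_. count_space UNIV) (\<lambda>i \<omega>. points_in (A i) (C \<omega>)) I"
    using C by (auto simp: poisson_process_def)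
  note [measurable] = g(1)
  have C_sub: "set_mset (C \<omega>) \<subseteq> space \<nu>" if "\<omega> \<in> space P" for \<omega>
    using measurable_space[OF \<open>C \<in> P \<rightarrow>\<^sub>M configs \<nu>\<close> that] by (simp add: space_configs)
  have int_l: "integrable \<nu> l"
    using l_nonneg l_fin by (intro integrableI_nonneg) (auto intro!: AE_I2)
  \<comment> \<open>The values are numbered because independence is stated for families indexed by
    natural numbers; injectivity of \<open>e\<close> makes the level sets disjoint.\<close>
  obtain e and k :: nat where e: "g ` space \<nu> = e ` {i. i < k}" "inj_on e {i. i < k}"
    using finite_imp_nat_seg_image_inj_on[OF g(3)] by blast
  define A where "A i = g -` {e i} \<inter> space \<nu>" for i
  define \<mu> where "\<mu> i = (\<integral>z\<in>A i. l z \<partial>\<nu>)" for i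
  have A [measurable]: "A i \<in> sets \<nu>" for i
    unfolding A_def by measurable
  have e_nonneg: "0 \<le> e i" if "i < k" for i
  proof -
    have "e i \<in> g ` space \<nu>" using that e(1) by auto
    then show ?thesis using g(2) by auto
  qed
  have \<mu>_nonneg: "0 \<le> \<mu> i" for i
    unfolding \<mu>_def set_lebesgue_integral_def using l_nonneg
    by (intro Bochner_Integration.integral_nonneg) (auto split: split_indicator)
  \<comment> \<open>Used with the identity, for the integral of \<open>g\<close> against the
    intensity, and with the constant 1, for the total intensity.\<close>
  have split: "(\<integral>y. f (g y) * l y \<partial>\<nu>) = (\<Sum>i<k. f (e i) * \<mu> i)" for f :: "real \<Rightarrow> real"
  proof -
    have "(\<integral>y. f (g y) * l y \<partial>\<nu>) = (\<integral>y. (\<Sum>i<k. f (e i) * (indicator (A i) y *\<^sub>R l y)) \<partial>\<nu>)"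
    proof (intro Bochner_Integration.integral_cong refl)
      fix y assume y: "y \<in> space \<nu>"
      then obtain i where i: "i < k" "g y = e i" using e(1) by blast
      have "(\<Sum>i<k. f (e i) * (indicator (A i) y *\<^sub>R l y)) = (\<Sum>i'<k. if i' = i then f (e i') * l y else 0)"
      proof (intro sum.cong refl)
        fix i' assume "i' \<in> {..<k}"
        then have "y \<in> A i' \<longleftrightarrow> i' = i"
          using i y e(2) by (auto simp: A_def inj_on_def)
        then show "f (e i') * (indicator (A i') y *\<^sub>R l y) = (if i' = i then f (e i') * l y else 0)"
          by (simp add: indicator_def)
      qed
      then show "f (g y) * l y = (\<Sum>i<k. f (e i) * (indicator (A i) y *\<^sub>R l y))"
        using i by simp
    qed
    also have "\<dots> = (\<Sum>i<k. f (e i) * \<mu> i)"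
      unfolding \<mu>_def set_lebesgue_integral_def
      by (subst Bochner_Integration.integral_sum, intro integrable_mult_right integrable_mult_indicator A int_l)
         (simp only: Bochner_Integration.integral_mult_right_zero)
    finally show ?thesis .
  qed
  have "indep_vars (\<lambda>_. borel) (\<lambda>i \<omega>. ennreal (e i) ^ points_in (A i) (C \<omega>)) {..<k}"
  proof (rule indep_vars_compose2[where X = "\<lambda>i \<omega>. points_in (A i) (C \<omega>)" and
        Y = "\<lambda>i n. ennreal (e i) ^ n" and M' = "\<lambda>_. count_space UNIV"])
    show "indep_vars (\<lambda>_. count_space UNIV) (\<lambda>i \<omega>. points_in (A i) (C \<omega>)) {..<k}"
      using e(2) by (intro indep A) (auto simp: disjoint_family_on_def A_def inj_on_def)
  qed simp
  then have "(\<integral>\<^sup>+\<omega>. (\<Prod>i<k. ennreal (e i) ^ points_in (A i) (C \<omega>)) \<partial>P) =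
      (\<Prod>i<k. \<integral>\<^sup>+\<omega>. ennreal (e i) ^ points_in (A i) (C \<omega>) \<partial>P)"
    by (intro indep_vars_nn_integral) auto
  also have "\<dots> = (\<Prod>i<k. ennreal (exp (e i * \<mu> i - \<mu> i)))"
    using e_nonneg \<mu>_nonneg unfolding \<mu>_def
    by (intro prod.cong refl nn_integral_power_poisson P dist A) auto
  also have "\<dots> = ennreal (exp (\<Sum>i<k. e i * \<mu> i - \<mu> i))"
    by (simp add: prod_ennreal exp_sum)
  also have "(\<Sum>i<k. e i * \<mu> i - \<mu> i) = (\<integral>y. g y * l y \<partial>\<nu>) - (\<integral>y. l y \<partial>\<nu>)"
    using split[of "\<lambda>t. t"] split[of "\<lambda>_. 1"] by (simp add: sum_subtractf)
  finally show ?thesis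
  proof (subst nn_integral_cong)
    fix \<omega> assume \<omega>: "\<omega> \<in> space P"
    have "(\<Prod>y\<in>#C \<omega>. g y) = (\<Prod>c\<in>e ` {i. i < k}. c ^ points_in (g -` {c} \<inter> space \<nu>) (C \<omega>))"
      unfolding e(1)[symmetric] by (rule prod_mset_finite_range[OF g(3) C_sub[OF \<omega>]])
    also have "\<dots> = (\<Prod>i<k. e i ^ points_in (A i) (C \<omega>))"
      using e(2) by (subst prod.reindex) (auto simp: A_def lessThan_def)
    finally have "ennreal (\<Prod>y\<in>#C \<omega>. g y) = (\<Prod>i<k. ennreal (e i ^ points_in (A i) (C \<omega>)))"
      using e_nonneg by (subst prod_ennreal) auto
    also have "\<dots> = (\<Prod>i<k. ennreal (e i) ^ points_in (A i) (C \<omega>))"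
      using e_nonneg by (intro prod.cong) (auto simp: ennreal_power)
    finally show "ennreal (\<Prod>y\<in>#C \<omega>. g y) = (\<Prod>i<k. ennreal (e i) ^ points_in (A i) (C \<omega>))" .
  qed simp
qed

lemma poisson_pgfl:
  fixes \<nu> :: "'a measure" and g :: "'a \<Rightarrow> real"
  assumes P: "prob_space P" and C: "poisson_process P \<nu> l C"
    and g: "g \<in> borel_measurable \<nu>" "\<And>y. 0 \<le> g y" "\<And>y. g y \<le> 1"
  shows "(\<integral>\<^sup>+\<omega>. ennreal (\<Prod>y\<in>#C \<omega>. g y) \<partial>P) = ennreal (exp ((\<integral>y. g y * l y \<partial>\<nu>) - (\<integral>y. l y \<partial>\<nu>)))"
proof -
  interpret prob_space P by (rule P)
  have [measurable]: "C \<in> P \<rightarrow>\<^sub>M configs \<nu>" and l [measurable]: "l \<in> borel_measurable \<nu>"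
    and l_nonneg: "\<And>z. z \<in> space \<nu> \<Longrightarrow> 0 \<le> l z" and l_fin: "(\<integral>\<^sup>+z. ennreal (l z) \<partial>\<nu>) < \<infinity>"
    using C by (auto simp: poisson_process_def)
  note [measurable] = g(1)
  have int_l: "integrable \<nu> l"
    using l_nonneg l_fin by (intro integrableI_nonneg) (auto intro!: AE_I2)
  \<comment> \<open>Rounding down to multiples of \<open>1 / 2 ^ i\<close> leaves finitely many
    values, as \<open>g\<close> lies in [0,1], and stays below \<open>g\<close>. Hence 1 and
    \<open>l\<close> dominate on the two sides of the identity.\<close>
  define s where "s i y = (of_int \<lfloor>2 ^ i * g y\<rfloor> / 2 ^ i :: real)" for i :: nat and y
  have s_meas [measurable]: "s i \<in> borel_measurable \<nu>" for i
    unfolding s_def by measurable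
  have s_le: "s i y \<le> g y" and s_ge: "g y - (1/2) ^ i \<le> s i y" for i y
  proof -
    have "of_int \<lfloor>2 ^ i * g y\<rfloor> \<le> 2 ^ i * g y" by simp
    then show "s i y \<le> g y" by (simp add: s_def divide_le_eq mult.commute)
    have "2 ^ i * g y - 1 \<le> of_int \<lfloor>2 ^ i * g y\<rfloor>" by linarith
    then have "(2 ^ i * g y - 1) / 2 ^ i \<le> s i y" unfolding s_def by (intro divide_right_mono) auto
    then show "g y - (1/2) ^ i \<le> s i y" by (simp add: diff_divide_distrib power_one_over)
  qed
  have s_nonneg: "0 \<le> s i y" for i y
    using g(2) by (simp add: s_def)
  have s_fin: "finite (s i ` space \<nu>)" for i
  proof (rule finite_subset)
    show "s i ` space \<nu> \<subseteq> (\<lambda>k. of_int k / 2 ^ i) ` {0..2 ^ i}"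
    proof (rule image_subsetI)
      fix y
      have "\<lfloor>2 ^ i * g y\<rfloor> \<le> \<lfloor>2 ^ i :: real\<rfloor>"
        using g(3) by (intro floor_mono) simp
      also have "\<lfloor>2 ^ i :: real\<rfloor> = 2 ^ i"
        by (metis floor_of_int of_int_numeral of_int_power)
      finally show "s i y \<in> (\<lambda>k. of_int k / 2 ^ i) ` {0..2 ^ i}"
        unfolding s_def using g(2) by (intro imageI) simp
    qed
  qed simp
  have s_lim: "(\<lambda>i. s i y) \<longlonglongrightarrow> g y" for y
  proof (rule tendsto_sandwich[where f = "\<lambda>i. g y - (1/2) ^ i" and h = "\<lambda>_. g y"])
    show "(\<lambda>i. g y - (1/2) ^ i) \<longlonglongrightarrow> g y"
      by (rule tendsto_eq_intros tendsto_const LIMSEQ_power_zero | simp)+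
  qed (use s_le s_ge in auto)
  have lhs: "(\<lambda>i. \<integral>\<^sup>+\<omega>. ennreal (\<Prod>y\<in>#C \<omega>. s i y) \<partial>P) \<longlonglongrightarrow> (\<integral>\<^sup>+\<omega>. ennreal (\<Prod>y\<in>#C \<omega>. g y) \<partial>P)"
  proof (rule nn_integral_dominated_convergence[where w = "\<lambda>_. 1"])
    show "AE \<omega> in P. ennreal (\<Prod>y\<in>#C \<omega>. s i y) \<le> 1" for i
      using s_nonneg s_le g(3) by (auto intro!: AE_I2 prod_mset_le_1 order_trans[OF s_le])
    show "AE \<omega> in P. (\<lambda>i. ennreal (\<Prod>y\<in>#C \<omega>. s i y)) \<longlonglongrightarrow> ennreal (\<Prod>y\<in>#C \<omega>. g y)"
      by (intro AE_I2 tendsto_ennrealI tendsto_prod_mset s_lim)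
  qed (auto simp: emeasure_space_1)
  have "(\<lambda>i. \<integral>y. s i y * l y \<partial>\<nu>) \<longlonglongrightarrow> (\<integral>y. g y * l y \<partial>\<nu>)"
  proof (rule integral_dominated_convergence[where w = l])
    show "AE y in \<nu>. (\<lambda>i. s i y * l y) \<longlonglongrightarrow> g y * l y"
      by (intro AE_I2 tendsto_mult s_lim tendsto_const)
    show "AE y in \<nu>. norm (s i y * l y) \<le> l y" for i
      using l_nonneg s_nonneg order_trans[OF s_le g(3)]
      by (intro AE_I2) (simp add: abs_mult mult_left_le_one_le)
  qed (auto intro: int_l)
  then have "(\<lambda>i. ennreal (exp ((\<integral>y. s i y * l y \<partial>\<nu>) - (\<integral>y. l y \<partial>\<nu>)))) \<longlonglongrightarrow>
      ennreal (exp ((\<integral>y. g y * l y \<partial>\<nu>) - (\<integral>y. l y \<partial>\<nu>)))"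
    by (intro tendsto_ennrealI tendsto_exp tendsto_diff tendsto_const)
  moreover have "(\<lambda>i. \<integral>\<^sup>+\<omega>. ennreal (\<Prod>y\<in>#C \<omega>. s i y) \<partial>P) =
      (\<lambda>i. ennreal (exp ((\<integral>y. s i y * l y \<partial>\<nu>) - (\<integral>y. l y \<partial>\<nu>))))"
    by (intro ext poisson_pgfl_finite_range[OF P C s_meas s_nonneg s_fin])
  ultimately have "(\<lambda>i. \<integral>\<^sup>+\<omega>. ennreal (\<Prod>y\<in>#C \<omega>. s i y) \<partial>P) \<longlonglongrightarrow>
      ennreal (exp ((\<integral>y. g y * l y \<partial>\<nu>) - (\<integral>y. l y \<partial>\<nu>)))"
    by (simp only:)
  with lhs show ?thesis
    by (rule LIMSEQ_unique)
qed

section \<open>Identification of the law of the pair of processes\<close>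

section \<open>The joint law\<close>

text \<open>The components of the joint formula are to be compared with a single law, so their
  series has to be a measure. With the series written as an integral over
  \<open>count_space UNIV\<close>, additivity is the exchange of two sums.\<close>

lemma ex_sum_measure:
  fixes M :: "nat \<Rightarrow> 'b measure"
  assumes sets_M: "\<And>i. sets (M i) = sets N"
  shows "\<exists>R. sets R = sets N \<and> (\<forall>F\<in>borel_measurable N. (\<integral>\<^sup>+x. F x \<partial>R) = (\<Sum>i. \<integral>\<^sup>+x. F x \<partial>M i))"
proof -
  define R where "R = measure_of (space N) (sets N) (\<lambda>X. \<integral>\<^sup>+i. emeasure (M i) X \<partial>count_space UNIV)"
  have sets_R [measurable_cong]: "sets R = sets N"
    by (simp add: R_def)
  have em: "emeasure R X = (\<Sum>i. emeasure (M i) X)" if X: "X \<in> sets N" for X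
  proof -
    have "emeasure R X = (\<integral>\<^sup>+i. emeasure (M i) X \<partial>count_space UNIV)"
    proof (rule emeasure_measure_of[OF R_def])
      show "sets N \<subseteq> Pow (space N)" by (rule sets.space_closed)
      show "positive (sets R) (\<lambda>X. \<integral>\<^sup>+i. emeasure (M i) X \<partial>count_space UNIV)"
        by (simp add: positive_def)
      show "countably_additive (sets R) (\<lambda>X. \<integral>\<^sup>+i. emeasure (M i) X \<partial>count_space UNIV)"
      proof (rule countably_additiveI)
        fix A :: "nat \<Rightarrow> 'b set" assume A: "range A \<subseteq> sets R" "disjoint_family A"
        have "(\<Sum>k. \<integral>\<^sup>+i. emeasure (M i) (A k) \<partial>count_space UNIV) = (\<integral>\<^sup>+i. (\<Sum>k. emeasure (M i) (A k)) \<partial>count_space UNIV)"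
          by (rule nn_integral_suminf[symmetric]) simp
        also have "\<dots> = (\<integral>\<^sup>+i. emeasure (M i) (\<Union>k. A k) \<partial>count_space UNIV)"
          using A by (intro nn_integral_cong suminf_emeasure) (auto simp: sets_M sets_R)
        finally show "(\<Sum>k. \<integral>\<^sup>+i. emeasure (M i) (A k) \<partial>count_space UNIV) = (\<integral>\<^sup>+i. emeasure (M i) (\<Union>k. A k) \<partial>count_space UNIV)" .
      qed
      show "X \<in> sets R" using X sets_R by simp
    qed
    then show ?thesis by (simp add: nn_integral_count_space_nat)
  qed
  have "(\<integral>\<^sup>+x. F x \<partial>R) = (\<Sum>i. \<integral>\<^sup>+x. F x \<partial>M i)" if "F \<in> borel_measurable N" for F
    using that
  proof induction
    case (cong f g)
    have sp: "space R = space N" "space (M i) = space N" for i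
      using sets_eq_imp_space_eq[OF sets_R] sets_eq_imp_space_eq[OF sets_M] by auto
    have "(\<integral>\<^sup>+x. f x \<partial>R) = (\<integral>\<^sup>+x. g x \<partial>R)" "(\<integral>\<^sup>+x. f x \<partial>M i) = (\<integral>\<^sup>+x. g x \<partial>M i)" for i
      using cong(3) by (auto intro!: nn_integral_cong simp: sp)
    then show ?case using cong by simp
  next
    case (set A)
    then show ?case using em[OF set] by (simp add: sets_R sets_M)
  next
    case (mult u c)
    have "(\<integral>\<^sup>+x. c * u x \<partial>R) = c * (\<integral>\<^sup>+x. u x \<partial>R)" "(\<integral>\<^sup>+x. c * u x \<partial>M i) = c * (\<integral>\<^sup>+x. u x \<partial>M i)" for i
      using mult(2) by (auto intro!: nn_integral_cmult simp: measurable_cong_sets[OF sets_M refl] measurable_cong_sets[OF sets_R refl])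
    then show ?case using mult by simp
  next
    case (add u v)
    have "(\<integral>\<^sup>+x. v x + u x \<partial>R) = (\<integral>\<^sup>+x. v x \<partial>R) + (\<integral>\<^sup>+x. u x \<partial>R)"
      "(\<integral>\<^sup>+x. v x + u x \<partial>M i) = (\<integral>\<^sup>+x. v x \<partial>M i) + (\<integral>\<^sup>+x. u x \<partial>M i)" for i
      by (rule nn_integral_add;
          simp add: add(1,3) measurable_cong_sets[OF sets_M refl] measurable_cong_sets[OF sets_R refl])+
    then show ?case using add by (simp add: suminf_add)
  next
    case (seq U)
    have "(\<integral>\<^sup>+x. (SUP k. U k x) \<partial>R) = (SUP k. \<integral>\<^sup>+x. U k x \<partial>R)"
      "(\<integral>\<^sup>+x. (SUP k. U k x) \<partial>M i) = (SUP k. \<integral>\<^sup>+x. U k x \<partial>M i)" for i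
      by (rule nn_integral_monotone_convergence_SUP;
          simp add: seq(1,3) measurable_cong_sets[OF sets_M refl] measurable_cong_sets[OF sets_R refl])+
    moreover have "(SUP k. \<Sum>i. \<integral>\<^sup>+x. U k x \<partial>M i) = (\<Sum>i. SUP k. \<integral>\<^sup>+x. U k x \<partial>M i)"
      using seq(3) by (intro ennreal_suminf_SUP_eq[symmetric]) (auto simp: incseq_def le_fun_def intro!: nn_integral_mono)
    ultimately show ?case using seq by (simp add: image_comp)
  qed
  then show ?thesis using sets_R by blast
qed

declare One_nat_def [simp del]

locale observed_process = detection_model \<nu> j q lt lc
  for \<nu> :: "'a measure" and j q lt lc +
  fixes P :: "'w measure" and \<Phi> \<Xi> :: "'w \<Rightarrow> 'a multiset" and p :: real and ld :: "'a \<Rightarrow> 'a \<Rightarrow> real"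
  assumes P: "prob_space P"
    and \<Phi>: "simple_point_process P \<nu> \<Phi>"
    and janossy: "janossy_densities P \<nu> \<Phi> j"
    and p: "0 \<le> p" "p \<le> 1" and q_def: "q = 1 - p"
    and ld: "shift_density \<nu> ld" and lt_def: "\<And>z x. lt z x = p * ld z x"
    and \<Xi>: "measurement_process P \<nu> p ld lc \<Phi> \<Xi>"
begin

sublocale prob_space P by (rule P)

lemma \<Phi>_meas [measurable]: "\<Phi> \<in> P \<rightarrow>\<^sub>M configs \<nu>"
  using \<Phi> by (simp add: simple_point_process_def)

lemma \<Xi>_meas [measurable]: "\<Xi> \<in> P \<rightarrow>\<^sub>M configs \<nu>"
proof -
  obtain \<Psi> C where "thinned_shifted P \<nu> p ld \<Phi> \<Psi>" "poisson_process P \<nu> lc C"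
    and eq: "\<forall>\<omega>\<in>space P. \<Xi> \<omega> = \<Psi> \<omega> + C \<omega>"
    using \<Xi> unfolding measurement_process_def by blast
  then have [measurable]: "\<Psi> \<in> P \<rightarrow>\<^sub>M configs \<nu>" "C \<in> P \<rightarrow>\<^sub>M configs \<nu>"
    by (simp_all add: thinned_shifted_def poisson_process_def)
  have "(\<lambda>\<omega>. \<Psi> \<omega> + C \<omega>) \<in> P \<rightarrow>\<^sub>M configs \<nu>" by measurable
  then show ?thesis by (rule iffD2[OF measurable_cong, rotated]) (simp add: eq)
qed

text \<open>Independence of the clutter splits the expectation into the Poisson functional and that
  of the thinned process. The constant \<open>void\<close> is separated because it is the prefactor
  of the joint formula.\<close>

lemma joint_pgfl_factorization:
  assumes h: "h \<in> borel_measurable \<nu>" "\<And>y. 0 \<le> h y" "\<And>y. h y \<le> 1"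
    and g: "g \<in> borel_measurable \<nu>" "\<And>y. 0 \<le> g y" "\<And>y. g y \<le> 1"
  shows "(\<integral>\<^sup>+\<omega>. ennreal (\<Prod>x\<in>#\<Phi> \<omega>. h x) * ennreal (\<Prod>y\<in>#\<Xi> \<omega>. g y) \<partial>P) =
    ennreal (void * exp (\<integral>y. g y * lc y \<partial>\<nu>)) * (\<integral>\<^sup>+\<omega>. ennreal (\<Prod>x\<in>#\<Phi> \<omega>. h x * survival_pgf \<nu> p ld g x) \<partial>P)"
proof -
  obtain \<Psi> C where \<Psi>: "thinned_shifted P \<nu> p ld \<Phi> \<Psi>" and C: "poisson_process P \<nu> lc C"
    and indep: "distr P ((configs \<nu> \<Otimes>\<^sub>M configs \<nu>) \<Otimes>\<^sub>M configs \<nu>) (\<lambda>\<omega>. ((\<Phi> \<omega>, \<Psi> \<omega>), C \<omega>)) =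
          distr P (configs \<nu> \<Otimes>\<^sub>M configs \<nu>) (\<lambda>\<omega>. (\<Phi> \<omega>, \<Psi> \<omega>)) \<Otimes>\<^sub>M distr P (configs \<nu>) C"
    and eq: "\<And>\<omega>. \<omega> \<in> space P \<Longrightarrow> \<Xi> \<omega> = \<Psi> \<omega> + C \<omega>"
    using \<Xi> by (auto simp: measurement_process_def)
  have \<Psi>_meas [measurable]: "\<Psi> \<in> P \<rightarrow>\<^sub>M configs \<nu>" and C_meas [measurable]: "C \<in> P \<rightarrow>\<^sub>M configs \<nu>"
    using \<Psi> C by (auto simp: thinned_shifted_def poisson_process_def)
  note [measurable] = h(1) g(1)
  define A where "A = distr P (configs \<nu> \<Otimes>\<^sub>M configs \<nu>) (\<lambda>\<omega>. (\<Phi> \<omega>, \<Psi> \<omega>))"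
  define B where "B = distr P (configs \<nu>) C"
  interpret A: prob_space A unfolding A_def by (rule prob_space_distr) measurable
  interpret B: prob_space B unfolding B_def by (rule prob_space_distr) measurable
  define F where "F w = ennreal (\<Prod>x\<in>#fst w. h x) * ennreal (\<Prod>y\<in>#snd w. g y)" for w :: "'a multiset \<times> 'a multiset"
  define G where "G \<xi> = ennreal (\<Prod>y\<in>#\<xi>. g y)" for \<xi>
  have F [measurable]: "F \<in> borel_measurable (configs \<nu> \<Otimes>\<^sub>M configs \<nu>)" unfolding F_def by measurable
  have G [measurable]: "G \<in> borel_measurable (configs \<nu>)" unfolding G_def by measurable
  have FG: "(\<lambda>w. F (fst w) * G (snd w)) \<in> borel_measurable ((configs \<nu> \<Otimes>\<^sub>M configs \<nu>) \<Otimes>\<^sub>M configs \<nu>)" by measurable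
  have sets_AB: "sets (A \<Otimes>\<^sub>M B) = sets ((configs \<nu> \<Otimes>\<^sub>M configs \<nu>) \<Otimes>\<^sub>M configs \<nu>)"
    by (intro sets_pair_measure_cong) (auto simp: A_def B_def)
  have "(\<integral>\<^sup>+\<omega>. ennreal (\<Prod>x\<in>#\<Phi> \<omega>. h x) * ennreal (\<Prod>y\<in>#\<Xi> \<omega>. g y) \<partial>P) = (\<integral>\<^sup>+\<omega>. F (\<Phi> \<omega>, \<Psi> \<omega>) * G (C \<omega>) \<partial>P)"
    using g(2) by (intro nn_integral_cong) (simp add: eq F_def G_def ennreal_mult prod_mset_nonneg mult.assoc)
  also have "\<dots> = (\<integral>\<^sup>+w. F (fst w) * G (snd w) \<partial>distr P ((configs \<nu> \<Otimes>\<^sub>M configs \<nu>) \<Otimes>\<^sub>M configs \<nu>) (\<lambda>\<omega>. ((\<Phi> \<omega>, \<Psi> \<omega>), C \<omega>)))"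
    by (subst nn_integral_distr) (auto intro: FG)
  also have "\<dots> = (\<integral>\<^sup>+w. F (fst w) * G (snd w) \<partial>(A \<Otimes>\<^sub>M B))"
    unfolding indep A_def B_def ..
  also have "\<dots> = (\<integral>\<^sup>+a. \<integral>\<^sup>+b. F a * G b \<partial>B \<partial>A)"
    using FG by (subst B.nn_integral_fst[symmetric]) (auto simp: measurable_cong_sets[OF sets_AB refl])
  also have "\<dots> = (\<integral>\<^sup>+b. G b \<partial>B) * (\<integral>\<^sup>+a. F a \<partial>A)"
  proof -
    have "G \<in> borel_measurable B" "F \<in> borel_measurable A" by (auto simp: A_def B_def)
    then show ?thesis by (simp add: nn_integral_cmult nn_integral_multc mult.commute)
  qed
  also have "(\<integral>\<^sup>+b. G b \<partial>B) = ennreal (exp ((\<integral>y. g y * lc y \<partial>\<nu>) - (\<integral>y. lc y \<partial>\<nu>)))"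
    unfolding B_def by (subst nn_integral_distr) (auto simp: G_def poisson_pgfl[OF P C g])
  also have "exp ((\<integral>y. g y * lc y \<partial>\<nu>) - (\<integral>y. lc y \<partial>\<nu>)) = void * exp (\<integral>y. g y * lc y \<partial>\<nu>)"
    by (simp add: exp_diff exp_minus divide_inverse mult.commute)
  also have "(\<integral>\<^sup>+a. F a \<partial>A) = (\<integral>\<^sup>+\<omega>. ennreal (\<Prod>x\<in>#\<Phi> \<omega>. h x * survival_pgf \<nu> p ld g x) \<partial>P)"
    unfolding A_def by (subst nn_integral_distr)
      (auto simp: F_def thinned_shifted_pgfl[OF sf p ld P \<Phi> \<Psi> h g])
  finally show ?thesis .
qed

text \<open>The part of the joint law with \<open>n\<close> hidden points and \<open>m\<close>
  observations, as the formula predicts it; the factorials account for the orderings of the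
  tuples.\<close>

definition component :: "nat \<Rightarrow> nat \<Rightarrow> ('a multiset \<times> 'a multiset) measure" where
  "component n m = distr (density (tuples \<nu> n \<Otimes>\<^sub>M tuples \<nu> m)
      (\<lambda>w. ennreal (1 / fact n) * (ennreal (1 / fact m) * ennreal (jf n m (fst w) (snd w)))))
    (configs \<nu> \<Otimes>\<^sub>M configs \<nu>) (\<lambda>w. (config_of n (fst w), config_of m (snd w)))"

lemma jf_meas' [measurable]: "(\<lambda>w. jf n m (fst w) (snd w)) \<in> borel_measurable (tuples \<nu> n \<Otimes>\<^sub>M tuples \<nu> m)"
  using jf_meas by (simp add: case_prod_beta)

lemma config_pair_meas [measurable]:
  "(\<lambda>w. (config_of n (fst w), config_of m (snd w))) \<in> tuples \<nu> n \<Otimes>\<^sub>M tuples \<nu> m \<rightarrow>\<^sub>M configs \<nu> \<Otimes>\<^sub>M configs \<nu>"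
  by measurable

lemma nn_integral_component:
  assumes [measurable]: "F \<in> borel_measurable (configs \<nu> \<Otimes>\<^sub>M configs \<nu>)"
  shows "(\<integral>\<^sup>+w. F w \<partial>component n m) =
    ennreal (1 / fact n) * (ennreal (1 / fact m) *
      (\<integral>\<^sup>+w. F (config_of n (fst w), config_of m (snd w)) * ennreal (jf n m (fst w) (snd w)) \<partial>(tuples \<nu> n \<Otimes>\<^sub>M tuples \<nu> m)))"
proof -
  have "(\<integral>\<^sup>+w. F w \<partial>component n m) =
      (\<integral>\<^sup>+w. ennreal (1 / fact n) * (ennreal (1 / fact m) * ennreal (jf n m (fst w) (snd w))) *
        F (config_of n (fst w), config_of m (snd w)) \<partial>(tuples \<nu> n \<Otimes>\<^sub>M tuples \<nu> m))"
  proof -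
    have T: "(\<lambda>w. (config_of n (fst w), config_of m (snd w))) \<in> density (tuples \<nu> n \<Otimes>\<^sub>M tuples \<nu> m)
      (\<lambda>w. ennreal (1 / fact n) * (ennreal (1 / fact m) * ennreal (jf n m (fst w) (snd w)))) \<rightarrow>\<^sub>M configs \<nu> \<Otimes>\<^sub>M configs \<nu>"
      using config_pair_meas by simp
    show ?thesis
      unfolding component_def
      by (subst nn_integral_distr[OF T], simp add: assms, rule nn_integral_density) measurable
  qed
  also have "\<dots> = (\<integral>\<^sup>+w. ennreal (1 / fact n) * (ennreal (1 / fact m) *
        (F (config_of n (fst w), config_of m (snd w)) * ennreal (jf n m (fst w) (snd w)))) \<partial>(tuples \<nu> n \<Otimes>\<^sub>M tuples \<nu> m))"
    by (simp only: mult_ac)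
  also have "\<dots> = ennreal (1 / fact n) * (ennreal (1 / fact m) *
      (\<integral>\<^sup>+w. F (config_of n (fst w), config_of m (snd w)) * ennreal (jf n m (fst w) (snd w)) \<partial>(tuples \<nu> n \<Otimes>\<^sub>M tuples \<nu> m)))"
    by (subst nn_integral_cmult, measurable, subst nn_integral_cmult, measurable)
  finally show ?thesis .
qed

text \<open>The sum over \<open>m\<close>, taken with the hidden points fixed, yields the product of
  the survival functions. The remaining sum over \<open>n\<close> is the Janossy identity of \<Phi>
  for the product of \<open>h\<close> times the survival function.\<close>

lemma suminf_component_pgfl:
  assumes h: "h \<in> borel_measurable \<nu>" "\<And>y. 0 \<le> h y" "\<And>y. h y \<le> 1"
    and g: "g \<in> borel_measurable \<nu>" "\<And>y. 0 \<le> g y" "\<And>y. g y \<le> 1"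
  shows "(\<Sum>n. \<Sum>m. \<integral>\<^sup>+w. ennreal (\<Prod>x\<in>#fst w. h x) * ennreal (\<Prod>y\<in>#snd w. g y) \<partial>component n m) =
    ennreal (void * exp (\<integral>y. g y * lc y \<partial>\<nu>)) * (\<integral>\<^sup>+\<omega>. ennreal (\<Prod>x\<in>#\<Phi> \<omega>. h x * survival_pgf \<nu> p ld g x) \<partial>P)"
proof -
  note [measurable] = h(1) g(1) survival_pgf_meas[OF sf p ld g(1)]
  define E where "E = void * exp (\<integral>y. g y * lc y \<partial>\<nu>)"
  let ?u = "survival_pgf \<nu> p ld g"
  let ?F = "\<lambda>n m w. ennreal (\<Prod>i=1..n. h (fst w i)) * (ennreal (\<Prod>k=1..m. g (snd w k)) * ennreal (jf n m (fst w) (snd w)))"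
  have F_meas: "?F n m \<in> borel_measurable (tuples \<nu> n \<Otimes>\<^sub>M tuples \<nu> m)" for n m
    by measurable
  have sect: "(\<lambda>z. ennreal (\<Prod>k=1..m. g (z k)) * ennreal (jf n m x z)) \<in> borel_measurable (tuples \<nu> m)"
    if "x \<in> space (tuples \<nu> n)" for x n m
    using jf_meas_z[OF that, of m] by measurable
  have inner_meas: "(\<lambda>x. \<integral>\<^sup>+z. ?F n m (x, z) \<partial>tuples \<nu> m) \<in> borel_measurable (tuples \<nu> n)" for n m
    by (rule sigma_finite_measure.borel_measurable_nn_integral[OF sigma_finite_tuples[OF sf]])
       (simp add: case_prod_beta F_meas)
  have term_n: "(\<Sum>m. \<integral>\<^sup>+w. ennreal (\<Prod>x\<in>#fst w. h x) * ennreal (\<Prod>y\<in>#snd w. g y) \<partial>component n m) =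
      ennreal E * (ennreal (1 / fact n) * (\<integral>\<^sup>+x. ennreal (\<Prod>y\<in>#config_of n x. h y * ?u y) * ennreal (j n x) \<partial>tuples \<nu> n))" for n
  proof -
    have "(\<integral>\<^sup>+w. ennreal (\<Prod>x\<in>#fst w. h x) * ennreal (\<Prod>y\<in>#snd w. g y) \<partial>component n m) =
        ennreal (1 / fact n) * (\<integral>\<^sup>+x. ennreal (1 / fact m) * (\<integral>\<^sup>+z. ?F n m (x, z) \<partial>tuples \<nu> m) \<partial>tuples \<nu> n)" for m
    proof -
      have "(\<integral>\<^sup>+w. ennreal (\<Prod>x\<in>#fst w. h x) * ennreal (\<Prod>y\<in>#snd w. g y) \<partial>component n m) =
          ennreal (1 / fact n) * (ennreal (1 / fact m) * (\<integral>\<^sup>+w. ?F n m w \<partial>(tuples \<nu> n \<Otimes>\<^sub>M tuples \<nu> m)))"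
        by (subst nn_integral_component) (auto simp: prod_mset_config_of mult.assoc)
      also have "(\<integral>\<^sup>+w. ?F n m w \<partial>(tuples \<nu> n \<Otimes>\<^sub>M tuples \<nu> m)) = (\<integral>\<^sup>+x. \<integral>\<^sup>+z. ?F n m (x, z) \<partial>tuples \<nu> m \<partial>tuples \<nu> n)"
        by (rule sigma_finite_measure.nn_integral_fst[OF sigma_finite_tuples[OF sf] F_meas, symmetric])
      also have "ennreal (1 / fact m) * \<dots> = (\<integral>\<^sup>+x. ennreal (1 / fact m) * (\<integral>\<^sup>+z. ?F n m (x, z) \<partial>tuples \<nu> m) \<partial>tuples \<nu> n)"
        by (rule nn_integral_cmult[OF inner_meas, symmetric])
      finally show ?thesis .
    qed
    then have "(\<Sum>m. \<integral>\<^sup>+w. ennreal (\<Prod>x\<in>#fst w. h x) * ennreal (\<Prod>y\<in>#snd w. g y) \<partial>component n m) =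
        ennreal (1 / fact n) * (\<Sum>m. \<integral>\<^sup>+x. ennreal (1 / fact m) * (\<integral>\<^sup>+z. ?F n m (x, z) \<partial>tuples \<nu> m) \<partial>tuples \<nu> n)"
      by simp
    also have "(\<Sum>m. \<integral>\<^sup>+x. ennreal (1 / fact m) * (\<integral>\<^sup>+z. ?F n m (x, z) \<partial>tuples \<nu> m) \<partial>tuples \<nu> n) =
        (\<integral>\<^sup>+x. (\<Sum>m. ennreal (1 / fact m) * (\<integral>\<^sup>+z. ?F n m (x, z) \<partial>tuples \<nu> m)) \<partial>tuples \<nu> n)"
      by (rule nn_integral_suminf[symmetric]) (intro borel_measurable_times_ennreal borel_measurable_const inner_meas)
    also have "\<dots> = (\<integral>\<^sup>+x. ennreal E * (ennreal (\<Prod>y\<in>#config_of n x. h y * ?u y) * ennreal (j n x)) \<partial>tuples \<nu> n)"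
    proof (intro nn_integral_cong)
      fix x assume x: "x \<in> space (tuples \<nu> n)"
      have u_nonneg: "0 \<le> ?u (x i)" if "i \<in> {1..n}" for i
        by (rule detection_law_pgfl(2)[OF sf p ld tuples_space[OF x that] g])
      have "(\<integral>\<^sup>+z. ?F n m (x, z) \<partial>tuples \<nu> m) = ennreal (\<Prod>i=1..n. h (x i)) *
          (\<integral>\<^sup>+z. ennreal (\<Prod>k=1..m. g (z k)) * ennreal (jf n m x z) \<partial>tuples \<nu> m)" for m
        using nn_integral_cmult[OF sect[OF x, of m]] by simp
      then have "(\<Sum>m. ennreal (1 / fact m) * (\<integral>\<^sup>+z. ?F n m (x, z) \<partial>tuples \<nu> m)) =
          (\<Sum>m. ennreal (\<Prod>i=1..n. h (x i)) * (ennreal (1 / fact m) * (\<integral>\<^sup>+z. ennreal (\<Prod>k=1..m. g (z k)) * ennreal (jf n m x z) \<partial>tuples \<nu> m)))"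
        by (simp only: mult_ac)
      also have "\<dots> = ennreal (\<Prod>i=1..n. h (x i)) * ennreal (E * j n x * (\<Prod>i=1..n. q + (\<integral>y. g y * lt y (x i) \<partial>\<nu>)))"
        unfolding ennreal_suminf_cmult suminf_pgfl_jf[OF x g] E_def ..
      also have "(\<Prod>i=1..n. q + (\<integral>y. g y * lt y (x i) \<partial>\<nu>)) = (\<Prod>i=1..n. ?u (x i))"
        by (simp add: survival_pgf_def[OF sf p ld] q_def lt_def)
      also have "ennreal (\<Prod>i=1..n. h (x i)) * ennreal (E * j n x * (\<Prod>i=1..n. ?u (x i))) =
          ennreal E * (ennreal (\<Prod>y\<in>#config_of n x. h y * ?u y) * ennreal (j n x))"
      proof -
        have *: "ennreal a * ennreal (E * c * b) = ennreal E * (ennreal (a * b) * ennreal c)"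
          if "0 \<le> a" "0 \<le> b" "0 \<le> c" for a b c :: real
          using that by (simp add: E_def ennreal_mult mult_ac)
        show ?thesis
          unfolding prod_mset_config_of prod.distrib
          by (rule *[OF prod_nonneg prod_nonneg j_nonneg[OF x]]) (use u_nonneg h(2) in auto)
      qed
      finally show "(\<Sum>m. ennreal (1 / fact m) * (\<integral>\<^sup>+z. ?F n m (x, z) \<partial>tuples \<nu> m)) =
          ennreal E * (ennreal (\<Prod>y\<in>#config_of n x. h y * ?u y) * ennreal (j n x))" .
    qed
    also have "\<dots> = ennreal E * (\<integral>\<^sup>+x. ennreal (\<Prod>y\<in>#config_of n x. h y * ?u y) * ennreal (j n x) \<partial>tuples \<nu> n)"
      by (rule nn_integral_cmult) measurable
    finally show ?thesis by (simp only: mult.left_commute)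
  qed
  have "(\<lambda>\<phi>. ennreal (\<Prod>y\<in>#\<phi>. h y * ?u y)) \<in> borel_measurable (configs \<nu>)" by measurable
  then have "(\<integral>\<^sup>+\<omega>. ennreal (\<Prod>x\<in>#\<Phi> \<omega>. h x * ?u x) \<partial>P) =
      (\<Sum>n. ennreal (1 / fact n) * (\<integral>\<^sup>+x. ennreal (\<Prod>y\<in>#config_of n x. h y * ?u y) * ennreal (j n x) \<partial>tuples \<nu> n))"
    using janossy by (auto simp: janossy_densities_def)
  then show ?thesis
    unfolding term_n E_def[symmetric] by (simp only: ennreal_suminf_cmult)
qed

text \<open>Both sides define finite measures with the same generating functional.\<close>

theorem nn_integral_joint_law:
  assumes F: "F \<in> borel_measurable (configs \<nu> \<Otimes>\<^sub>M configs \<nu>)"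
  shows "(\<integral>\<^sup>+\<omega>. F (\<Phi> \<omega>, \<Xi> \<omega>) \<partial>P) = (\<Sum>n. \<Sum>m. \<integral>\<^sup>+w. F w \<partial>component n m)"
proof -
  let ?N = "configs \<nu> \<Otimes>\<^sub>M configs \<nu>"
  \<comment> \<open>The double series is made into a measure in two rounds: over \<open>m\<close>
    for each \<open>n\<close>, then over \<open>n\<close>.\<close>
  have "\<forall>n. \<exists>R. sets R = sets ?N \<and> (\<forall>F\<in>borel_measurable ?N. (\<integral>\<^sup>+x. F x \<partial>R) = (\<Sum>m. \<integral>\<^sup>+x. F x \<partial>component n m))"
    by (intro allI ex_sum_measure) (simp add: component_def)
  then obtain R1 where R1: "\<And>n. sets (R1 n) = sets ?N"
    "\<And>n F. F \<in> borel_measurable ?N \<Longrightarrow> (\<integral>\<^sup>+x. F x \<partial>R1 n) = (\<Sum>m. \<integral>\<^sup>+x. F x \<partial>component n m)"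
    by metis
  obtain R where R: "sets R = sets ?N"
    "\<And>F. F \<in> borel_measurable ?N \<Longrightarrow> (\<integral>\<^sup>+x. F x \<partial>R) = (\<Sum>n. \<Sum>m. \<integral>\<^sup>+x. F x \<partial>component n m)"
    using ex_sum_measure[of R1 ?N] R1 by auto
  define Q where "Q = distr P ?N (\<lambda>\<omega>. (\<Phi> \<omega>, \<Xi> \<omega>))"
  have pgfl: "(\<integral>\<^sup>+w. ennreal (\<Prod>x\<in>#fst w. h x) * ennreal (\<Prod>y\<in>#snd w. g y) \<partial>Q) =
      (\<integral>\<^sup>+w. ennreal (\<Prod>x\<in>#fst w. h x) * ennreal (\<Prod>y\<in>#snd w. g y) \<partial>R)"
    if h: "h \<in> borel_measurable \<nu>" "\<And>y. 0 \<le> h y" "\<And>y. h y \<le> 1"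
      and g: "g \<in> borel_measurable \<nu>" "\<And>y. 0 \<le> g y" "\<And>y. g y \<le> 1" for h g :: "'a \<Rightarrow> real"
  proof -
    note [measurable] = h(1) g(1)
    have F: "(\<lambda>w. ennreal (\<Prod>x\<in>#fst w. h x) * ennreal (\<Prod>y\<in>#snd w. g y)) \<in> borel_measurable ?N" by measurable
    have "(\<integral>\<^sup>+w. ennreal (\<Prod>x\<in>#fst w. h x) * ennreal (\<Prod>y\<in>#snd w. g y) \<partial>Q) =
        (\<integral>\<^sup>+\<omega>. ennreal (\<Prod>x\<in>#\<Phi> \<omega>. h x) * ennreal (\<Prod>y\<in>#\<Xi> \<omega>. g y) \<partial>P)"
      unfolding Q_def by (subst nn_integral_distr) (use F in auto)
    then show ?thesis
      unfolding R(2)[OF F] suminf_component_pgfl[OF h g] joint_pgfl_factorization[OF h g] by simp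
  qed
  have Q: "prob_space Q" "sets Q = sets ?N"
    unfolding Q_def by (auto intro: prob_space_distr)
  have space_RQ: "space R = space ?N" "space Q = space ?N"
    using sets_eq_imp_space_eq[OF R(1)] sets_eq_imp_space_eq[OF Q(2)] by auto
  \<comment> \<open>At \<open>h = g = 1\<close> the functional is the total mass, so the series
    measure inherits mass 1 from the law \<open>Q\<close>.\<close>
  have "emeasure R (space R) = 1"
    using pgfl[of "\<lambda>_. 1" "\<lambda>_. 1"] prob_space.emeasure_space_1[OF Q(1)] by simp
  then have R_prob: "prob_space R" by (rule prob_spaceI)
  have "Q = R"
  proof (rule measure_eqI_configs_pair[OF prob_space_imp_subprob_space[OF Q(1)] Q(2) prob_space_imp_subprob_space[OF R_prob] R(1)])
    fix h g :: "'a \<Rightarrow> real"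
    assume h: "h \<in> borel_measurable \<nu>" "\<And>y. 0 \<le> h y" "\<And>y. h y \<le> 1"
      and g: "g \<in> borel_measurable \<nu>" "\<And>y. 0 \<le> g y" "\<And>y. g y \<le> 1"
    note [measurable] = h(1) g(1)
    have F: "(\<lambda>w. (\<Prod>x\<in>#fst w. h x) * (\<Prod>x\<in>#snd w. g x)) \<in> borel_measurable ?N" by measurable
    have nn: "0 \<le> (\<Prod>x\<in>#\<phi>. h x)" "0 \<le> (\<Prod>x\<in>#\<phi>. g x)" for \<phi>
      using h(2) g(2) by (auto intro: prod_mset_nonneg)
    have "(\<integral>w. (\<Prod>x\<in>#fst w. h x) * (\<Prod>x\<in>#snd w. g x) \<partial>M) =
        enn2real (\<integral>\<^sup>+w. ennreal (\<Prod>x\<in>#fst w. h x) * ennreal (\<Prod>y\<in>#snd w. g y) \<partial>M)"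
      if "sets M = sets ?N" for M
      using F nn by (subst integral_eq_nn_integral) (auto simp: measurable_cong_sets[OF that refl] ennreal_mult)
    then show "(\<integral>w. (\<Prod>x\<in>#fst w. h x) * (\<Prod>x\<in>#snd w. g x) \<partial>Q) = (\<integral>w. (\<Prod>x\<in>#fst w. h x) * (\<Prod>x\<in>#snd w. g x) \<partial>R)"
      using Q(2) R(1) pgfl[OF h g] by simp
  qed
  have "(\<integral>\<^sup>+\<omega>. F (\<Phi> \<omega>, \<Xi> \<omega>) \<partial>P) = (\<integral>\<^sup>+w. F w \<partial>Q)"
    unfolding Q_def by (subst nn_integral_distr) (use F in auto)
  also have "\<dots> = (\<Sum>n. \<Sum>m. \<integral>\<^sup>+w. F w \<partial>component n m)"
    unfolding \<open>Q = R\<close> by (rule R(2)[OF F])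
  finally show ?thesis .
qed

end

declare upt_Suc [simp del]

section \<open>Product moments of hidden and observed points\<close>

section \<open>Janossy densities as densities of symmetrized expectations\<close>

lemma suminf_swap_ennreal:
  fixes f :: "nat \<Rightarrow> nat \<Rightarrow> ennreal"
  shows "(\<Sum>i. \<Sum>k. f i k) = (\<Sum>k. \<Sum>i. f i k)"
proof -
  have "(\<Sum>i. \<Sum>k. f i k) = (\<integral>\<^sup>+i. (\<Sum>k. f i k) \<partial>count_space UNIV)"
    by (rule nn_integral_count_space_nat[symmetric])
  also have "\<dots> = (\<Sum>k. \<integral>\<^sup>+i. f i k \<partial>count_space UNIV)"
    by (rule nn_integral_suminf) simp
  finally show ?thesis by (simp add: nn_integral_count_space_nat)
qed

lemma suminf_single_ennreal:
  fixes f :: "nat \<Rightarrow> ennreal"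
  assumes "\<And>i. i \<noteq> n \<Longrightarrow> f i = 0"
  shows "(\<Sum>i. f i) = f n"
  using suminf_finite[of "{n}" f] assms by simp

text \<open>The permanent of the directions at the points of a configuration, encoded as a mixed
  derivative at zero. It vanishes on configurations of any size other than \<open>n\<close>, and its
  expectation is a symmetrized product moment.\<close>

definition perm_prod :: "(nat \<Rightarrow> 'a \<Rightarrow> real) \<Rightarrow> nat \<Rightarrow> 'a multiset \<Rightarrow> real" where
  "perm_prod \<eta> n = dprod (map \<eta> [1..<Suc n]) (\<lambda>_. 0)"

lemma test_directions_nonneg:
  "test_directions \<nu> n \<eta> \<Longrightarrow> i \<in> {1..n} \<Longrightarrow> x \<in> space \<nu> \<Longrightarrow> 0 \<le> \<eta> i x"
  unfolding test_directions_def by blast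

lemma perm_prod_meas:
  "test_directions \<nu> n \<eta> \<Longrightarrow> perm_prod \<eta> n \<in> borel_measurable (configs \<nu>)"
  unfolding perm_prod_def by (rule borel_measurable_dprod) (auto simp: test_directions_def)

lemma perm_prod_nonneg:
  "test_directions \<nu> n \<eta> \<Longrightarrow> \<phi> \<in> space (configs \<nu>) \<Longrightarrow> 0 \<le> perm_prod \<eta> n \<phi>"
  unfolding perm_prod_def by (rule dprod_nonneg) (auto intro!: test_directions_nonneg[of \<nu> n \<eta>] simp: space_configs)

lemma perm_prod_size: "size \<phi> \<noteq> n \<Longrightarrow> perm_prod \<eta> n \<phi> = 0"
  unfolding perm_prod_def by (rule dprod_zero_size) simp

lemma test_directions_bound:
  assumes "test_directions \<nu> n \<eta>"
  shows "\<exists>B\<ge>0. \<forall>i\<in>{1..n}. \<forall>x\<in>space \<nu>. \<bar>\<eta> i x\<bar> \<le> B"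
proof -
  have "\<forall>i\<in>{1..n}. \<exists>B. \<forall>x\<in>space \<nu>. 0 \<le> \<eta> i x \<and> \<eta> i x \<le> B"
    using assms by (auto simp: test_directions_def)
  then obtain b where b: "\<forall>i\<in>{1..n}. \<forall>x\<in>space \<nu>. 0 \<le> \<eta> i x \<and> \<eta> i x \<le> b i"
    unfolding bchoice_iff by blast
  show ?thesis
  proof (intro exI[of _ "\<Sum>i=1..n. \<bar>b i\<bar>"] conjI ballI)
    fix i x assume i: "i \<in> {1..n}" and x: "x \<in> space \<nu>"
    have "\<bar>\<eta> i x\<bar> \<le> \<bar>b i\<bar>" using b i x by force
    also have "\<dots> \<le> (\<Sum>i=1..n. \<bar>b i\<bar>)" using i by (intro member_le_sum) auto
    finally show "\<bar>\<eta> i x\<bar> \<le> (\<Sum>i=1..n. \<bar>b i\<bar>)" .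
  qed (simp add: sum_nonneg)
qed

lemma perm_prod_bounded:
  assumes "test_directions \<nu> n \<eta>"
  shows "\<exists>C\<ge>0. \<forall>\<phi>\<in>space (configs \<nu>). \<bar>perm_prod \<eta> n \<phi>\<bar> \<le> C"
proof -
  obtain B where B: "0 \<le> B" "\<forall>i\<in>{1..n}. \<forall>x\<in>space \<nu>. \<bar>\<eta> i x\<bar> \<le> B"
    using test_directions_bound[OF assms] by blast
  have "\<bar>perm_prod \<eta> n \<phi>\<bar> \<le> B ^ n * real n ^ n" if \<phi>: "\<phi> \<in> space (configs \<nu>)" for \<phi>
  proof (cases "size \<phi> = n")
    case True
    \<comment> \<open>The general bound is taken with \<open>r = 0\<close> at size exactly
      \<open>n\<close>, where the last factor is \<open>0 ^ 0 = 1\<close>.\<close>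
    have "\<bar>perm_prod \<eta> n \<phi>\<bar> \<le> B ^ length (map \<eta> [1..<Suc n]) *
        (real (size \<phi>) ^ length (map \<eta> [1..<Suc n]) * 0 ^ (size \<phi> - length (map \<eta> [1..<Suc n])))"
      using B \<phi> unfolding perm_prod_def by (intro dprod_bound) (auto simp: space_configs)
    then show ?thesis using True by simp
  next
    case False
    then show ?thesis using B(1) by (simp add: perm_prod_size[OF False])
  qed
  then show ?thesis using B(1) by (intro exI[of _ "B ^ n * real n ^ n"]) simp
qed

lemma test_directions_indicator:
  "(\<And>i. i \<in> {1..n} \<Longrightarrow> A i \<in> sets \<nu>) \<Longrightarrow> test_directions \<nu> n (\<lambda>i. indicator (A i))"
  unfolding test_directions_def by (auto intro!: exI[of _ 1] simp: indicator_def)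

lemma test_directions_one: "test_directions \<nu> n (\<lambda>_ _. 1)"
  unfolding test_directions_def by (auto intro!: exI[of _ 1])

text \<open>The symmetrization is undone in one group of variables at a time; Fubini's theorem
  brings the other group to the inside in between.\<close>

lemma nn_integral_perm_prod_pair:
  fixes f :: "(nat \<Rightarrow> 'a) \<times> (nat \<Rightarrow> 'a) \<Rightarrow> ennreal"
  assumes \<nu>: "sigma_finite_measure \<nu>"
    and \<eta>: "test_directions \<nu> n \<eta>" and \<theta>: "test_directions \<nu> m \<theta>"
    and f [measurable]: "f \<in> borel_measurable (tuples \<nu> n \<Otimes>\<^sub>M tuples \<nu> m)"
    and sym_x: "\<And>z. z \<in> space (tuples \<nu> m) \<Longrightarrow> symmetric_on_tuples \<nu> n (\<lambda>x. f (x, z))"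
    and sym_z: "\<And>x. x \<in> space (tuples \<nu> n) \<Longrightarrow> symmetric_on_tuples \<nu> m (\<lambda>z. f (x, z))"
  shows "(\<integral>\<^sup>+w. ennreal (perm_prod \<eta> n (config_of n (fst w))) * (ennreal (perm_prod \<theta> m (config_of m (snd w))) * f w)
      \<partial>(tuples \<nu> n \<Otimes>\<^sub>M tuples \<nu> m)) =
    fact n * (fact m * (\<integral>\<^sup>+w. ennreal ((\<Prod>i=1..n. \<eta> i (fst w i)) * (\<Prod>k=1..m. \<theta> k (snd w k))) * f w \<partial>(tuples \<nu> n \<Otimes>\<^sub>M tuples \<nu> m)))"
proof -
  interpret X: sigma_finite_measure "tuples \<nu> n" by (rule sigma_finite_tuples[OF \<nu>])
  interpret Z: sigma_finite_measure "tuples \<nu> m" by (rule sigma_finite_tuples[OF \<nu>])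
  interpret XZ: pair_sigma_finite "tuples \<nu> n" "tuples \<nu> m" ..
  note [measurable] = perm_prod_meas[OF \<eta>] perm_prod_meas[OF \<theta>]
  have \<eta>_meas [measurable]: "\<eta> i \<in> borel_measurable \<nu>" if "i \<in> {1..n}" for i
    using \<eta> that by (auto simp: test_directions_def)
  have \<theta>_meas [measurable]: "\<theta> i \<in> borel_measurable \<nu>" if "i \<in> {1..m}" for i
    using \<theta> that by (auto simp: test_directions_def)
  define a where "a x = ennreal (perm_prod \<eta> n (config_of n x))" for x
  define a' where "a' x = ennreal (\<Prod>i=1..n. \<eta> i (x i))" for x
  define b where "b z = ennreal (perm_prod \<theta> m (config_of m z))" for z
  define b' where "b' z = ennreal (\<Prod>k=1..m. \<theta> k (z k))" for z
  have [measurable]: "a \<in> borel_measurable (tuples \<nu> n)" "b \<in> borel_measurable (tuples \<nu> m)"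
    unfolding a_def b_def by measurable
  have [measurable]: "a' \<in> borel_measurable (tuples \<nu> n)"
    unfolding a'_def by measurable
  have [measurable]: "b' \<in> borel_measurable (tuples \<nu> m)"
    unfolding b'_def by measurable
  have fz: "(\<lambda>z. f (x, z)) \<in> borel_measurable (tuples \<nu> m)" if "x \<in> space (tuples \<nu> n)" for x
    using that by measurable
  have fx: "(\<lambda>x. f (x, z)) \<in> borel_measurable (tuples \<nu> n)" if "z \<in> space (tuples \<nu> m)" for z
    using that by measurable
  have m1: "(\<lambda>w. a (fst w) * (b (snd w) * f w)) \<in> borel_measurable (tuples \<nu> n \<Otimes>\<^sub>M tuples \<nu> m)"
    "(\<lambda>w. a (fst w) * (b' (snd w) * f w)) \<in> borel_measurable (tuples \<nu> n \<Otimes>\<^sub>M tuples \<nu> m)"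
    "(\<lambda>w. a' (fst w) * (b' (snd w) * f w)) \<in> borel_measurable (tuples \<nu> n \<Otimes>\<^sub>M tuples \<nu> m)"
    by measurable
  have m2: "(\<lambda>x. \<integral>\<^sup>+z. a x * (b' z * f (x, z)) \<partial>tuples \<nu> m) \<in> borel_measurable (tuples \<nu> n)"
    by measurable
  have m3: "(\<lambda>z. \<integral>\<^sup>+x. a' x * (b' z * f (x, z)) \<partial>tuples \<nu> n) \<in> borel_measurable (tuples \<nu> m)"
    by measurable
  have "(\<integral>\<^sup>+w. a (fst w) * (b (snd w) * f w) \<partial>(tuples \<nu> n \<Otimes>\<^sub>M tuples \<nu> m)) =
      (\<integral>\<^sup>+x. \<integral>\<^sup>+z. a x * (b z * f (x, z)) \<partial>tuples \<nu> m \<partial>tuples \<nu> n)"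
    using Z.nn_integral_fst[OF m1(1)] by simp
  also have "\<dots> = (\<integral>\<^sup>+x. fact m * (\<integral>\<^sup>+z. a x * (b' z * f (x, z)) \<partial>tuples \<nu> m) \<partial>tuples \<nu> n)"
  proof (intro nn_integral_cong)
    fix x assume x: "x \<in> space (tuples \<nu> n)"
    note [measurable] = fz[OF x]
    have "(\<integral>\<^sup>+z. a x * (b z * f (x, z)) \<partial>tuples \<nu> m) = a x * (\<integral>\<^sup>+z. b z * f (x, z) \<partial>tuples \<nu> m)"
      by (rule nn_integral_cmult) measurable
    also have "(\<integral>\<^sup>+z. b z * f (x, z) \<partial>tuples \<nu> m) = fact m * (\<integral>\<^sup>+z. b' z * f (x, z) \<partial>tuples \<nu> m)"
      unfolding b_def b'_def perm_prod_def by (rule nn_integral_dprod_config_of[OF \<nu> \<theta> fz[OF x] sym_z[OF x]])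
    also have "a x * (fact m * (\<integral>\<^sup>+z. b' z * f (x, z) \<partial>tuples \<nu> m)) = fact m * (a x * (\<integral>\<^sup>+z. b' z * f (x, z) \<partial>tuples \<nu> m))"
      by (rule mult.left_commute)
    also have "a x * (\<integral>\<^sup>+z. b' z * f (x, z) \<partial>tuples \<nu> m) = (\<integral>\<^sup>+z. a x * (b' z * f (x, z)) \<partial>tuples \<nu> m)"
      by (rule nn_integral_cmult[symmetric]) measurable
    finally show "(\<integral>\<^sup>+z. a x * (b z * f (x, z)) \<partial>tuples \<nu> m) = fact m * (\<integral>\<^sup>+z. a x * (b' z * f (x, z)) \<partial>tuples \<nu> m)" .
  qed
  also have "\<dots> = fact m * (\<integral>\<^sup>+x. \<integral>\<^sup>+z. a x * (b' z * f (x, z)) \<partial>tuples \<nu> m \<partial>tuples \<nu> n)"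
    by (rule nn_integral_cmult[OF m2])
  also have "(\<integral>\<^sup>+x. \<integral>\<^sup>+z. a x * (b' z * f (x, z)) \<partial>tuples \<nu> m \<partial>tuples \<nu> n) =
      (\<integral>\<^sup>+z. \<integral>\<^sup>+x. a x * (b' z * f (x, z)) \<partial>tuples \<nu> n \<partial>tuples \<nu> m)"
    using XZ.Fubini[OF m1(2)] by simp
  also have "\<dots> = (\<integral>\<^sup>+z. fact n * (\<integral>\<^sup>+x. a' x * (b' z * f (x, z)) \<partial>tuples \<nu> n) \<partial>tuples \<nu> m)"
  proof (intro nn_integral_cong)
    fix z assume z: "z \<in> space (tuples \<nu> m)"
    note [measurable] = fx[OF z]
    show "(\<integral>\<^sup>+x. a x * (b' z * f (x, z)) \<partial>tuples \<nu> n) = fact n * (\<integral>\<^sup>+x. a' x * (b' z * f (x, z)) \<partial>tuples \<nu> n)"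
      unfolding a_def a'_def perm_prod_def
    proof (rule nn_integral_dprod_config_of[OF \<nu> \<eta>])
      show "symmetric_on_tuples \<nu> n (\<lambda>x. b' z * f (x, z))"
        using sym_x[OF z] by (auto simp: symmetric_on_tuples_def)
    qed measurable
  qed
  also have "\<dots> = fact n * (\<integral>\<^sup>+z. \<integral>\<^sup>+x. a' x * (b' z * f (x, z)) \<partial>tuples \<nu> n \<partial>tuples \<nu> m)"
    by (rule nn_integral_cmult[OF m3])
  also have "(\<integral>\<^sup>+z. \<integral>\<^sup>+x. a' x * (b' z * f (x, z)) \<partial>tuples \<nu> n \<partial>tuples \<nu> m) =
      (\<integral>\<^sup>+w. a' (fst w) * (b' (snd w) * f w) \<partial>(tuples \<nu> n \<Otimes>\<^sub>M tuples \<nu> m))"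
    using XZ.nn_integral_snd[OF m1(3)] by simp
  also have "\<dots> = (\<integral>\<^sup>+w. ennreal ((\<Prod>i=1..n. \<eta> i (fst w i)) * (\<Prod>k=1..m. \<theta> k (snd w k))) * f w \<partial>(tuples \<nu> n \<Otimes>\<^sub>M tuples \<nu> m))"
  proof (intro nn_integral_cong)
    fix w assume "w \<in> space (tuples \<nu> n \<Otimes>\<^sub>M tuples \<nu> m)"
    then have w: "fst w \<in> space (tuples \<nu> n)" "snd w \<in> space (tuples \<nu> m)"
      by (auto simp: space_pair_measure)
    have "0 \<le> (\<Prod>i=1..n. \<eta> i (fst w i))" "0 \<le> (\<Prod>k=1..m. \<theta> k (snd w k))"
      using w by (auto intro!: prod_nonneg test_directions_nonneg[OF \<eta>] test_directions_nonneg[OF \<theta>] simp: space_PiM)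
    then show "a' (fst w) * (b' (snd w) * f w) =
        ennreal ((\<Prod>i=1..n. \<eta> i (fst w i)) * (\<Prod>k=1..m. \<theta> k (snd w k))) * f w"
      by (simp add: a'_def b'_def ennreal_mult mult.assoc)
  qed
  finally show ?thesis unfolding a_def b_def by (simp only: mult_ac)
qed

context observed_process
begin

abbreviation obs :: "nat \<Rightarrow> (nat \<Rightarrow> 'a) \<Rightarrow> ennreal" where
  "obs \<equiv> observation_formula \<nu> j q lt lc"

text \<open>On tuples of points of the space the formula is a series of integrals of the joint
  formula, whose measurability is known.\<close>

lemma obs_meas [measurable]: "obs m \<in> borel_measurable (tuples \<nu> m)"
proof -
  interpret X: sigma_finite_measure "tuples \<nu> n" for n by (rule sigma_finite_tuples[OF sf])
  have "(\<lambda>z. \<integral>\<^sup>+x. ennreal (jf n m x z) \<partial>tuples \<nu> n) \<in> borel_measurable (tuples \<nu> m)" for n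
  proof (rule X.borel_measurable_nn_integral)
    have "(\<lambda>w. jf n m (snd w) (fst w)) \<in> borel_measurable (tuples \<nu> m \<Otimes>\<^sub>M tuples \<nu> n)"
      using measurable_compose[OF measurable_pair_swap' jf_meas'] by (simp add: case_prod_beta)
    then show "(\<lambda>(z, x). ennreal (jf n m x z)) \<in> borel_measurable (tuples \<nu> m \<Otimes>\<^sub>M tuples \<nu> n)"
      unfolding case_prod_beta by measurable
  qed
  then have "(\<lambda>z. \<Sum>n. ennreal (1 / fact n) * (\<integral>\<^sup>+x. ennreal (jf n m x z) \<partial>tuples \<nu> n)) \<in> borel_measurable (tuples \<nu> m)"
    by measurable
  then show ?thesis
    by (rule iffD1[OF measurable_cong, rotated]) (rule suminf_integral_jf)
qed

lemma obs_sym: "symmetric_on_tuples \<nu> m (obs m)"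
  unfolding symmetric_on_tuples_def
proof (intro allI impI ballI)
  fix \<sigma> z assume \<sigma>: "\<sigma> permutes {1..m}" and z: "z \<in> space (tuples \<nu> m)"
  show "obs m (z \<circ> \<sigma>) = obs m z"
    unfolding suminf_integral_jf[OF z, symmetric] suminf_integral_jf[OF comp_permutes_in_tuples[OF \<sigma> z], symmetric]
      jf_permute_z[OF \<sigma>] ..
qed

text \<open>The joint law with the observations outermost. The inner series over \<open>n\<close> is
  the unnormalized posterior mean of \<open>F\<close> given \<open>z\<close>; for
  \<open>F = 1\<close> it is the observation formula.\<close>

lemma nn_integral_observed:
  assumes F [measurable]: "F \<in> borel_measurable (configs \<nu>)" and G [measurable]: "G \<in> borel_measurable (configs \<nu>)"
  shows "(\<integral>\<^sup>+\<omega>. G (\<Xi> \<omega>) * F (\<Phi> \<omega>) \<partial>P) =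
    (\<Sum>m. ennreal (1 / fact m) * (\<integral>\<^sup>+z. G (config_of m z) *
      (\<Sum>n. ennreal (1 / fact n) * (\<integral>\<^sup>+x. F (config_of n x) * ennreal (jf n m x z) \<partial>tuples \<nu> n)) \<partial>tuples \<nu> m))"
proof -
  interpret X: sigma_finite_measure "tuples \<nu> n" for n by (rule sigma_finite_tuples[OF sf])
  interpret XZ: pair_sigma_finite "tuples \<nu> n" "tuples \<nu> m" for n m ..
  define I where "I n m z = (\<integral>\<^sup>+x. F (config_of n x) * ennreal (jf n m x z) \<partial>tuples \<nu> n)" for n m z
  have Fjf: "(\<lambda>w. F (config_of n (fst w)) * ennreal (jf n m (fst w) (snd w))) \<in> borel_measurable (tuples \<nu> n \<Otimes>\<^sub>M tuples \<nu> m)" for n m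
    by measurable
  have I_meas [measurable]: "I n m \<in> borel_measurable (tuples \<nu> m)" for n m
    unfolding I_def
  proof (rule X.borel_measurable_nn_integral)
    show "(\<lambda>(z, x). F (config_of n x) * ennreal (jf n m x z)) \<in> borel_measurable (tuples \<nu> m \<Otimes>\<^sub>M tuples \<nu> n)"
      using measurable_compose[OF measurable_pair_swap' Fjf] by (simp add: case_prod_beta)
  qed
  have "(\<lambda>w. G (snd w) * F (fst w)) \<in> borel_measurable (configs \<nu> \<Otimes>\<^sub>M configs \<nu>)" by measurable
  note law = nn_integral_joint_law[OF this] nn_integral_component[OF this]
  have comp: "(\<integral>\<^sup>+w. G (snd w) * F (fst w) \<partial>component n m) =
      ennreal (1 / fact m) * (\<integral>\<^sup>+z. ennreal (1 / fact n) * (G (config_of m z) * I n m z) \<partial>tuples \<nu> m)" for n m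
  proof -
    have GF: "(\<lambda>w. G (config_of m (snd w)) * (F (config_of n (fst w)) * ennreal (jf n m (fst w) (snd w))))
        \<in> borel_measurable (tuples \<nu> n \<Otimes>\<^sub>M tuples \<nu> m)" by measurable
    have "(\<integral>\<^sup>+w. G (config_of m (snd w)) * (F (config_of n (fst w)) * ennreal (jf n m (fst w) (snd w))) \<partial>(tuples \<nu> n \<Otimes>\<^sub>M tuples \<nu> m)) =
        (\<integral>\<^sup>+z. \<integral>\<^sup>+x. G (config_of m z) * (F (config_of n x) * ennreal (jf n m x z)) \<partial>tuples \<nu> n \<partial>tuples \<nu> m)"
      using XZ.nn_integral_snd[OF GF] by simp
    also have "\<dots> = (\<integral>\<^sup>+z. G (config_of m z) * I n m z \<partial>tuples \<nu> m)"
    proof (intro nn_integral_cong)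
      fix z assume z: "z \<in> space (tuples \<nu> m)"
      note [measurable] = jf_meas_x[OF z]
      show "(\<integral>\<^sup>+x. G (config_of m z) * (F (config_of n x) * ennreal (jf n m x z)) \<partial>tuples \<nu> n) = G (config_of m z) * I n m z"
        unfolding I_def by (rule nn_integral_cmult) measurable
    qed
    finally have *: "(\<integral>\<^sup>+w. G (config_of m (snd w)) * (F (config_of n (fst w)) * ennreal (jf n m (fst w) (snd w))) \<partial>(tuples \<nu> n \<Otimes>\<^sub>M tuples \<nu> m)) =
        (\<integral>\<^sup>+z. G (config_of m z) * I n m z \<partial>tuples \<nu> m)" .
    have "(\<integral>\<^sup>+w. G (snd w) * F (fst w) \<partial>component n m) =
        ennreal (1 / fact m) * (ennreal (1 / fact n) * (\<integral>\<^sup>+z. G (config_of m z) * I n m z \<partial>tuples \<nu> m))"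
      unfolding law(2) fst_conv snd_conv mult.assoc[of "G _"] * by (rule mult.left_commute)
    also have "ennreal (1 / fact n) * (\<integral>\<^sup>+z. G (config_of m z) * I n m z \<partial>tuples \<nu> m) =
        (\<integral>\<^sup>+z. ennreal (1 / fact n) * (G (config_of m z) * I n m z) \<partial>tuples \<nu> m)"
      by (rule nn_integral_cmult[symmetric]) measurable
    finally show ?thesis .
  qed
  have "(\<integral>\<^sup>+\<omega>. G (\<Xi> \<omega>) * F (\<Phi> \<omega>) \<partial>P) = (\<Sum>m. \<Sum>n. \<integral>\<^sup>+w. G (snd w) * F (fst w) \<partial>component n m)"
    using law(1) unfolding suminf_swap_ennreal[of "\<lambda>m n. \<integral>\<^sup>+w. G (snd w) * F (fst w) \<partial>component n m"] by simp
  also have "\<dots> = (\<Sum>m. ennreal (1 / fact m) * (\<Sum>n. \<integral>\<^sup>+z. ennreal (1 / fact n) * (G (config_of m z) * I n m z) \<partial>tuples \<nu> m))"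
    unfolding comp by (simp only: ennreal_suminf_cmult)
  also have "\<dots> = (\<Sum>m. ennreal (1 / fact m) * (\<integral>\<^sup>+z. (\<Sum>n. ennreal (1 / fact n) * (G (config_of m z) * I n m z)) \<partial>tuples \<nu> m))"
    by (subst nn_integral_suminf) measurable
  also have "\<dots> = (\<Sum>m. ennreal (1 / fact m) * (\<integral>\<^sup>+z. G (config_of m z) * (\<Sum>n. ennreal (1 / fact n) * I n m z) \<partial>tuples \<nu> m))"
    by (simp only: ennreal_suminf_cmult[symmetric] mult.left_commute)
  finally show ?thesis unfolding I_def .
qed

lemma nn_integral_observation:
  assumes G [measurable]: "G \<in> borel_measurable (configs \<nu>)"
  shows "(\<integral>\<^sup>+\<omega>. G (\<Xi> \<omega>) \<partial>P) = (\<Sum>m. ennreal (1 / fact m) * (\<integral>\<^sup>+z. G (config_of m z) * obs m z \<partial>tuples \<nu> m))"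
proof -
  have "(\<integral>\<^sup>+\<omega>. G (\<Xi> \<omega>) \<partial>P) = (\<integral>\<^sup>+\<omega>. G (\<Xi> \<omega>) * 1 \<partial>P)" by simp
  also have "\<dots> = (\<Sum>m. ennreal (1 / fact m) * (\<integral>\<^sup>+z. G (config_of m z) *
      (\<Sum>n. ennreal (1 / fact n) * (\<integral>\<^sup>+x. 1 * ennreal (jf n m x z) \<partial>tuples \<nu> n)) \<partial>tuples \<nu> m))"
    by (rule nn_integral_observed) measurable
  also have "\<dots> = (\<Sum>m. ennreal (1 / fact m) * (\<integral>\<^sup>+z. G (config_of m z) * obs m z \<partial>tuples \<nu> m))"
    by (intro suminf_cong arg_cong2[of _ _ _ _ "(*)"] refl nn_integral_cong)
       (simp only: mult_1 suminf_integral_jf)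
  finally show ?thesis .
qed

lemma jf_pair_sym:
  "z \<in> space (tuples \<nu> m) \<Longrightarrow> symmetric_on_tuples \<nu> n (\<lambda>x. ennreal (jf n m x z))"
  "x \<in> space (tuples \<nu> n) \<Longrightarrow> symmetric_on_tuples \<nu> m (\<lambda>z. ennreal (jf n m x z))"
  by (auto simp: symmetric_on_tuples_def jf_permute_x jf_permute_z)

text \<open>Only the component with exactly \<open>n\<close> hidden points and \<open>m\<close>
  observations survives, since permanents vanish at other sizes. Its factors
  \<open>1 / fact n\<close> and \<open>1 / fact m\<close> cancel the factorials of the
  desymmetrization.\<close>

lemma nn_integral_perm_prod_joint:
  assumes \<eta>: "test_directions \<nu> n \<eta>" and \<theta>: "test_directions \<nu> m \<theta>"
  shows "(\<integral>\<^sup>+\<omega>. ennreal (perm_prod \<eta> n (\<Phi> \<omega>)) * ennreal (perm_prod \<theta> m (\<Xi> \<omega>)) \<partial>P) =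
    (\<integral>\<^sup>+w. ennreal ((\<Prod>i=1..n. \<eta> i (fst w i)) * (\<Prod>k=1..m. \<theta> k (snd w k))) * ennreal (jf n m (fst w) (snd w)) \<partial>(tuples \<nu> n \<Otimes>\<^sub>M tuples \<nu> m))"
proof -
  note [measurable] = perm_prod_meas[OF \<eta>] perm_prod_meas[OF \<theta>]
  define F where "F w = ennreal (perm_prod \<eta> n (fst w)) * ennreal (perm_prod \<theta> m (snd w))" for w :: "'a multiset \<times> 'a multiset"
  have F: "F \<in> borel_measurable (configs \<nu> \<Otimes>\<^sub>M configs \<nu>)" unfolding F_def by measurable
  have F0: "(\<integral>\<^sup>+w. F w \<partial>component n' m') = 0" if "n' \<noteq> n \<or> m' \<noteq> m" for n' m'
  proof -
    have "F (config_of n' (fst w), config_of m' (snd w)) = 0" for w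
      unfolding F_def fst_conv snd_conv using that perm_prod_size size_config_of by (metis ennreal_0 mult_zero_left mult_zero_right)
    then show ?thesis by (simp add: nn_integral_component[OF F])
  qed
  have "(\<integral>\<^sup>+\<omega>. F (\<Phi> \<omega>, \<Xi> \<omega>) \<partial>P) = (\<Sum>n. \<Sum>m. \<integral>\<^sup>+w. F w \<partial>component n m)"
    by (rule nn_integral_joint_law[OF F])
  also have "\<dots> = (\<Sum>m. \<integral>\<^sup>+w. F w \<partial>component n m)"
    by (rule suminf_single_ennreal) (simp add: F0)
  also have "\<dots> = (\<integral>\<^sup>+w. F w \<partial>component n m)"
    by (rule suminf_single_ennreal) (simp add: F0)
  also have "\<dots> = ennreal (1 / fact n) * (ennreal (1 / fact m) *
      (\<integral>\<^sup>+w. ennreal (perm_prod \<eta> n (config_of n (fst w))) * (ennreal (perm_prod \<theta> m (config_of m (snd w))) * ennreal (jf n m (fst w) (snd w)))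
        \<partial>(tuples \<nu> n \<Otimes>\<^sub>M tuples \<nu> m)))"
    unfolding nn_integral_component[OF F] unfolding F_def fst_conv snd_conv mult.assoc ..
  also have "(\<integral>\<^sup>+w. ennreal (perm_prod \<eta> n (config_of n (fst w))) * (ennreal (perm_prod \<theta> m (config_of m (snd w))) * ennreal (jf n m (fst w) (snd w)))
        \<partial>(tuples \<nu> n \<Otimes>\<^sub>M tuples \<nu> m)) =
      fact n * (fact m * (\<integral>\<^sup>+w. ennreal ((\<Prod>i=1..n. \<eta> i (fst w i)) * (\<Prod>k=1..m. \<theta> k (snd w k))) * ennreal (jf n m (fst w) (snd w)) \<partial>(tuples \<nu> n \<Otimes>\<^sub>M tuples \<nu> m)))"
    by (rule nn_integral_perm_prod_pair[OF sf \<eta> \<theta>]) (auto simp: jf_pair_sym)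
  also have "ennreal (1 / fact n) * (ennreal (1 / fact m) * (fact n * (fact m * X))) = X" for X
  proof -
    have 1: "ennreal (1 / fact k) * fact k = 1" for k
      by (simp add: ennreal_fact[symmetric] ennreal_mult[symmetric])
    have "ennreal (1 / fact n) * (ennreal (1 / fact m) * (fact n * (fact m * X))) =
        (ennreal (1 / fact n) * fact n) * ((ennreal (1 / fact m) * fact m) * X)"
      by (simp only: mult_ac)
    then show ?thesis by (simp add: 1)
  qed
  finally show ?thesis by (simp add: F_def)
qed

lemma nn_integral_perm_prod_obs:
  assumes \<theta>: "test_directions \<nu> m \<theta>"
  shows "(\<integral>\<^sup>+\<omega>. ennreal (perm_prod \<theta> m (\<Xi> \<omega>)) \<partial>P) =
    (\<integral>\<^sup>+z. ennreal (\<Prod>k=1..m. \<theta> k (z k)) * obs m z \<partial>tuples \<nu> m)"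
proof -
  note [measurable] = perm_prod_meas[OF \<theta>]
  have "(\<integral>\<^sup>+\<omega>. ennreal (perm_prod \<theta> m (\<Xi> \<omega>)) \<partial>P) =
      (\<Sum>m'. ennreal (1 / fact m') * (\<integral>\<^sup>+z. ennreal (perm_prod \<theta> m (config_of m' z)) * obs m' z \<partial>tuples \<nu> m'))"
    by (rule nn_integral_observation) measurable
  also have "\<dots> = ennreal (1 / fact m) * (\<integral>\<^sup>+z. ennreal (perm_prod \<theta> m (config_of m z)) * obs m z \<partial>tuples \<nu> m)"
    by (rule suminf_single_ennreal) (simp add: perm_prod_size)
  also have "\<dots> = ennreal (1 / fact m) * (fact m * (\<integral>\<^sup>+z. ennreal (\<Prod>k=1..m. \<theta> k (z k)) * obs m z \<partial>tuples \<nu> m))"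
    unfolding perm_prod_def by (simp only: nn_integral_dprod_config_of[OF sf \<theta> obs_meas obs_sym])
  also have "\<dots> = (\<integral>\<^sup>+z. ennreal (\<Prod>k=1..m. \<theta> k (z k)) * obs m z \<partial>tuples \<nu> m)"
    unfolding mult.assoc[symmetric] by (simp add: ennreal_fact[symmetric] ennreal_mult[symmetric])
  finally show ?thesis .
qed

end

section \<open>Densities recovered from derivatives at zero\<close>

section \<open>Characterization of the three densities\<close>

lemma AE_tuples_swap:
  fixes f g :: "(nat \<Rightarrow> 'a) \<times> (nat \<Rightarrow> 'a) \<Rightarrow> ennreal"
  assumes \<nu>: "sigma_finite_measure \<nu>"
    and [measurable]: "f \<in> borel_measurable (tuples \<nu> n \<Otimes>\<^sub>M tuples \<nu> m)" "g \<in> borel_measurable (tuples \<nu> n \<Otimes>\<^sub>M tuples \<nu> m)"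
    and AE: "AE w in tuples \<nu> n \<Otimes>\<^sub>M tuples \<nu> m. f w = g w"
  shows "AE z in tuples \<nu> m. AE x in tuples \<nu> n. f (x, z) = g (x, z)"
proof -
  interpret X: sigma_finite_measure "tuples \<nu> n" by (rule sigma_finite_tuples[OF \<nu>])
  interpret Z: sigma_finite_measure "tuples \<nu> m" by (rule sigma_finite_tuples[OF \<nu>])
  interpret XZ: pair_sigma_finite "tuples \<nu> n" "tuples \<nu> m" ..
  have "AE x in tuples \<nu> n. AE z in tuples \<nu> m. f (x, z) = g (x, z)"
    by (rule XZ.AE_pair[OF AE])
  moreover have "{w \<in> space (tuples \<nu> n \<Otimes>\<^sub>M tuples \<nu> m). f (fst w, snd w) = g (fst w, snd w)} \<in> sets (tuples \<nu> n \<Otimes>\<^sub>M tuples \<nu> m)"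
    by measurable
  ultimately show ?thesis
    using XZ.AE_commute[of "\<lambda>x z. f (x, z) = g (x, z)"] by simp
qed

lemma ennreal_divide_eq_iff:
  fixes a k l :: ennreal
  assumes "k \<noteq> 0" "k \<noteq> \<infinity>"
  shows "l = a / k \<longleftrightarrow> a = l * k"
proof -
  have k: "k / k = 1"
    using assms by (intro ennreal_divide_self) (auto simp: less_top)
  show ?thesis
  proof
    assume "l = a / k"
    then have "l * k = a * (k / k)"
      by (simp add: ennreal_times_divide mult.commute)
    then show "a = l * k" by (simp add: k)
  next
    assume "a = l * k"
    then have "a / k = l * (k / k)"
      by (simp add: ennreal_times_divide)
    then show "l = a / k" by (simp add: k)
  qed
qed

context observed_process
begin

lemma \<Phi>_space: "\<omega> \<in> space P \<Longrightarrow> \<Phi> \<omega> \<in> space (configs \<nu>)"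
  by (rule measurable_space[OF \<Phi>_meas])

lemma \<Xi>_space: "\<omega> \<in> space P \<Longrightarrow> \<Xi> \<omega> \<in> space (configs \<nu>)"
  by (rule measurable_space[OF \<Xi>_meas])

definition joint_moment :: "nat \<Rightarrow> nat \<Rightarrow> (nat \<Rightarrow> 'a \<Rightarrow> real) \<Rightarrow> (nat \<Rightarrow> 'a \<Rightarrow> real) \<Rightarrow> ennreal" where
  "joint_moment n m \<eta> \<theta> = (\<integral>\<^sup>+\<omega>. ennreal (perm_prod \<eta> n (\<Phi> \<omega>)) * ennreal (perm_prod \<theta> m (\<Xi> \<omega>)) \<partial>P)"

definition obs_moment :: "nat \<Rightarrow> (nat \<Rightarrow> 'a \<Rightarrow> real) \<Rightarrow> ennreal" where
  "obs_moment m \<theta> = (\<integral>\<^sup>+\<omega>. ennreal (perm_prod \<theta> m (\<Xi> \<omega>)) \<partial>P)"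

lemma joint_moment_finite:
  assumes \<eta>: "test_directions \<nu> n \<eta>" and \<theta>: "test_directions \<nu> m \<theta>"
  shows "joint_moment n m \<eta> \<theta> < \<infinity>"
proof -
  obtain C where C: "0 \<le> C" "\<forall>\<phi>\<in>space (configs \<nu>). \<bar>perm_prod \<eta> n \<phi>\<bar> \<le> C"
    using perm_prod_bounded[OF \<eta>] by blast
  obtain C' where C': "0 \<le> C'" "\<forall>\<phi>\<in>space (configs \<nu>). \<bar>perm_prod \<theta> m \<phi>\<bar> \<le> C'"
    using perm_prod_bounded[OF \<theta>] by blast
  have "joint_moment n m \<eta> \<theta> \<le> (\<integral>\<^sup>+\<omega>. ennreal C * ennreal C' \<partial>P)"
    unfolding joint_moment_def
  proof (intro nn_integral_mono mult_mono ennreal_leI)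
    fix \<omega> assume \<omega>: "\<omega> \<in> space P"
    show "perm_prod \<eta> n (\<Phi> \<omega>) \<le> C" "perm_prod \<theta> m (\<Xi> \<omega>) \<le> C'"
      using C(2)[rule_format, OF \<Phi>_space[OF \<omega>]] C'(2)[rule_format, OF \<Xi>_space[OF \<omega>]] by auto
  qed auto
  also have "\<dots> < \<infinity>"
    using emeasure_space_1 by (simp add: ennreal_mult[symmetric] C(1) C'(1) ennreal_mult_less_top)
  finally show ?thesis .
qed

lemma obs_moment_finite:
  assumes \<theta>: "test_directions \<nu> m \<theta>"
  shows "obs_moment m \<theta> < \<infinity>"
proof -
  obtain C' where C': "0 \<le> C'" "\<forall>\<phi>\<in>space (configs \<nu>). \<bar>perm_prod \<theta> m \<phi>\<bar> \<le> C'"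
    using perm_prod_bounded[OF \<theta>] by blast
  have "obs_moment m \<theta> \<le> (\<integral>\<^sup>+\<omega>. ennreal C' \<partial>P)"
    unfolding obs_moment_def
  proof (intro nn_integral_mono ennreal_leI)
    fix \<omega> assume \<omega>: "\<omega> \<in> space P"
    show "perm_prod \<theta> m (\<Xi> \<omega>) \<le> C'"
      using C'(2)[rule_format, OF \<Xi>_space[OF \<omega>]] by auto
  qed
  also have "\<dots> < \<infinity>"
    using emeasure_space_1 by simp
  finally show ?thesis .
qed

text \<open>Evaluation at zero allows \<open>r = 0\<close> in the differentiation theorem, and there
  the derivative of the product splits into one permanent for each process.\<close>

lemma joint_mixed_derivative:
  assumes \<eta>: "test_directions \<nu> n \<eta>" and \<theta>: "test_directions \<nu> m \<theta>"
  shows "has_mixed_derivative (joint_pgfl P \<Phi> \<Xi>)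
      (map (\<lambda>i. (\<eta> i, \<lambda>_. 0)) [1..<Suc n] @ map (\<lambda>k. (\<lambda>_. 0, \<theta> k)) [1..<Suc m])
      (\<lambda>_. 0) (\<lambda>_. 0) (enn2real (joint_moment n m \<eta> \<theta>))"
proof -
  define ds where "ds = map (\<lambda>i. (\<eta> i, \<lambda>_. 0 :: real)) [1..<Suc n] @ map (\<lambda>k. (\<lambda>_. 0 :: real, \<theta> k)) [1..<Suc m]"
  define Y where "Y \<omega> = image_mset Inl (\<Phi> \<omega>) + image_mset Inr (\<Xi> \<omega>)" for \<omega>
  define U where "U h g \<longleftrightarrow> h \<in> borel_measurable \<nu> \<and> g \<in> borel_measurable \<nu>" for h g :: "'a \<Rightarrow> real"
  obtain B where B: "0 \<le> B" "\<forall>i\<in>{1..n}. \<forall>x\<in>space \<nu>. \<bar>\<eta> i x\<bar> \<le> B"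
    using test_directions_bound[OF \<eta>] by blast
  obtain B' where B': "0 \<le> B'" "\<forall>i\<in>{1..m}. \<forall>x\<in>space \<nu>. \<bar>\<theta> i x\<bar> \<le> B'"
    using test_directions_bound[OF \<theta>] by blast
  have Y_prod: "(\<Prod>y\<in>#Y \<omega>. case_sum h g y) = (\<Prod>x\<in>#\<Phi> \<omega>. h x) * (\<Prod>z\<in>#\<Xi> \<omega>. g z)" for h g :: "'a \<Rightarrow> real" and \<omega>
    by (simp add: Y_def image_mset.compositionality comp_def)
  have ds_cases: "(\<exists>i\<in>{1..n}. d = (\<eta> i, \<lambda>_. 0)) \<or> (\<exists>k\<in>{1..m}. d = (\<lambda>_. 0, \<theta> k))" if "d \<in> set ds" for d
    using that by (auto simp: ds_def)
  have "has_mixed_derivative (joint_pgfl P \<Phi> \<Xi>) ds (\<lambda>_. 0) (\<lambda>_. 0)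
      (\<integral>\<omega>. dprod (map (\<lambda>d. case_sum (fst d) (snd d)) ds) (case_sum (\<lambda>_. 0) (\<lambda>_. 0)) (Y \<omega>) \<partial>P)"
  proof (rule has_mixed_derivative_expectation[where U = U and D = "set ds" and B = "B + B'" and r = 0])
    show "finite_measure P" by (rule finite_measure_axioms)
    show "joint_pgfl P \<Phi> \<Xi> h g = (\<integral>\<omega>. (\<Prod>y\<in>#Y \<omega>. case_sum h g y) \<partial>P)" for h g
      by (simp add: joint_pgfl_def Y_prod)
    show "(\<lambda>\<omega>. \<Prod>y\<in>#Y \<omega>. case_sum h g y) \<in> borel_measurable P" if "U h g" for h g
    proof -
      have [measurable]: "h \<in> borel_measurable \<nu>" "g \<in> borel_measurable \<nu>" using that by (auto simp: U_def)
      show ?thesis unfolding Y_prod by measurable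
    qed
    show "U (\<lambda>x. h x + t * fst d x) (\<lambda>z. g z + t * snd d z)" if "U h g" "d \<in> set ds" for h g d t
    proof -
      have [measurable]: "h \<in> borel_measurable \<nu>" "g \<in> borel_measurable \<nu>" using that by (auto simp: U_def)
      have [measurable]: "fst d \<in> borel_measurable \<nu>" "snd d \<in> borel_measurable \<nu>"
        using ds_cases[OF that(2)] \<eta> \<theta> by (auto simp: test_directions_def)
      show ?thesis unfolding U_def by measurable
    qed
    show "\<bar>case_sum (fst d) (snd d) y\<bar> \<le> B + B'" if "d \<in> set ds" "\<omega> \<in> space P" "y \<in># Y \<omega>" for d \<omega> y
    proof -
      have "y \<in> Inl ` space \<nu> \<or> y \<in> Inr ` space \<nu>"
        using that(3) \<Phi>_space[OF that(2)] \<Xi>_space[OF that(2)] by (auto simp: Y_def space_configs)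
      moreover have "\<bar>\<eta> i x\<bar> \<le> B + B'" if "i \<in> {1..n}" "x \<in> space \<nu>" for i x
        using B(2) that B'(1) by force
      moreover have "\<bar>\<theta> i x\<bar> \<le> B + B'" if "i \<in> {1..m}" "x \<in> space \<nu>" for i x
        using B'(2) that B(1) by force
      ultimately show ?thesis
        using ds_cases[OF that(1)] B(1) B'(1) by (elim disjE bexE imageE) simp_all
    qed
    show "U (\<lambda>_. 0) (\<lambda>_. 0)" by (simp add: U_def)
    show "\<bar>case_sum (\<lambda>_. 0) (\<lambda>_. 0) y\<bar> \<le> (0 :: real)" for y :: "'a + 'a"
      by (cases y) auto
  qed auto
  moreover have "dprod (map (\<lambda>d. case_sum (fst d) (snd d)) ds) (case_sum (\<lambda>_. 0) (\<lambda>_. 0)) (Y \<omega>) =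
      perm_prod \<eta> n (\<Phi> \<omega>) * perm_prod \<theta> m (\<Xi> \<omega>)" for \<omega>
  proof -
    have "map (\<lambda>d. case_sum (fst d) (snd d)) ds =
        map (\<lambda>d. case_sum d (\<lambda>_. 0)) (map \<eta> [1..<Suc n]) @ map (\<lambda>d. case_sum (\<lambda>_. 0) d) (map \<theta> [1..<Suc m])"
      by (simp add: ds_def)
    moreover have "case_sum (\<lambda>_. 0) (\<lambda>_. 0) = (\<lambda>_ :: 'a + 'a. 0 :: real)"
      by (auto simp: fun_eq_iff split: sum.split)
    ultimately show ?thesis
      unfolding Y_def perm_prod_def by (simp only: dprod_zero_sum)
  qed
  moreover have "(\<integral>\<omega>. perm_prod \<eta> n (\<Phi> \<omega>) * perm_prod \<theta> m (\<Xi> \<omega>) \<partial>P) = enn2real (joint_moment n m \<eta> \<theta>)"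
  proof -
    note [measurable] = perm_prod_meas[OF \<eta>] perm_prod_meas[OF \<theta>]
    have nn: "0 \<le> perm_prod \<eta> n (\<Phi> \<omega>)" "0 \<le> perm_prod \<theta> m (\<Xi> \<omega>)" if "\<omega> \<in> space P" for \<omega>
      using perm_prod_nonneg[OF \<eta> \<Phi>_space[OF that]] perm_prod_nonneg[OF \<theta> \<Xi>_space[OF that]] by auto
    have "(\<integral>\<omega>. perm_prod \<eta> n (\<Phi> \<omega>) * perm_prod \<theta> m (\<Xi> \<omega>) \<partial>P) =
        enn2real (\<integral>\<^sup>+\<omega>. ennreal (perm_prod \<eta> n (\<Phi> \<omega>) * perm_prod \<theta> m (\<Xi> \<omega>)) \<partial>P)"
      using nn by (intro integral_eq_nn_integral) auto
    also have "(\<integral>\<^sup>+\<omega>. ennreal (perm_prod \<eta> n (\<Phi> \<omega>) * perm_prod \<theta> m (\<Xi> \<omega>)) \<partial>P) = joint_moment n m \<eta> \<theta>"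
      unfolding joint_moment_def using nn by (intro nn_integral_cong ennreal_mult) auto
    finally show ?thesis .
  qed
  ultimately show ?thesis unfolding ds_def by simp
qed

text \<open>At \<open>h = 1\<close> the hidden points contribute the factor 1 and are left out of
  \<open>Y\<close>. The test function then vanishes at all points present, so \<open>r = 0\<close>
  applies again. The directions leave \<open>h\<close> unchanged, so \<open>U\<close> can fix it at
  1.\<close>

lemma obs_mixed_derivative:
  assumes \<theta>: "test_directions \<nu> m \<theta>"
  shows "has_mixed_derivative (joint_pgfl P \<Phi> \<Xi>) (map (\<lambda>k. (\<lambda>_. 0, \<theta> k)) [1..<Suc m])
      (\<lambda>_. 1) (\<lambda>_. 0) (enn2real (obs_moment m \<theta>))"
proof -
  define ds where "ds = map (\<lambda>k. (\<lambda>_ :: 'a. 0 :: real, \<theta> k)) [1..<Suc m]"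
  define Y where "Y \<omega> = (image_mset Inr (\<Xi> \<omega>) :: ('a + 'a) multiset)" for \<omega>
  define U where "U h g \<longleftrightarrow> h = (\<lambda>_. 1) \<and> g \<in> borel_measurable \<nu>" for h g :: "'a \<Rightarrow> real"
  obtain B' where B': "0 \<le> B'" "\<forall>i\<in>{1..m}. \<forall>x\<in>space \<nu>. \<bar>\<theta> i x\<bar> \<le> B'"
    using test_directions_bound[OF \<theta>] by blast
  have Y_prod: "(\<Prod>y\<in>#Y \<omega>. case_sum h g y) = (\<Prod>z\<in>#\<Xi> \<omega>. g z)" for h g :: "'a \<Rightarrow> real" and \<omega>
    by (simp add: Y_def image_mset.compositionality comp_def)
  have ds_cases: "\<exists>k\<in>{1..m}. d = (\<lambda>_. 0, \<theta> k)" if "d \<in> set ds" for d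
    using that by (auto simp: ds_def)
  have "has_mixed_derivative (joint_pgfl P \<Phi> \<Xi>) ds (\<lambda>_. 1) (\<lambda>_. 0)
      (\<integral>\<omega>. dprod (map (\<lambda>d. case_sum (fst d) (snd d)) ds) (case_sum (\<lambda>_. 1) (\<lambda>_. 0)) (Y \<omega>) \<partial>P)"
  proof (rule has_mixed_derivative_expectation[where U = U and D = "set ds" and B = B' and r = 0])
    show "finite_measure P" by (rule finite_measure_axioms)
    show "joint_pgfl P \<Phi> \<Xi> h g = (\<integral>\<omega>. (\<Prod>y\<in>#Y \<omega>. case_sum h g y) \<partial>P)" if "U h g" for h g
      using that by (simp add: joint_pgfl_def Y_prod U_def)
    show "(\<lambda>\<omega>. \<Prod>y\<in>#Y \<omega>. case_sum h g y) \<in> borel_measurable P" if "U h g" for h g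
    proof -
      have [measurable]: "g \<in> borel_measurable \<nu>" using that by (auto simp: U_def)
      show ?thesis unfolding Y_prod by measurable
    qed
    show "U (\<lambda>x. h x + t * fst d x) (\<lambda>z. g z + t * snd d z)" if Uhg: "U h g" and d: "d \<in> set ds" for h g d t
    proof -
      obtain k where k: "k \<in> {1..m}" "d = (\<lambda>_. 0, \<theta> k)" using ds_cases[OF d] by blast
      have [measurable]: "g \<in> borel_measurable \<nu>" "\<theta> k \<in> borel_measurable \<nu>"
        using Uhg \<theta> k by (auto simp: U_def test_directions_def)
      show ?thesis using Uhg unfolding U_def k(2) fst_conv snd_conv by simp
    qed
    show "\<bar>case_sum (fst d) (snd d) y\<bar> \<le> B'" if d: "d \<in> set ds" and \<omega>: "\<omega> \<in> space P" and y: "y \<in># Y \<omega>" for d \<omega> y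
    proof -
      obtain x where "y = Inr x" "x \<in> space \<nu>"
        using y \<Xi>_space[OF \<omega>] by (auto simp: Y_def space_configs)
      then show ?thesis
        using ds_cases[OF d] B'(2) by (elim bexE) simp
    qed
    show "U (\<lambda>_. 1) (\<lambda>_. 0)" by (simp add: U_def)
    show "\<bar>case_sum (\<lambda>_. 1) (\<lambda>_. 0) y\<bar> \<le> (0 :: real)" if "y \<in># Y \<omega>" for y \<omega>
      using that by (auto simp: Y_def)
  qed auto
  moreover have "dprod (map (\<lambda>d. case_sum (fst d) (snd d)) ds) (case_sum (\<lambda>_. 1) (\<lambda>_. 0)) (Y \<omega>) = perm_prod \<theta> m (\<Xi> \<omega>)" for \<omega>
    unfolding Y_def dprod_image_mset perm_prod_def by (simp add: ds_def comp_def)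
  moreover have "(\<integral>\<omega>. perm_prod \<theta> m (\<Xi> \<omega>) \<partial>P) = enn2real (obs_moment m \<theta>)"
  proof -
    note [measurable] = perm_prod_meas[OF \<theta>]
    show ?thesis
      unfolding obs_moment_def using perm_prod_nonneg[OF \<theta> \<Xi>_space]
      by (intro integral_eq_nn_integral) auto
  qed
  ultimately show ?thesis unfolding ds_def by simp
qed

lemma finite_enn2real_eq_iff:
  fixes I E :: ennreal
  assumes "E < \<infinity>"
  shows "I < \<infinity> \<and> enn2real I = enn2real E \<longleftrightarrow> I = E"
  using assms by (cases I; cases E) auto

text \<open>The mixed derivative exists and is unique, so asking that \<open>I\<close> be finite
  with this derivative as its real value amounts to \<open>I\<close> being the moment. The density
  is thereby characterized by a moment problem.\<close>

lemma joint_janossy_density_moments: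
  assumes J: "(\<lambda>(x, z). J x z) \<in> borel_measurable (tuples \<nu> n \<Otimes>\<^sub>M tuples \<nu> m)"
  shows "joint_janossy_density P \<nu> \<Phi> \<Xi> n m J \<longleftrightarrow>
    (\<forall>\<eta> \<theta>. test_directions \<nu> n \<eta> \<and> test_directions \<nu> m \<theta> \<longrightarrow>
      (\<integral>\<^sup>+w. ennreal ((\<Prod>i=1..n. \<eta> i (fst w i)) * (\<Prod>k=1..m. \<theta> k (snd w k))) * J (fst w) (snd w) \<partial>(tuples \<nu> n \<Otimes>\<^sub>M tuples \<nu> m)) =
      joint_moment n m \<eta> \<theta>)"
proof -
  have "I < \<infinity> \<and> has_mixed_derivative (joint_pgfl P \<Phi> \<Xi>)
      (map (\<lambda>i. (\<eta> i, \<lambda>_. 0)) [1..<Suc n] @ map (\<lambda>k. (\<lambda>_. 0, \<theta> k)) [1..<Suc m])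
      (\<lambda>_. 0) (\<lambda>_. 0) (enn2real I) \<longleftrightarrow> I = joint_moment n m \<eta> \<theta>"
    if \<eta>: "test_directions \<nu> n \<eta>" and \<theta>: "test_directions \<nu> m \<theta>" for I \<eta> \<theta>
    using joint_mixed_derivative[OF \<eta> \<theta>] has_mixed_derivative_unique[OF joint_mixed_derivative[OF \<eta> \<theta>]]
      finite_enn2real_eq_iff[OF joint_moment_finite[OF \<eta> \<theta>], of I]
    by metis
  then show ?thesis
    unfolding joint_janossy_density_def Let_def case_prod_beta using J by (auto simp: case_prod_beta)
qed

lemma obs_janossy_density_moments:
  assumes J: "J \<in> borel_measurable (tuples \<nu> m)"
  shows "observation_janossy_density P \<nu> \<Phi> \<Xi> m J \<longleftrightarrow>
    (\<forall>\<theta>. test_directions \<nu> m \<theta> \<longrightarrow>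
      (\<integral>\<^sup>+z. ennreal (\<Prod>k=1..m. \<theta> k (z k)) * J z \<partial>tuples \<nu> m) = obs_moment m \<theta>)"
proof -
  have "I < \<infinity> \<and> has_mixed_derivative (joint_pgfl P \<Phi> \<Xi>) (map (\<lambda>k. (\<lambda>_. 0, \<theta> k)) [1..<Suc m])
      (\<lambda>_. 1) (\<lambda>_. 0) (enn2real I) \<longleftrightarrow> I = obs_moment m \<theta>"
    if \<theta>: "test_directions \<nu> m \<theta>" for I \<theta>
    using obs_mixed_derivative[OF \<theta>] has_mixed_derivative_unique[OF obs_mixed_derivative[OF \<theta>]]
      finite_enn2real_eq_iff[OF obs_moment_finite[OF \<theta>], of I]
    by metis
  then show ?thesis
    unfolding observation_janossy_density_def Let_def using J by auto
qed

text \<open>Indicators are admissible directions, so the moments fix all integrals over rectangles;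
  the constant directions give finite mass. It is applied to candidate joint densities and also to
  \<open>L * obs\<close>, the form in which a conditional law enters.\<close>

lemma AE_eq_jf:
  assumes f: "f \<in> borel_measurable (tuples \<nu> n \<Otimes>\<^sub>M tuples \<nu> m)"
    and eq: "\<And>\<eta> \<theta>. test_directions \<nu> n \<eta> \<Longrightarrow> test_directions \<nu> m \<theta> \<Longrightarrow>
      (\<integral>\<^sup>+w. ennreal ((\<Prod>i=1..n. \<eta> i (fst w i)) * (\<Prod>k=1..m. \<theta> k (snd w k))) * f w \<partial>(tuples \<nu> n \<Otimes>\<^sub>M tuples \<nu> m)) =
      joint_moment n m \<eta> \<theta>"
  shows "AE w in tuples \<nu> n \<Otimes>\<^sub>M tuples \<nu> m. f w = ennreal (jf n m (fst w) (snd w))"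
proof (rule AE_eq_tuples_pair[OF sf f])
  show "(\<lambda>w. ennreal (jf n m (fst w) (snd w))) \<in> borel_measurable (tuples \<nu> n \<Otimes>\<^sub>M tuples \<nu> m)"
    by measurable
  show "(\<integral>\<^sup>+w. f w \<partial>(tuples \<nu> n \<Otimes>\<^sub>M tuples \<nu> m)) < \<infinity>"
    using eq[OF test_directions_one test_directions_one] joint_moment_finite[OF test_directions_one test_directions_one]
    by simp
  fix A B :: "nat \<Rightarrow> 'a set"
  assume "\<And>i. i \<in> {1..n} \<Longrightarrow> A i \<in> sets \<nu>" "\<And>i. i \<in> {1..m} \<Longrightarrow> B i \<in> sets \<nu>"
  then have "test_directions \<nu> n (\<lambda>i. indicator (A i))" "test_directions \<nu> m (\<lambda>i. indicator (B i))"
    by (auto intro: test_directions_indicator)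
  from eq[OF this] nn_integral_perm_prod_joint[OF this, folded joint_moment_def]
  show "(\<integral>\<^sup>+w. ennreal ((\<Prod>i=1..n. indicator (A i) (fst w i)) * (\<Prod>k=1..m. indicator (B k) (snd w k))) * f w \<partial>(tuples \<nu> n \<Otimes>\<^sub>M tuples \<nu> m)) =
      (\<integral>\<^sup>+w. ennreal ((\<Prod>i=1..n. indicator (A i) (fst w i)) * (\<Prod>k=1..m. indicator (B k) (snd w k))) * ennreal (jf n m (fst w) (snd w)) \<partial>(tuples \<nu> n \<Otimes>\<^sub>M tuples \<nu> m))"
    by simp
qed

theorem joint_janossy_density_iff:
  assumes J: "(\<lambda>(x, z). J x z) \<in> borel_measurable (tuples \<nu> n \<Otimes>\<^sub>M tuples \<nu> m)"
  shows "joint_janossy_density P \<nu> \<Phi> \<Xi> n m J \<longleftrightarrow>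
    (AE (x, z) in tuples \<nu> n \<Otimes>\<^sub>M tuples \<nu> m. J x z = ennreal (jf n m x z))"
proof
  assume "joint_janossy_density P \<nu> \<Phi> \<Xi> n m J"
  then show "AE (x, z) in tuples \<nu> n \<Otimes>\<^sub>M tuples \<nu> m. J x z = ennreal (jf n m x z)"
    using AE_eq_jf[of "\<lambda>w. J (fst w) (snd w)" n m] J unfolding joint_janossy_density_moments[OF J]
    by (simp add: case_prod_beta)
next
  assume AE: "AE (x, z) in tuples \<nu> n \<Otimes>\<^sub>M tuples \<nu> m. J x z = ennreal (jf n m x z)"
  show "joint_janossy_density P \<nu> \<Phi> \<Xi> n m J"
    unfolding joint_janossy_density_moments[OF J]
  proof (intro allI impI, elim conjE)
    fix \<eta> \<theta> assume t: "test_directions \<nu> n \<eta>" "test_directions \<nu> m \<theta>"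
    show "(\<integral>\<^sup>+w. ennreal ((\<Prod>i=1..n. \<eta> i (fst w i)) * (\<Prod>k=1..m. \<theta> k (snd w k))) * J (fst w) (snd w) \<partial>(tuples \<nu> n \<Otimes>\<^sub>M tuples \<nu> m)) =
        joint_moment n m \<eta> \<theta>"
      unfolding joint_moment_def nn_integral_perm_prod_joint[OF t]
      using AE by (intro nn_integral_cong_AE) (auto simp: case_prod_beta)
  qed
qed

theorem observation_janossy_density_iff:
  assumes J: "J \<in> borel_measurable (tuples \<nu> m)"
  shows "observation_janossy_density P \<nu> \<Phi> \<Xi> m J \<longleftrightarrow> (AE z in tuples \<nu> m. J z = obs m z)"
proof
  assume "observation_janossy_density P \<nu> \<Phi> \<Xi> m J"
  then have eq: "(\<integral>\<^sup>+z. ennreal (\<Prod>k=1..m. \<theta> k (z k)) * J z \<partial>tuples \<nu> m) = obs_moment m \<theta>"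
    if "test_directions \<nu> m \<theta>" for \<theta>
    using that unfolding obs_janossy_density_moments[OF J] by blast
  interpret X: sigma_finite_measure "tuples \<nu> n" for n by (rule sigma_finite_tuples[OF sf])
  \<comment> \<open>\<open>tuples \<nu> 0\<close> is a unit point mass, so the criterion for pairs
    is reused with an empty group of hidden points.\<close>
  interpret XZ: pair_sigma_finite "tuples \<nu> 0" "tuples \<nu> m" ..
  have e0: "emeasure (tuples \<nu> 0) (space (tuples \<nu> 0)) = 1"
    by (simp add: PiM_empty)
  have snd: "(\<integral>\<^sup>+w. f (snd w) \<partial>(tuples \<nu> 0 \<Otimes>\<^sub>M tuples \<nu> m)) = (\<integral>\<^sup>+z. f z \<partial>tuples \<nu> m)"
    if "f \<in> borel_measurable (tuples \<nu> m)" for f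
  proof -
    have "(\<lambda>w. f (snd w)) \<in> borel_measurable (tuples \<nu> 0 \<Otimes>\<^sub>M tuples \<nu> m)" using that by measurable
    from XZ.nn_integral_snd[OF this] show ?thesis using e0 by simp
  qed
  note [measurable] = J
  have "AE w in tuples \<nu> 0 \<Otimes>\<^sub>M tuples \<nu> m. J (snd w) = obs m (snd w)"
  proof (rule AE_eq_tuples_pair[OF sf])
    show "(\<integral>\<^sup>+w. J (snd w) \<partial>(tuples \<nu> 0 \<Otimes>\<^sub>M tuples \<nu> m)) < \<infinity>"
      unfolding snd[OF J]
      using eq[OF test_directions_one] obs_moment_finite[OF test_directions_one[of \<nu> m]] by simp
    fix A B :: "nat \<Rightarrow> 'a set"
    assume B: "\<And>i. i \<in> {1..m} \<Longrightarrow> B i \<in> sets \<nu>"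
    then have t: "test_directions \<nu> m (\<lambda>i. indicator (B i))"
      by (rule test_directions_indicator)
    have [measurable]: "(\<lambda>z. \<Prod>k=1..m. indicator (B k) (z k) :: real) \<in> borel_measurable (tuples \<nu> m)"
      using B by measurable
    show "(\<integral>\<^sup>+w. ennreal ((\<Prod>i=1..0. indicator (A i) (fst w i)) * (\<Prod>k=1..m. indicator (B k) (snd w k))) * J (snd w) \<partial>(tuples \<nu> 0 \<Otimes>\<^sub>M tuples \<nu> m)) =
      (\<integral>\<^sup>+w. ennreal ((\<Prod>i=1..0. indicator (A i) (fst w i)) * (\<Prod>k=1..m. indicator (B k) (snd w k))) * obs m (snd w) \<partial>(tuples \<nu> 0 \<Otimes>\<^sub>M tuples \<nu> m))"
    proof -
      have "(\<lambda>z. ennreal (\<Prod>k=1..m. indicator (B k) (z k)) * J z) \<in> borel_measurable (tuples \<nu> m)"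
        "(\<lambda>z. ennreal (\<Prod>k=1..m. indicator (B k) (z k)) * obs m z) \<in> borel_measurable (tuples \<nu> m)"
        by measurable
      from snd[OF this(1)] snd[OF this(2)] show ?thesis
        using eq[OF t] nn_integral_perm_prod_obs[OF t, folded obs_moment_def] by simp
    qed
  qed measurable
  then have "AE x in tuples \<nu> 0. AE z in tuples \<nu> m. J z = obs m z"
    using XZ.AE_pair by fastforce
  moreover have "tuples \<nu> 0 = count_space {\<lambda>_. undefined}"
    by (simp add: PiM_empty)
  ultimately show "AE z in tuples \<nu> m. J z = obs m z"
    by (auto simp only: AE_count_space)
next
  assume AE: "AE z in tuples \<nu> m. J z = obs m z"
  show "observation_janossy_density P \<nu> \<Phi> \<Xi> m J"
    unfolding obs_janossy_density_moments[OF J]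
  proof (intro allI impI)
    fix \<theta> assume t: "test_directions \<nu> m \<theta>"
    show "(\<integral>\<^sup>+z. ennreal (\<Prod>k=1..m. \<theta> k (z k)) * J z \<partial>tuples \<nu> m) = obs_moment m \<theta>"
      unfolding obs_moment_def nn_integral_perm_prod_obs[OF t]
      using AE by (intro nn_integral_cong_AE) auto
  qed
qed

end

section \<open>The conditional law given the observations\<close>

context observed_process
begin

lemma AE_obs_finite: "AE z in tuples \<nu> m. obs m z \<noteq> \<infinity>"
proof (rule nn_integral_PInf_AE)
  show "(\<integral>\<^sup>+z. obs m z \<partial>tuples \<nu> m) \<noteq> \<infinity>"
    using nn_integral_perm_prod_obs[OF test_directions_one, folded obs_moment_def]
      obs_moment_finite[OF test_directions_one[of \<nu> m]] by simp
qed measurable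

text \<open>A vanishing series of nonnegative terms has vanishing terms, and the terms are integrals
  of the joint formula. This settles the observations at which the quotient has denominator
  0.\<close>

lemma obs_zero:
  assumes z: "z \<in> space (tuples \<nu> m)" and "obs m z = 0"
  shows "AE x in tuples \<nu> n. ennreal (jf n m x z) = 0"
proof -
  note [measurable] = jf_meas_x[OF z]
  have "(\<Sum>n. ennreal (1 / fact n) * (\<integral>\<^sup>+x. ennreal (jf n m x z) \<partial>tuples \<nu> n)) = 0"
    using suminf_integral_jf[OF z] assms(2) by simp
  then have "ennreal (1 / fact n) * (\<integral>\<^sup>+x. ennreal (jf n m x z) \<partial>tuples \<nu> n) = 0"
    by (subst (asm) suminf_eq_zero_iff) (auto intro: summableI)
  then have "(\<integral>\<^sup>+x. ennreal (jf n m x z) \<partial>tuples \<nu> n) = 0"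
    by simp
  then show ?thesis
    by (subst (asm) nn_integral_0_iff_AE) auto
qed

text \<open>The quotient formula multiplied out. It also makes a claim where the denominator
  vanishes, and there \<open>obs_zero\<close> makes it true.\<close>

definition proportional :: "('a multiset \<Rightarrow> nat \<Rightarrow> (nat \<Rightarrow> 'a) \<Rightarrow> ennreal) \<Rightarrow> nat \<Rightarrow> nat \<Rightarrow> bool" where
  "proportional L n m \<longleftrightarrow>
    (AE z in tuples \<nu> m. AE x in tuples \<nu> n. ennreal (jf n m x z) = L (config_of m z) n x * obs m z)"

lemma kernel_section_meas:
  assumes "janossy_kernel \<nu> L" "\<xi> \<in> space (configs \<nu>)"
  shows "L \<xi> n \<in> borel_measurable (tuples \<nu> n)"
proof -
  have "(\<lambda>(\<xi>, x). L \<xi> n x) \<in> borel_measurable (configs \<nu> \<Otimes>\<^sub>M tuples \<nu> n)"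
    using assms(1) by (simp add: janossy_kernel_def)
  from measurable_compose[OF measurable_Pair1'[OF assms(2)] this] show ?thesis by simp
qed

text \<open>The denominator is almost everywhere finite, so it can be cancelled where it is nonzero.
  At its zeros the left side is vacuous and the right side is \<open>obs_zero\<close>.\<close>

lemma quotient_iff_proportional:
  assumes J: "AE w in tuples \<nu> n \<Otimes>\<^sub>M tuples \<nu> m. J (fst w) (snd w) = ennreal (jf n m (fst w) (snd w))"
    and J_meas: "(\<lambda>w. J (fst w) (snd w)) \<in> borel_measurable (tuples \<nu> n \<Otimes>\<^sub>M tuples \<nu> m)"
    and K: "AE z in tuples \<nu> m. K z = obs m z"
  shows "(AE z in tuples \<nu> m. K z \<noteq> 0 \<longrightarrow> (AE x in tuples \<nu> n. L (config_of m z) n x = J x z / K z)) \<longleftrightarrow>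
    proportional L n m"
  unfolding proportional_def
proof (rule eventually_subst)
  have J': "AE z in tuples \<nu> m. AE x in tuples \<nu> n. J x z = ennreal (jf n m x z)"
    using AE_tuples_swap[OF sf J_meas _ J] by simp
  show "AE z in tuples \<nu> m. (K z \<noteq> 0 \<longrightarrow> (AE x in tuples \<nu> n. L (config_of m z) n x = J x z / K z)) \<longleftrightarrow>
      (AE x in tuples \<nu> n. ennreal (jf n m x z) = L (config_of m z) n x * obs m z)"
    using J' K AE_obs_finite AE_space
  proof eventually_elim
    fix z assume J: "AE x in tuples \<nu> n. J x z = ennreal (jf n m x z)" and K: "K z = obs m z"
      and fin: "obs m z \<noteq> \<infinity>" and z: "z \<in> space (tuples \<nu> m)"
    show "(K z \<noteq> 0 \<longrightarrow> (AE x in tuples \<nu> n. L (config_of m z) n x = J x z / K z)) \<longleftrightarrow>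
        (AE x in tuples \<nu> n. ennreal (jf n m x z) = L (config_of m z) n x * obs m z)"
    proof (cases "obs m z = 0")
      case True
      then show ?thesis using obs_zero[OF z True, of n] K by simp
    next
      case False
      have "(AE x in tuples \<nu> n. L (config_of m z) n x = J x z / K z) \<longleftrightarrow>
          (AE x in tuples \<nu> n. ennreal (jf n m x z) = L (config_of m z) n x * obs m z)"
        by (rule eventually_subst, use J in eventually_elim) (simp add: K ennreal_divide_eq_iff[OF False fin])
      then show ?thesis using False K by simp
    qed
  qed
qed

definition posterior_mean :: "('a multiset \<Rightarrow> nat \<Rightarrow> (nat \<Rightarrow> 'a) \<Rightarrow> ennreal) \<Rightarrow> ('a multiset \<Rightarrow> ennreal) \<Rightarrow> 'a multiset \<Rightarrow> ennreal" where
  "posterior_mean L F \<xi> = (\<Sum>n. ennreal (1 / fact n) * (\<integral>\<^sup>+x. F (config_of n x) * L \<xi> n x \<partial>tuples \<nu> n))"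

lemma posterior_mean_meas:
  assumes L: "janossy_kernel \<nu> L" and F [measurable]: "F \<in> borel_measurable (configs \<nu>)"
  shows "posterior_mean L F \<in> borel_measurable (configs \<nu>)"
proof -
  interpret X: sigma_finite_measure "tuples \<nu> n" for n by (rule sigma_finite_tuples[OF sf])
  have [measurable]: "(\<lambda>w. L (fst w) n (snd w)) \<in> borel_measurable (configs \<nu> \<Otimes>\<^sub>M tuples \<nu> n)" for n
    using L unfolding janossy_kernel_def case_prod_beta by blast
  have "(\<lambda>\<xi>. \<integral>\<^sup>+x. F (config_of n x) * L \<xi> n x \<partial>tuples \<nu> n) \<in> borel_measurable (configs \<nu>)" for n
    by (rule X.borel_measurable_nn_integral) (unfold case_prod_beta, measurable)
  then show ?thesis
    unfolding posterior_mean_def[abs_def] by measurable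
qed

definition obs_algebra :: "'w measure" where
  "obs_algebra = vimage_algebra (space P) \<Xi> (configs \<nu>)"

lemma sets_obs_algebra: "sets obs_algebra = {\<Xi> -` B \<inter> space P | B. B \<in> sets (configs \<nu>)}"
  unfolding obs_algebra_def by (rule sets_vimage_algebra2) (use \<Xi>_space in auto)

lemma \<Xi>_meas_obs_algebra: "\<Xi> \<in> obs_algebra \<rightarrow>\<^sub>M configs \<nu>"
  unfolding obs_algebra_def by (rule measurable_vimage_algebra1) (use \<Xi>_space in auto)

lemma sigma_finite_subalgebra_obs: "sigma_finite_subalgebra P obs_algebra"
proof -
  have "subalgebra P obs_algebra"
    unfolding subalgebra_def sets_obs_algebra
    by (auto simp: obs_algebra_def intro: measurable_sets[OF \<Xi>_meas])
  then interpret finite_measure_subalgebra P obs_algebra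
    by unfold_locales
  show ?thesis by unfold_locales
qed

text \<open>Under proportionality the posterior mean has the same integral as \<open>F\<close> of
  \<Phi> over every event of \<Xi>, so it is the conditional expectation. Conversely, with
  permanents as \<open>F\<close> and as weight in the observations, \<open>L * obs\<close> is seen
  to have the moments of the joint law, and these determine the density.\<close>

lemma conditional_janossy_densities_iff:
  assumes L: "janossy_kernel \<nu> L"
  shows "conditional_janossy_densities P \<nu> \<Phi> \<Xi> L \<longleftrightarrow> (\<forall>n m. proportional L n m)"
proof
  assume proportional: "\<forall>n m. proportional L n m"
  have AE: "AE \<omega> in P. posterior_mean L F (\<Xi> \<omega>) = nn_cond_exp P obs_algebra (\<lambda>\<omega>. F (\<Phi> \<omega>)) \<omega>"
    if F [measurable]: "F \<in> borel_measurable (configs \<nu>)" for F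
  proof (rule sigma_finite_subalgebra.nn_cond_exp_charact[OF sigma_finite_subalgebra_obs])
    note [measurable] = posterior_mean_meas[OF L F]
    show "(\<lambda>\<omega>. posterior_mean L F (\<Xi> \<omega>)) \<in> borel_measurable obs_algebra"
      using \<Xi>_meas_obs_algebra by measurable
    fix A assume "A \<in> sets obs_algebra"
    then obtain B where A: "A = \<Xi> -` B \<inter> space P" and B [measurable]: "B \<in> sets (configs \<nu>)"
      unfolding sets_obs_algebra by blast
    have set: "(\<integral>\<^sup>+\<omega>\<in>A. f \<omega> \<partial>P) = (\<integral>\<^sup>+\<omega>. indicator B (\<Xi> \<omega>) * f \<omega> \<partial>P)" for f
      by (intro nn_integral_cong) (auto simp: A split: split_indicator)
    have "(\<integral>\<^sup>+\<omega>. indicator B (\<Xi> \<omega>) * F (\<Phi> \<omega>) \<partial>P) = (\<Sum>m. ennreal (1 / fact m) * (\<integral>\<^sup>+z. indicator B (config_of m z) *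
      (\<Sum>n. ennreal (1 / fact n) * (\<integral>\<^sup>+x. F (config_of n x) * ennreal (jf n m x z) \<partial>tuples \<nu> n)) \<partial>tuples \<nu> m))"
      by (rule nn_integral_observed) measurable
    also have "\<dots> = (\<Sum>m. ennreal (1 / fact m) * (\<integral>\<^sup>+z. (indicator B (config_of m z) * posterior_mean L F (config_of m z)) * obs m z \<partial>tuples \<nu> m))"
    proof (intro suminf_cong arg_cong2[of _ _ _ _ "(*)"] refl nn_integral_cong_AE)
      fix m
      \<comment> \<open>The exceptional null sets, one for each \<open>n\<close>, are joined so that
        the whole series can be compared at one \<open>z\<close>.\<close>
      have "AE z in tuples \<nu> m. \<forall>n. AE x in tuples \<nu> n. ennreal (jf n m x z) = L (config_of m z) n x * obs m z"
        using proportional unfolding AE_all_countable proportional_def by blast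
      then show "AE z in tuples \<nu> m. indicator B (config_of m z) *
          (\<Sum>n. ennreal (1 / fact n) * (\<integral>\<^sup>+x. F (config_of n x) * ennreal (jf n m x z) \<partial>tuples \<nu> n)) =
          (indicator B (config_of m z) * posterior_mean L F (config_of m z)) * obs m z"
        using AE_space
      proof eventually_elim
        fix z assume AE: "\<forall>n. AE x in tuples \<nu> n. ennreal (jf n m x z) = L (config_of m z) n x * obs m z"
          and z: "z \<in> space (tuples \<nu> m)"
        have [measurable]: "L (config_of m z) n \<in> borel_measurable (tuples \<nu> n)" for n
          by (rule kernel_section_meas[OF L measurable_space[OF measurable_config_of z]])
        have "(\<integral>\<^sup>+x. F (config_of n x) * ennreal (jf n m x z) \<partial>tuples \<nu> n) =
            (\<integral>\<^sup>+x. F (config_of n x) * L (config_of m z) n x \<partial>tuples \<nu> n) * obs m z" for n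
        proof -
          have "(\<integral>\<^sup>+x. F (config_of n x) * ennreal (jf n m x z) \<partial>tuples \<nu> n) =
              (\<integral>\<^sup>+x. (F (config_of n x) * L (config_of m z) n x) * obs m z \<partial>tuples \<nu> n)"
          proof (rule nn_integral_cong_AE)
            show "AE x in tuples \<nu> n. F (config_of n x) * ennreal (jf n m x z) = (F (config_of n x) * L (config_of m z) n x) * obs m z"
              using AE[rule_format, of n] by eventually_elim (simp add: mult.assoc)
          qed
          also have "\<dots> = (\<integral>\<^sup>+x. F (config_of n x) * L (config_of m z) n x \<partial>tuples \<nu> n) * obs m z"
            by (rule nn_integral_multc) measurable
          finally show ?thesis .
        qed
        then have "(\<Sum>n. ennreal (1 / fact n) * (\<integral>\<^sup>+x. F (config_of n x) * ennreal (jf n m x z) \<partial>tuples \<nu> n)) =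
            posterior_mean L F (config_of m z) * obs m z"
          unfolding posterior_mean_def by (simp only: mult.assoc[symmetric] ennreal_suminf_multc)
        then show "indicator B (config_of m z) *
          (\<Sum>n. ennreal (1 / fact n) * (\<integral>\<^sup>+x. F (config_of n x) * ennreal (jf n m x z) \<partial>tuples \<nu> n)) =
          (indicator B (config_of m z) * posterior_mean L F (config_of m z)) * obs m z"
          by (simp only: mult.assoc)
      qed
    qed
    also have "\<dots> = (\<integral>\<^sup>+\<omega>. indicator B (\<Xi> \<omega>) * posterior_mean L F (\<Xi> \<omega>) \<partial>P)"
      by (rule nn_integral_observation[symmetric]) measurable
    finally show "(\<integral>\<^sup>+\<omega>\<in>A. F (\<Phi> \<omega>) \<partial>P) = (\<integral>\<^sup>+\<omega>\<in>A. posterior_mean L F (\<Xi> \<omega>) \<partial>P)"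
      unfolding set .
  qed measurable
  show "conditional_janossy_densities P \<nu> \<Phi> \<Xi> L"
    unfolding conditional_janossy_densities_def posterior_mean_def[symmetric] obs_algebra_def[symmetric]
    by (intro conjI L ballI) (rule AE_symmetric[OF AE])
next
  assume cond: "conditional_janossy_densities P \<nu> \<Phi> \<Xi> L"
  show "\<forall>n m. proportional L n m"
  proof (intro allI)
    fix n m
    \<comment> \<open>\<open>L\<close> depends on the observations only through their configuration,
      which makes \<open>f\<close> symmetric in \<open>z\<close> as well as in
      \<open>x\<close>.\<close>
    define f where "f w = L (config_of m (snd w)) n (fst w) * obs m (snd w)" for w :: "(nat \<Rightarrow> 'a) \<times> (nat \<Rightarrow> 'a)"
    have f [measurable]: "f \<in> borel_measurable (tuples \<nu> n \<Otimes>\<^sub>M tuples \<nu> m)"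
    proof -
      have "(\<lambda>w. (config_of m (snd w), fst w)) \<in> tuples \<nu> n \<Otimes>\<^sub>M tuples \<nu> m \<rightarrow>\<^sub>M configs \<nu> \<Otimes>\<^sub>M tuples \<nu> n"
        by measurable
      moreover have "(\<lambda>(\<xi>, x). L \<xi> n x) \<in> borel_measurable (configs \<nu> \<Otimes>\<^sub>M tuples \<nu> n)"
        using L by (simp add: janossy_kernel_def)
      ultimately have "(\<lambda>w. L (config_of m (snd w)) n (fst w)) \<in> borel_measurable (tuples \<nu> n \<Otimes>\<^sub>M tuples \<nu> m)"
        using measurable_compose by fastforce
      then show ?thesis unfolding f_def by measurable
    qed
    have sym_x: "symmetric_on_tuples \<nu> n (\<lambda>x. f (x, z))" if "z \<in> space (tuples \<nu> m)" for z
      using L measurable_space[OF measurable_config_of that]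
      by (auto simp: f_def symmetric_on_tuples_def janossy_kernel_def)
    have sym_z: "symmetric_on_tuples \<nu> m (\<lambda>z. f (x, z))" for x
      using obs_sym[of m] by (auto simp: f_def symmetric_on_tuples_def config_of_comp_permutes)
    have "AE w in tuples \<nu> n \<Otimes>\<^sub>M tuples \<nu> m. f w = ennreal (jf n m (fst w) (snd w))"
    proof (rule AE_eq_jf[OF f])
      fix \<eta> \<theta> assume \<eta>: "test_directions \<nu> n \<eta>" and \<theta>: "test_directions \<nu> m \<theta>"
      define F where "F \<phi> = ennreal (perm_prod \<eta> n \<phi>)" for \<phi>
      define G where "G \<xi> = ennreal (perm_prod \<theta> m \<xi>)" for \<xi>
      have F [measurable]: "F \<in> borel_measurable (configs \<nu>)" and G [measurable]: "G \<in> borel_measurable (configs \<nu>)"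
        using perm_prod_meas[OF \<eta>] perm_prod_meas[OF \<theta>] unfolding F_def G_def by measurable
      note [measurable] = posterior_mean_meas[OF L F]
      define c where "c = ennreal (1 / fact n) * ennreal (1 / fact m)"
      have ae: "AE \<omega> in P. nn_cond_exp P obs_algebra (\<lambda>\<omega>. F (\<Phi> \<omega>)) \<omega> = posterior_mean L F (\<Xi> \<omega>)"
        using cond F unfolding conditional_janossy_densities_def posterior_mean_def obs_algebra_def by blast
      have "joint_moment n m \<eta> \<theta> = (\<integral>\<^sup>+\<omega>. G (\<Xi> \<omega>) * F (\<Phi> \<omega>) \<partial>P)"
        by (simp add: joint_moment_def F_def G_def mult.commute)
      also have "\<dots> = (\<integral>\<^sup>+\<omega>. G (\<Xi> \<omega>) * nn_cond_exp P obs_algebra (\<lambda>\<omega>. F (\<Phi> \<omega>)) \<omega> \<partial>P)"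
        by (rule sigma_finite_subalgebra.nn_cond_exp_intg[OF sigma_finite_subalgebra_obs, symmetric])
           (use \<Xi>_meas_obs_algebra in measurable)
      also have "\<dots> = (\<integral>\<^sup>+\<omega>. G (\<Xi> \<omega>) * posterior_mean L F (\<Xi> \<omega>) \<partial>P)"
        using ae by (intro nn_integral_cong_AE) auto
      also have "\<dots> = (\<Sum>m'. ennreal (1 / fact m') * (\<integral>\<^sup>+z. (G (config_of m' z) * posterior_mean L F (config_of m' z)) * obs m' z \<partial>tuples \<nu> m'))"
        by (rule nn_integral_observation) measurable
      \<comment> \<open>The permanents single out the term with \<open>m\<close> observations here
        and, inside the posterior mean, the term with \<open>n\<close> hidden points.\<close>
      also have "\<dots> = ennreal (1 / fact m) * (\<integral>\<^sup>+z. (G (config_of m z) * posterior_mean L F (config_of m z)) * obs m z \<partial>tuples \<nu> m)"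
        by (rule suminf_single_ennreal) (simp add: G_def perm_prod_size)
      also have "(\<integral>\<^sup>+z. (G (config_of m z) * posterior_mean L F (config_of m z)) * obs m z \<partial>tuples \<nu> m) =
          (\<integral>\<^sup>+z. ennreal (1 / fact n) * (\<integral>\<^sup>+x. F (config_of n x) * (G (config_of m z) * f (x, z)) \<partial>tuples \<nu> n) \<partial>tuples \<nu> m)"
      proof (intro nn_integral_cong)
        fix z assume z: "z \<in> space (tuples \<nu> m)"
        have [measurable]: "L (config_of m z) n \<in> borel_measurable (tuples \<nu> n)"
          by (rule kernel_section_meas[OF L measurable_space[OF measurable_config_of z]])
        have "posterior_mean L F (config_of m z) =
            ennreal (1 / fact n) * (\<integral>\<^sup>+x. F (config_of n x) * L (config_of m z) n x \<partial>tuples \<nu> n)"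
          unfolding posterior_mean_def by (rule suminf_single_ennreal) (simp add: F_def perm_prod_size)
        moreover have "(\<integral>\<^sup>+x. F (config_of n x) * (G (config_of m z) * f (x, z)) \<partial>tuples \<nu> n) =
            (\<integral>\<^sup>+x. (G (config_of m z) * obs m z) * (F (config_of n x) * L (config_of m z) n x) \<partial>tuples \<nu> n)"
          by (simp add: f_def mult_ac)
        moreover have "\<dots> = (G (config_of m z) * obs m z) * (\<integral>\<^sup>+x. F (config_of n x) * L (config_of m z) n x \<partial>tuples \<nu> n)"
          by (rule nn_integral_cmult) measurable
        ultimately show "(G (config_of m z) * posterior_mean L F (config_of m z)) * obs m z =
            ennreal (1 / fact n) * (\<integral>\<^sup>+x. F (config_of n x) * (G (config_of m z) * f (x, z)) \<partial>tuples \<nu> n)"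
          by (simp add: mult_ac)
      qed
      also have "\<dots> = ennreal (1 / fact n) * (\<integral>\<^sup>+w. F (config_of n (fst w)) * (G (config_of m (snd w)) * f w) \<partial>(tuples \<nu> n \<Otimes>\<^sub>M tuples \<nu> m))"
      proof -
        interpret X: sigma_finite_measure "tuples \<nu> n" by (rule sigma_finite_tuples[OF sf])
        interpret Z: sigma_finite_measure "tuples \<nu> m" by (rule sigma_finite_tuples[OF sf])
        interpret XZ: pair_sigma_finite "tuples \<nu> n" "tuples \<nu> m" ..
        have meas: "(\<lambda>w. F (config_of n (fst w)) * (G (config_of m (snd w)) * f w)) \<in> borel_measurable (tuples \<nu> n \<Otimes>\<^sub>M tuples \<nu> m)"
          by measurable
        have "(\<lambda>z. \<integral>\<^sup>+x. F (config_of n x) * (G (config_of m z) * f (x, z)) \<partial>tuples \<nu> n) \<in> borel_measurable (tuples \<nu> m)"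
          by measurable
        then show ?thesis
          using XZ.nn_integral_snd[OF meas] by (simp add: nn_integral_cmult)
      qed
      also have "(\<integral>\<^sup>+w. F (config_of n (fst w)) * (G (config_of m (snd w)) * f w) \<partial>(tuples \<nu> n \<Otimes>\<^sub>M tuples \<nu> m)) =
          fact n * (fact m * (\<integral>\<^sup>+w. ennreal ((\<Prod>i=1..n. \<eta> i (fst w i)) * (\<Prod>k=1..m. \<theta> k (snd w k))) * f w \<partial>(tuples \<nu> n \<Otimes>\<^sub>M tuples \<nu> m)))"
        unfolding F_def G_def by (rule nn_integral_perm_prod_pair[OF sf \<eta> \<theta> f sym_x sym_z])
      also have "ennreal (1 / fact m) * (ennreal (1 / fact n) * (fact n * (fact m * I))) = I" for I
      proof -
        have 1: "ennreal (1 / fact k) * fact k = 1" for k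
          by (simp add: ennreal_fact[symmetric] ennreal_mult[symmetric])
        have "ennreal (1 / fact m) * (ennreal (1 / fact n) * (fact n * (fact m * I))) =
            (ennreal (1 / fact n) * fact n) * ((ennreal (1 / fact m) * fact m) * I)"
          by (simp only: mult_ac)
        then show ?thesis by (simp add: 1)
      qed
      finally show "(\<integral>\<^sup>+w. ennreal ((\<Prod>i=1..n. \<eta> i (fst w i)) * (\<Prod>k=1..m. \<theta> k (snd w k))) * f w \<partial>(tuples \<nu> n \<Otimes>\<^sub>M tuples \<nu> m)) =
          joint_moment n m \<eta> \<theta>" by simp
    qed
    then have "AE z in tuples \<nu> m. AE x in tuples \<nu> n. f (x, z) = ennreal (jf n m x z)"
      using AE_tuples_swap[OF sf f, of "\<lambda>w. ennreal (jf n m (fst w) (snd w))"] by simp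
    then show "proportional L n m"
      unfolding proportional_def f_def by (auto elim!: eventually_mono)
  qed
qed

end

theorem lemma3p1:
  fixes \<Lambda> :: "'a::euclidean_space set" and \<nu> :: "'a measure" and P :: "'w measure"
    and \<Phi> \<Xi> :: "'w \<Rightarrow> 'a multiset" and j :: "nat \<Rightarrow> (nat \<Rightarrow> 'a) \<Rightarrow> real"
    and p q :: real and ld lt :: "'a \<Rightarrow> 'a \<Rightarrow> real" and lc :: "'a \<Rightarrow> real"
  assumes "compact (closure \<Lambda>)" and "radon_on \<Lambda> \<nu>"
    and "prob_space P"
    and "simple_point_process P \<nu> \<Phi>" and "janossy_densities P \<nu> \<Phi> j"
    and "0 < p" and "p \<le> 1" and "q = 1 - p"
    and "shift_density \<nu> ld" and "\<And>z x. lt z x = p * ld z x"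
    and "measurement_process P \<nu> p ld lc \<Phi> \<Xi>"
  shows
    "(\<forall>J K. (\<forall>n m. joint_janossy_density P \<nu> \<Phi> \<Xi> n m (J n m)) \<and>
            (\<forall>m. observation_janossy_density P \<nu> \<Phi> \<Xi> m (K m)) \<longrightarrow>
        (\<forall>L. janossy_kernel \<nu> L \<longrightarrow>
           (conditional_janossy_densities P \<nu> \<Phi> \<Xi> L \<longleftrightarrow>
            (\<forall>n m. AE z in tuples \<nu> m. K m z \<noteq> 0 \<longrightarrow>
               (AE x in tuples \<nu> n. L (config_of m z) n x = J n m x z / K m z)))))
     \<and> (\<forall>n m. \<forall>J. (\<lambda>(x, z). J x z) \<in> borel_measurable (tuples \<nu> n \<Otimes>\<^sub>M tuples \<nu> m) \<longrightarrow>
          (joint_janossy_density P \<nu> \<Phi> \<Xi> n m J \<longleftrightarrow>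
           (AE (x, z) in tuples \<nu> n \<Otimes>\<^sub>M tuples \<nu> m.
              J x z = ennreal (joint_formula \<nu> j q lt lc n m x z))))
     \<and> (\<forall>m. \<forall>J. J \<in> borel_measurable (tuples \<nu> m) \<longrightarrow>
          (observation_janossy_density P \<nu> \<Phi> \<Xi> m J \<longleftrightarrow>
           (AE z in tuples \<nu> m. J z = observation_formula \<nu> j q lt lc m z)))"
proof -
  have ld: "(\<lambda>(z, x). ld z x) \<in> borel_measurable (\<nu> \<Otimes>\<^sub>M \<nu>)"
      "\<And>z x. z \<in> space \<nu> \<Longrightarrow> x \<in> space \<nu> \<Longrightarrow> 0 \<le> ld z x"
      "\<And>x. x \<in> space \<nu> \<Longrightarrow> (\<integral>\<^sup>+z. ennreal (ld z x) \<partial>\<nu>) = 1"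
    using \<open>shift_density \<nu> ld\<close> by (auto simp: shift_density_def)
  \<comment> \<open>Measurability, nonnegativity and integrability of \<open>lc\<close> come with
    the Poisson property of the clutter.\<close>
  obtain \<Psi> C where "poisson_process P \<nu> lc C"
    using \<open>measurement_process P \<nu> p ld lc \<Phi> \<Xi>\<close> unfolding measurement_process_def by blast
  then have lc: "lc \<in> borel_measurable \<nu>" "\<And>z. z \<in> space \<nu> \<Longrightarrow> 0 \<le> lc z" "(\<integral>\<^sup>+z. ennreal (lc z) \<partial>\<nu>) < \<infinity>"
    by (auto simp: poisson_process_def)
  interpret observed_process \<nu> j q lt lc P \<Phi> \<Xi> p ld
  proof (intro observed_process.intro detection_model.intro observed_process_axioms.intro)
    show "sigma_finite_measure \<nu>"
      by (rule radon_on_sigma_finite[OF assms(2)])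
    show "(\<lambda>(z, x). lt z x) \<in> borel_measurable (\<nu> \<Otimes>\<^sub>M \<nu>)"
      using ld(1) unfolding assms(10) case_prod_beta by measurable
    show "0 \<le> lt z x" if "z \<in> space \<nu>" "x \<in> space \<nu>" for z x
      using ld(2)[OF that] assms(6) by (simp add: assms(10))
    show "(\<integral>\<^sup>+z. ennreal (lt z x) \<partial>\<nu>) < \<infinity>" if x: "x \<in> space \<nu>" for x
    proof -
      have "(\<lambda>z. ld z x) \<in> borel_measurable \<nu>"
        using measurable_compose[OF measurable_Pair2'[OF x] ld(1)] by simp
      then have "(\<integral>\<^sup>+z. ennreal (lt z x) \<partial>\<nu>) = ennreal p * (\<integral>\<^sup>+z. ennreal (ld z x) \<partial>\<nu>)"
        using assms(6) by (simp add: assms(10) ennreal_mult' nn_integral_cmult)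
      then show ?thesis by (simp add: ld(3)[OF x])
    qed
    show "j n \<in> borel_measurable (tuples \<nu> n)" "symmetric_on_tuples \<nu> n (j n)" for n
      using assms(5) unfolding janossy_densities_def by blast+
    show "0 \<le> j n x" if "x \<in> space (tuples \<nu> n)" for n x
      using assms(5) that unfolding janossy_densities_def by blast
    show "0 \<le> q" "0 \<le> p"
      using assms(6-8) by simp_all
  qed (fact assms lc)+
  show ?thesis
  proof (intro conjI allI impI, elim conjE)
    fix J K L
    assume J: "\<forall>n m. joint_janossy_density P \<nu> \<Phi> \<Xi> n m (J n m)"
      and K: "\<forall>m. observation_janossy_density P \<nu> \<Phi> \<Xi> m (K m)"
      and L: "janossy_kernel \<nu> L"
    have J_meas: "(\<lambda>(x, z). J n m x z) \<in> borel_measurable (tuples \<nu> n \<Otimes>\<^sub>M tuples \<nu> m)" for n m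
      using J unfolding joint_janossy_density_def by blast
    have K_meas: "K m \<in> borel_measurable (tuples \<nu> m)" for m
      using K unfolding observation_janossy_density_def by blast
    \<comment> \<open>\<open>J\<close> and \<open>K\<close> are arbitrary versions of the two
      densities; they enter only through almost everywhere equality with the explicit
      formulas.\<close>
    have "(AE z in tuples \<nu> m. K m z \<noteq> 0 \<longrightarrow> (AE x in tuples \<nu> n. L (config_of m z) n x = J n m x z / K m z)) \<longleftrightarrow>
        proportional L n m" for n m
    proof (rule quotient_iff_proportional)
      show "AE w in tuples \<nu> n \<Otimes>\<^sub>M tuples \<nu> m. J n m (fst w) (snd w) = ennreal (jf n m (fst w) (snd w))"
        using J joint_janossy_density_iff[OF J_meas[of n m]] by (simp add: case_prod_beta)
      show "(\<lambda>w. J n m (fst w) (snd w)) \<in> borel_measurable (tuples \<nu> n \<Otimes>\<^sub>M tuples \<nu> m)"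
        using J_meas[of n m] by (simp add: case_prod_beta)
      show "AE z in tuples \<nu> m. K m z = obs m z"
        using K observation_janossy_density_iff[OF K_meas[of m]] by blast
    qed
    then show "conditional_janossy_densities P \<nu> \<Phi> \<Xi> L \<longleftrightarrow>
        (\<forall>n m. AE z in tuples \<nu> m. K m z \<noteq> 0 \<longrightarrow>
           (AE x in tuples \<nu> n. L (config_of m z) n x = J n m x z / K m z))"
      by (simp add: conditional_janossy_densities_iff[OF L])
  next
    fix n m and J :: "(nat \<Rightarrow> 'a) \<Rightarrow> (nat \<Rightarrow> 'a) \<Rightarrow> ennreal"
    assume "(\<lambda>(x, z). J x z) \<in> borel_measurable (tuples \<nu> n \<Otimes>\<^sub>M tuples \<nu> m)"
    then show "joint_janossy_density P \<nu> \<Phi> \<Xi> n m J \<longleftrightarrow>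
        (AE (x, z) in tuples \<nu> n \<Otimes>\<^sub>M tuples \<nu> m. J x z = ennreal (jf n m x z))"
      by (rule joint_janossy_density_iff)
  next
    fix m and J :: "(nat \<Rightarrow> 'a) \<Rightarrow> ennreal"
    assume "J \<in> borel_measurable (tuples \<nu> m)"
    then show "observation_janossy_density P \<nu> \<Phi> \<Xi> m J \<longleftrightarrow> (AE z in tuples \<nu> m. J z = obs m z)"
      by (rule observation_janossy_density_iff)
  qed
qed

end
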